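(* Let $\lambda\in(0,1)$, fix any $\varrho\in(0,1)$ and $c>0$. For the stationary last passage percolation model with parameter $\varrho$ from the line $\mathcal{L}^\infty_\lambda$, let $\widetilde Z^{{\rm stat},\varrho}(x)$ denote the exit point of the last passage path from $\mathcal{L}^\infty_\lambda$ to the point $P^\varrho(x)=((1-\varrho)^2N+x,\varrho^2N-x)$. Then there exist $M_0=M_0(c,\lambda,\varrho)$ and constants $C_1=C_1(\lambda,\varrho)>0$, $C_2=C_2(\lambda,\varrho)>0$ such that for all $M\geq M_0$, $$\mathbb{P}\left(\left|\widetilde Z^{{\rm stat},\varrho}(cN^{1/3})\right|\geq MN^{2/3}\right)\leq C_1e^{-C_2M^2},$$ uniformly for all large $N$ (i.e. for all $N\geq N_0$ with $N_0$ not depending on $M$).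
   Context: Last passage percolation: let $\{\omega_{i,j}\}_{i,j\in\mathbb{Z}}$ be i.i.d. ${\rm Exp}(1)$ random variables. For lattice points $a,b$, an up-right path from $a$ to $b$ is a sequence $\pi(0)=a,\dots,\pi(n)=b$ in $\mathbb{Z}^2$ with increments in $\{(1,0),(0,1)\}$, and $L_{a\to b}=\max_\pi\sum_{(i,j)\in\pi\setminus\{a\}}\omega_{i,j}$ over such paths ($-\infty$ if there are none). Non-integer coordinates of points are replaced by their integer parts. The line is $\mathcal{L}^\infty_\lambda=\{\mathbf{p}_k: k\in\mathbb{Z}\}$ with $\mathbf{p}_k=(\lfloor\tfrac{\lambda-1}{\lambda}k\rfloor,k)$. Stationary model with parameter $\varrho\in(0,1)$: let $\{p_i,q_i\}_{i\in\mathbb{Z}}$ be independent random variables, independent of the $\omega_{i,j}$, with $p_i\sim{\rm Exp}(1-\varrho)$ and $q_i\sim{\rm Exp}(\varrho)$ (the parameter being the rate). Put $h_k=\lfloor(\lambda-1)k/\lambda\rfloor$ and define boundary weights $\omega^\varrho(0)=0$, $$\omega^\varrho(k)=\sum_{i=1}^{h_k}p_i-\sum_{i=k+1}^{0}q_i\quad (k<0),\qquad \omega^\varrho(k)=-\sum_{i=h_k+1}^{0}p_i+\sum_{i=1}^{k}q_i\quad (k>0).$$ The stationary last passage time from $\mathcal{L}^\infty_\lambda$ to a point $b$ is $L^{{\rm stat},\varrho}_{\mathcal{L}^\infty_\lambda\to b}=\max_{k\in\mathbb{Z}}\{L_{\mathbf{p}_k\to b}+\omega^\varrho(k)\}$,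 and the exit point to $b$ is the (a.s. unique) maximizing index $k$, so $\widetilde Z^{{\rm stat},\varrho}(x)=\operatorname{argmax}_{k\in\mathbb{Z}}\{L_{\mathbf{p}_k\to P^\varrho(x)}+\omega^\varrho(k)\}$. *)

theory Defs
  imports "HOL-Probability.Probability"
begin

definition up_right_path :: "int \<times> int \<Rightarrow> int \<times> int \<Rightarrow> (int \<times> int) list \<Rightarrow> bool" where
  "up_right_path a b \<pi> \<longleftrightarrow> \<pi> \<noteq> [] \<and> hd \<pi> = a \<and> last \<pi> = b \<and>
     successively (\<lambda>u v. v - u \<in> {(1, 0), (0, 1)}) \<pi>"

text \<open>A path never revisits a vertex, so it may be summed over as a set.  There are only finitely
  many paths from \<open>a\<close> to \<open>b\<close>, so the supremum is a maximum if there is a path at all, and it is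
  \<open>-\<infinity>\<close> otherwise.\<close>

definition last_passage_time :: "(int \<times> int \<Rightarrow> real) \<Rightarrow> int \<times> int \<Rightarrow> int \<times> int \<Rightarrow> ereal" where
  "last_passage_time w a b = (SUP \<pi>\<in>{\<pi>. up_right_path a b \<pi>}. ereal (\<Sum>z\<in>set \<pi> - {a}. w z))"

definition line_abscissa :: "real \<Rightarrow> int \<Rightarrow> int" where
  "line_abscissa lam k = \<lfloor>(lam - 1) / lam * of_int k\<rfloor>"

definition line_point :: "real \<Rightarrow> int \<Rightarrow> int \<times> int" where
  "line_point lam k = (line_abscissa lam k, k)"

definition boundary_weight :: "real \<Rightarrow> (int \<Rightarrow> real) \<Rightarrow> (int \<Rightarrow> real) \<Rightarrow> int \<Rightarrow> real" where
  "boundary_weight lam p q k =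
     (if k < 0 then (\<Sum>i = 1..line_abscissa lam k. p i) - (\<Sum>i = k + 1..0. q i)
      else if k > 0 then - (\<Sum>i = line_abscissa lam k + 1..0. p i) + (\<Sum>i = 1..k. q i)
      else 0)"

text \<open>The maximizer is almost surely unique (whenever some point of the line lies below and to the
  left of \<open>b\<close>); on the exceptional null set \<open>arg_max\<close> picks one maximizer.  The choice depends only
  on the set of maximizers, so the exit point is a measurable function of the weights.\<close>

definition exit_point ::
  "real \<Rightarrow> (int \<times> int \<Rightarrow> real) \<Rightarrow> (int \<Rightarrow> real) \<Rightarrow> (int \<Rightarrow> real) \<Rightarrow> int \<times> int \<Rightarrow> int" where
  "exit_point lam w p q b =
     arg_max (\<lambda>k. last_passage_time w (line_point lam k) b + ereal (boundary_weight lam p q k))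
       (\<lambda>k. True)"

definition end_point :: "real \<Rightarrow> nat \<Rightarrow> real \<Rightarrow> int \<times> int" where
  "end_point \<rho> N x = (\<lfloor>(1 - \<rho>)\<^sup>2 * real N + x\<rfloor>, \<lfloor>\<rho>\<^sup>2 * real N - x\<rfloor>)"

text \<open>All the variables \<open>\<omega>\<close>, \<open>p\<close>, \<open>q\<close> together form one independent family, indexed by the
  disjoint union of their index sets.\<close>

locale stationary_lpp = prob_space \<Omega> for \<Omega> :: "'a measure" +
  fixes \<rho> :: real
    and \<omega> :: "int \<times> int \<Rightarrow> 'a \<Rightarrow> real"
    and p q :: "int \<Rightarrow> 'a \<Rightarrow> real"
  assumes indep: "indep_vars (\<lambda>_. borel) (case_sum \<omega> (case_sum p q)) UNIV"
    and bulk: "\<And>z. distributed \<Omega> lborel (\<omega> z) (exponential_density 1)"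
    and horizontal: "\<And>i. distributed \<Omega> lborel (p i) (exponential_density (1 - \<rho>))"
    and vertical: "\<And>i. distributed \<Omega> lborel (q i) (exponential_density \<rho>)"

end

theory Submission
  imports Defs
begin

text \<open>
  The proof follows the coupling method of Emrah, Janjigian and Seppalainen.  Replace \<open>\<rho>\<close> by \<open>r\<^sub>1\<close> in
  the boundary weights north-west of the origin and by \<open>r\<^sub>2\<close> south-east of it, by rescaling the same
  variables.  Burke's theorem and a change of measure give the exact identity
  \<open>E exp ((r\<^sub>1 - r\<^sub>2) G) = ((1 - r\<^sub>2) / (1 - r\<^sub>1))\<^sup>m (r\<^sub>1 / r\<^sub>2)\<^sup>n\<close> for the passage time \<open>G\<close> to \<open>(m, n)\<close>, and
  its exponent is \<open>(r\<^sub>1 - r\<^sub>2) (m / (1 - \<xi>) + n / \<xi>)\<close> for some \<open>\<xi>\<close> between the parameters.  In the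
  characteristic direction the last factor is \<open>N (1 + (\<xi> - \<rho>)\<^sup>2 / (\<xi> (1 - \<xi>)))\<close>.

  If the exit point is at least \<open>K\<close>, some maximizer is still at least \<open>K\<close> for the parameters
  \<open>(\<rho> - \<delta>, \<rho>)\<close>, which favour large exit points.  Passing on to \<open>(\<rho> - 2\<delta>, \<rho> - 3\<delta>)\<close> then raises the
  passage time by at least the change of the boundary weight at \<open>K\<close>, which is of order \<open>\<delta> K\<close>.  For \<open>\<delta>\<close>
  a small multiple of \<open>K / N\<close> this beats the change of the mean, which is of order \<open>N \<delta>\<^sup>2\<close>, so one of the
  two passage times deviates by order \<open>K\<^sup>2 / N\<close> in the direction that the identity controls with
  exponential rate \<open>\<delta>\<close>; the exponent is of order \<open>K\<^sup>3 / N\<^sup>2\<close>.  Exit points below \<open>-K\<close> are treated in the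
  same way with \<open>(\<rho>, \<rho> + \<delta>)\<close> and \<open>(\<rho> + 3\<delta>, \<rho> + 2\<delta>)\<close>.
\<close>

section \<open>The corner flip preserves exponential weights\<close>

text \<open>The exact moment is available only at the exponent r1 - r2, which is tied to the
  parameters. An ordered pair therefore controls one tail: the lower one if r1 < r2, the upper one
  if r1 > r2. This is why the first pair of parameters increases and the second decreases. The
  obstacle is the discreteness of the line. The identity concerns a field on all lattice points, and
  this agrees with the maximum over exits from the line only up to a few weights next to the line:
  the field may leave between two line points, and a path may climb along a vertical stretch of the
  line. These weights are truncated at a level \<open>B\<close>, so that the error is
  \<open>B\<close> times a constant depending on the slope only. For K of order M N^(2/3), both
  \<delta> K and N \<delta>^2 are of order M^2 N^(1/3), so \<open>B\<close> may be a small multiple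
  of that, and the union bound over order N sites costs a factor that the exponential absorbs. Exits
  at distance beyond order N cannot occur. This confines M to order N^(1/3), which keeps all shifted
  parameters inside (0, 1).\<close>

text \<open>The map is a piecewise linear involution with Jacobian \<open>\<plusminus>1\<close>: on each of the two pieces it is a
  translation in one variable followed by a permutation of the coordinates.\<close>

lemma nn_integral_lborel_flip:
  fixes g :: "real \<Rightarrow> real \<Rightarrow> real \<Rightarrow> ennreal"
  assumes [measurable]: "(\<lambda>(x, y, z). g x y z) \<in> borel_measurable (borel \<Otimes>\<^sub>M borel \<Otimes>\<^sub>M borel)"
  shows "(\<integral>\<^sup>+z. \<integral>\<^sup>+y. \<integral>\<^sup>+x. g (z + max 0 (x - y)) (z + max 0 (y - x)) (min x y) \<partial>lborel \<partial>lborel \<partial>lborel)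
       = (\<integral>\<^sup>+z. \<integral>\<^sup>+y. \<integral>\<^sup>+x. g x y z \<partial>lborel \<partial>lborel \<partial>lborel)" (is "?L = ?R")
proof -
  have g_meas [measurable]: "(\<lambda>w. g (a w) (b w) (c w)) \<in> borel_measurable M"
    if [measurable]: "a \<in> borel_measurable M" "b \<in> borel_measurable M" "c \<in> borel_measurable M"
    for a b c and M :: "'b measure"
  proof -
    have "(\<lambda>w. (\<lambda>(x, y, z). g x y z) (a w, b w, c w)) \<in> borel_measurable M"
      by measurable
    then show ?thesis by simp
  qed
  let ?A = "\<lambda>x y z. g (z + max 0 (x - y)) (z + max 0 (y - x)) (min x y)"
  let ?gt = "\<lambda>x y::real. if y < x then 1 else 0 :: ennreal"
  let ?le = "\<lambda>x y::real. if x \<le> y then 1 else 0 :: ennreal"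
  have L: "?L = (\<integral>\<^sup>+z. \<integral>\<^sup>+y. \<integral>\<^sup>+x. ?gt x y * ?A x y z \<partial>lborel \<partial>lborel \<partial>lborel)
      + (\<integral>\<^sup>+z. \<integral>\<^sup>+y. \<integral>\<^sup>+x. ?le x y * ?A x y z \<partial>lborel \<partial>lborel \<partial>lborel)"
    by (subst nn_integral_add[symmetric], measurable, intro nn_integral_cong,
        subst nn_integral_add[symmetric], measurable, intro nn_integral_cong,
        subst nn_integral_add[symmetric], measurable, intro nn_integral_cong, auto)
  have R: "?R = (\<integral>\<^sup>+z. \<integral>\<^sup>+y. \<integral>\<^sup>+x. ?gt x y * g x y z \<partial>lborel \<partial>lborel \<partial>lborel)
      + (\<integral>\<^sup>+z. \<integral>\<^sup>+y. \<integral>\<^sup>+x. ?le x y * g x y z \<partial>lborel \<partial>lborel \<partial>lborel)"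
    by (subst nn_integral_add[symmetric], measurable, intro nn_integral_cong,
        subst nn_integral_add[symmetric], measurable, intro nn_integral_cong,
        subst nn_integral_add[symmetric], measurable, intro nn_integral_cong, auto)
  have "(\<integral>\<^sup>+z. \<integral>\<^sup>+y. \<integral>\<^sup>+x. ?gt x y * ?A x y z \<partial>lborel \<partial>lborel \<partial>lborel)
      = (\<integral>\<^sup>+z. \<integral>\<^sup>+y. \<integral>\<^sup>+x. ?gt x y * g (z - y + x) z y \<partial>lborel \<partial>lborel \<partial>lborel)"
    by (intro nn_integral_cong) (auto simp: diff_add_eq intro!: arg_cong[where f = "\<lambda>u. g u _ _"])
  also have "\<dots> = (\<integral>\<^sup>+z. \<integral>\<^sup>+y. \<integral>\<^sup>+x. ?gt x z * g x z y \<partial>lborel \<partial>lborel \<partial>lborel)"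
  proof (rule nn_integral_cong, rule nn_integral_cong)
    fix z y :: real
    have "(\<integral>\<^sup>+x. ?gt x z * g x z y \<partial>lborel)
      = (\<integral>\<^sup>+x. ?gt ((z - y) + 1 * x) z * g ((z - y) + 1 * x) z y \<partial>lborel)"
      by (subst nn_integral_real_affine[where c = 1 and t = "z - y"]) auto
    also have "\<dots> = (\<integral>\<^sup>+x. ?gt x y * g (z - y + x) z y \<partial>lborel)"
      by (intro nn_integral_cong) auto
    finally show "(\<integral>\<^sup>+x. ?gt x y * g (z - y + x) z y \<partial>lborel) = (\<integral>\<^sup>+x. ?gt x z * g x z y \<partial>lborel)"
      by simp
  qed
  also have "\<dots> = (\<integral>\<^sup>+z. \<integral>\<^sup>+y. \<integral>\<^sup>+x. ?gt x y * g x y z \<partial>lborel \<partial>lborel \<partial>lborel)"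
    by (rule lborel_pair.Fubini') measurable
  finally have 1: "(\<integral>\<^sup>+z. \<integral>\<^sup>+y. \<integral>\<^sup>+x. ?gt x y * ?A x y z \<partial>lborel \<partial>lborel \<partial>lborel)
    = (\<integral>\<^sup>+z. \<integral>\<^sup>+y. \<integral>\<^sup>+x. ?gt x y * g x y z \<partial>lborel \<partial>lborel \<partial>lborel)" .
  have "(\<integral>\<^sup>+z. \<integral>\<^sup>+y. \<integral>\<^sup>+x. ?le x y * ?A x y z \<partial>lborel \<partial>lborel \<partial>lborel)
      = (\<integral>\<^sup>+z. \<integral>\<^sup>+x. \<integral>\<^sup>+y. ?le x y * ?A x y z \<partial>lborel \<partial>lborel \<partial>lborel)"
    by (rule nn_integral_cong, rule lborel_pair.Fubini') measurable
  also have "\<dots> = (\<integral>\<^sup>+z. \<integral>\<^sup>+x. \<integral>\<^sup>+y. ?le x y * g z (z - x + y) x \<partial>lborel \<partial>lborel \<partial>lborel)"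
    by (intro nn_integral_cong) (auto simp: algebra_simps max_def min_def)
  also have "\<dots> = (\<integral>\<^sup>+z. \<integral>\<^sup>+x. \<integral>\<^sup>+y. ?le z y * g z y x \<partial>lborel \<partial>lborel \<partial>lborel)"
  proof (rule nn_integral_cong, rule nn_integral_cong)
    fix z x :: real
    have "(\<integral>\<^sup>+y. ?le z y * g z y x \<partial>lborel)
      = (\<integral>\<^sup>+y. ?le z ((z - x) + 1 * y) * g z ((z - x) + 1 * y) x \<partial>lborel)"
      by (subst nn_integral_real_affine[where c = 1 and t = "z - x"]) auto
    also have "\<dots> = (\<integral>\<^sup>+y. ?le x y * g z (z - x + y) x \<partial>lborel)"
      by (intro nn_integral_cong) auto
    finally show "(\<integral>\<^sup>+y. ?le x y * g z (z - x + y) x \<partial>lborel) = (\<integral>\<^sup>+y. ?le z y * g z y x \<partial>lborel)"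
      by simp
  qed
  also have "\<dots> = (\<integral>\<^sup>+z. \<integral>\<^sup>+x. \<integral>\<^sup>+y. ?le x y * g x y z \<partial>lborel \<partial>lborel \<partial>lborel)"
    by (rule lborel_pair.Fubini') measurable
  also have "\<dots> = (\<integral>\<^sup>+z. \<integral>\<^sup>+y. \<integral>\<^sup>+x. ?le x y * g x y z \<partial>lborel \<partial>lborel \<partial>lborel)"
    by (rule nn_integral_cong, rule lborel_pair.Fubini') measurable
  finally show ?thesis using L R 1 by simp
qed

section \<open>Exponential laws and their invariance under the flip\<close>

definition expo :: "real \<Rightarrow> real measure" where
  "expo r = density lborel (\<lambda>x. ennreal (exponential_density r x))"

lemma sets_expo [measurable_cong, simp]: "sets (expo r) = sets borel"
  by (simp add: expo_def)

lemma space_expo [simp]: "space (expo r) = UNIV"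
  by (simp add: expo_def)

lemma prob_space_expo: "0 < r \<Longrightarrow> prob_space (expo r)"
  unfolding expo_def by (rule prob_space_exponential_density)

lemma nn_integral_expo:
  assumes [measurable]: "f \<in> borel_measurable borel"
  shows "(\<integral>\<^sup>+x. f x \<partial>expo r) = (\<integral>\<^sup>+x. ennreal (exponential_density r x) * f x \<partial>lborel)"
  unfolding expo_def by (rule nn_integral_density) auto

text \<open>The three rates satisfy (1 - r) + r = 1. Therefore the exponent (1 - r) x + r y + z
  keeps its value under the flip, and so does membership in the nonnegative octant; the joint
  density is invariant and the Lebesgue identity applies.\<close>

lemma nn_integral_expo_flip:
  fixes g :: "real \<Rightarrow> real \<Rightarrow> real \<Rightarrow> ennreal"
  assumes [measurable]: "(\<lambda>(x, y, z). g x y z) \<in> borel_measurable (borel \<Otimes>\<^sub>M borel \<Otimes>\<^sub>M borel)"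
    and r: "0 < r" "r < 1"
  shows "(\<integral>\<^sup>+z. \<integral>\<^sup>+y. \<integral>\<^sup>+x. g (z + max 0 (x - y)) (z + max 0 (y - x)) (min x y)
            \<partial>expo (1 - r) \<partial>expo r \<partial>expo 1)
       = (\<integral>\<^sup>+z. \<integral>\<^sup>+y. \<integral>\<^sup>+x. g x y z \<partial>expo (1 - r) \<partial>expo r \<partial>expo 1)"
proof -
  have g_meas [measurable]: "(\<lambda>w. g (a w) (b w) (c w)) \<in> borel_measurable M"
    if [measurable]: "a \<in> borel_measurable M" "b \<in> borel_measurable M" "c \<in> borel_measurable M"
    for a b c and M :: "'b measure"
  proof -
    have "(\<lambda>w. (\<lambda>(x, y, z). g x y z) (a w, b w, c w)) \<in> borel_measurable M"
      by measurable
    then show ?thesis by simp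
  qed
  define D where "D = (\<lambda>x y z. exponential_density 1 z *
    (exponential_density r y * exponential_density (1 - r) x))"
  have [measurable]: "(\<lambda>(x, y, z). D x y z) \<in> borel_measurable (borel \<Otimes>\<^sub>M borel \<Otimes>\<^sub>M borel)"
    unfolding D_def by measurable
  have D_flip: "D (z + max 0 (x - y)) (z + max 0 (y - x)) (min x y) = D x y z" for x y z
  proof (cases "x < 0 \<or> y < 0 \<or> z < 0")
    case True
    then show ?thesis
      by (auto simp: D_def exponential_density_def max_def min_def)
  next
    case False
    then show ?thesis
      using r by (cases "x \<le> y") (simp_all add: D_def exponential_density_def algebra_simps
          max_def min_def flip: exp_add)
  qed
  have lift: "(\<integral>\<^sup>+z. \<integral>\<^sup>+y. \<integral>\<^sup>+x. h x y z \<partial>expo (1 - r) \<partial>expo r \<partial>expo 1)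
     = (\<integral>\<^sup>+z. \<integral>\<^sup>+y. \<integral>\<^sup>+x. ennreal (D x y z) * h x y z \<partial>lborel \<partial>lborel \<partial>lborel)"
    if [measurable]: "(\<lambda>(x, y, z). h x y z) \<in> borel_measurable (borel \<Otimes>\<^sub>M borel \<Otimes>\<^sub>M borel)"
    for h :: "real \<Rightarrow> real \<Rightarrow> real \<Rightarrow> ennreal"
  proof -
    have [measurable]: "(\<lambda>w. h (a w) (b w) (c w)) \<in> borel_measurable M"
      if [measurable]: "a \<in> borel_measurable M" "b \<in> borel_measurable M" "c \<in> borel_measurable M"
      for a b c and M :: "'b measure"
    proof -
      have "(\<lambda>w. (\<lambda>(x, y, z). h x y z) (a w, b w, c w)) \<in> borel_measurable M"
        by measurable
      then show ?thesis by simp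
    qed
    show ?thesis
      using r by (simp add: nn_integral_expo D_def ennreal_mult'' exponential_density_nonneg
          ennreal_mult mult.assoc nn_integral_cmult[symmetric])
  qed
  show ?thesis
  proof -
    have "(\<lambda>(x, y, z). ennreal (D x y z) * g x y z) \<in> borel_measurable (borel \<Otimes>\<^sub>M borel \<Otimes>\<^sub>M borel)"
      by (simp add: split_def D_def)
    from nn_integral_lborel_flip[OF this] show ?thesis
      by (simp add: lift D_flip)
  qed
qed

text \<open>One step of the last passage recursion for the increments \<open>I\<close>, \<open>J\<close> along a corner and the bulk weight
  at \<open>e3\<close>.  Storing \<open>min I J\<close> in place of the used weight makes the map measure preserving on the whole
  family of weights, so that Burke's theorem follows by composing flips.\<close>

definition corner_flip :: "'i \<Rightarrow> 'i \<Rightarrow> 'i \<Rightarrow> ('i \<Rightarrow> real) \<Rightarrow> 'i \<Rightarrow> real" where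
  "corner_flip e1 e2 e3 f = f(e3 := min (f e1) (f e2), e2 := f e3 + max 0 (f e2 - f e1),
     e1 := f e3 + max 0 (f e1 - f e2))"

lemma corner_flip_measurable:
  assumes "e1 \<in> K" "e2 \<in> K" "e3 \<in> K"
  shows "corner_flip e1 e2 e3 \<in> measurable (PiM K (\<lambda>e. expo (rate e))) (PiM K (\<lambda>e. expo (rate e)))"
proof -
  let ?M = "PiM K (\<lambda>e. expo (rate e))"
  have [measurable]: "(\<lambda>f. f e) \<in> borel_measurable ?M" if "e \<in> K" for e
    using measurable_component_singleton[OF that, of "\<lambda>e. expo (rate e)"]
    by (simp add: measurable_cong_sets[OF refl sets_expo])
  show ?thesis
    unfolding corner_flip_def
  proof (rule measurable_PiM_single')
    show "(\<lambda>f i. (f(e3 := min (f e1) (f e2), e2 := f e3 + max 0 (f e2 - f e1), e1 := f e3 + max 0 (f e1 - f e2))) i)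
      \<in> space ?M \<rightarrow> (\<Pi>\<^sub>E i\<in>K. space (expo (rate i)))"
      using assms by (auto simp: space_PiM PiE_def extensional_def)
    fix i assume "i \<in> K"
    then show "(\<lambda>f. (f(e3 := min (f e1) (f e2), e2 := f e3 + max 0 (f e2 - f e1), e1 := f e3 + max 0 (f e1 - f e2))) i) \<in> ?M \<rightarrow>\<^sub>M expo (rate i)"
      using assms by (cases "i = e1"; cases "i = e2"; cases "i = e3")
        (simp_all add: measurable_cong_sets[OF refl sets_expo])
  qed
qed

text \<open>Fubini isolates the three coordinates that the flip moves and freezes the rest as
  \<open>s\<close>; the rates at \<open>e1\<close>, \<open>e2\<close>, \<open>e3\<close> are those
  of the three-variable identity.\<close>

lemma nn_integral_corner_flip:
  fixes rate :: "'i \<Rightarrow> real"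
  assumes K: "finite K" "e1 \<in> K" "e2 \<in> K" "e3 \<in> K" "e1 \<noteq> e2" "e1 \<noteq> e3" "e2 \<noteq> e3"
    and r: "0 < r" "r < 1"
    and rate: "\<And>e. 0 < rate e" "rate e1 = 1 - r" "rate e2 = r" "rate e3 = 1"
    and f: "f \<in> borel_measurable (PiM K (\<lambda>e. expo (rate e)))"
  shows "(\<integral>\<^sup>+s. f (corner_flip e1 e2 e3 s) \<partial>PiM K (\<lambda>e. expo (rate e)))
    = (\<integral>\<^sup>+s. f s \<partial>PiM K (\<lambda>e. expo (rate e)))"
proof -
  let ?M = "\<lambda>e. expo (rate e)"
  interpret product_sigma_finite ?M
    by (simp add: product_sigma_finite_def prob_space_expo rate prob_space_imp_sigma_finite)
  define K' where "K' = K - {e1, e2, e3}"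
  have K': "finite K'" "e1 \<notin> K'" "e2 \<notin> K'" "e3 \<notin> K'"
    and K_eq: "K = insert e1 (insert e2 (insert e3 K'))"
    using K by (auto simp: K'_def)
  have expand: "(\<integral>\<^sup>+s. h s \<partial>PiM K ?M)
     = (\<integral>\<^sup>+s. \<integral>\<^sup>+z. \<integral>\<^sup>+y. \<integral>\<^sup>+x. h (s(e3 := z, e2 := y, e1 := x)) \<partial>?M e1 \<partial>?M e2 \<partial>?M e3 \<partial>PiM K' ?M)"
    if h [measurable]: "h \<in> borel_measurable (PiM K ?M)" for h :: "_ \<Rightarrow> ennreal"
  proof -
    have h' [measurable]: "h \<in> borel_measurable (PiM (insert e1 (insert e2 (insert e3 K'))) ?M)"
      using h unfolding K_eq .
    have M1: "(\<lambda>x. \<integral>\<^sup>+ y. h (x(e1 := y)) \<partial>?M e1) \<in> borel_measurable (PiM (insert e2 (insert e3 K')) ?M)"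
    proof (rule sigma_finite_measure.borel_measurable_nn_integral)
      show "sigma_finite_measure (?M e1)" by (rule sigma_finite_measures)
      show "(\<lambda>(x, y). h (x(e1 := y))) \<in> borel_measurable (Pi\<^sub>M (insert e2 (insert e3 K')) ?M \<Otimes>\<^sub>M ?M e1)"
        using measurable_compose[OF measurable_add_dim h'] by (simp add: split_def)
    qed
    have M2: "(\<lambda>x. \<integral>\<^sup>+ y. \<integral>\<^sup>+ xa. h (x(e2 := y, e1 := xa)) \<partial>?M e1 \<partial>?M e2) \<in> borel_measurable (PiM (insert e3 K') ?M)"
    proof (rule sigma_finite_measure.borel_measurable_nn_integral)
      show "sigma_finite_measure (?M e2)" by (rule sigma_finite_measures)
      show "(\<lambda>(x, y). \<integral>\<^sup>+ xa. h (x(e2 := y, e1 := xa)) \<partial>?M e1) \<in> borel_measurable (Pi\<^sub>M (insert e3 K') ?M \<Otimes>\<^sub>M ?M e2)"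
        using measurable_compose[OF measurable_add_dim M1] by (simp add: split_def)
    qed
    show ?thesis
      unfolding K_eq using K K'
      by (simp add: product_nn_integral_insert h' M1 M2)
  qed
  have f1: "(\<lambda>s. f (corner_flip e1 e2 e3 s)) \<in> borel_measurable (PiM K ?M)"
    using K by (intro measurable_compose[OF corner_flip_measurable f])
  show ?thesis
    unfolding expand[OF f1] expand[OF f]
  proof (rule nn_integral_cong)
    fix s assume s: "s \<in> space (PiM K' ?M)"
    have meas: "(\<lambda>(x, y, z). f (s(e3 := z, e2 := y, e1 := x))) \<in> borel_measurable (borel \<Otimes>\<^sub>M borel \<Otimes>\<^sub>M borel)"
    proof -
      have "(\<lambda>(x, y, z). s(e3 := z, e2 := y, e1 := x)) \<in> borel \<Otimes>\<^sub>M borel \<Otimes>\<^sub>M borel \<rightarrow>\<^sub>M PiM K ?M"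
      proof (rule measurable_PiM_single')
        show "(\<lambda>w i. (case w of (x, y, z) \<Rightarrow> s(e3 := z, e2 := y, e1 := x)) i)
          \<in> space (borel \<Otimes>\<^sub>M borel \<Otimes>\<^sub>M borel) \<rightarrow> (\<Pi>\<^sub>E i\<in>K. space (?M i))"
          using s by (auto simp: K_eq space_PiM PiE_def extensional_def)
        fix i assume "i \<in> K"
        show "(\<lambda>w. (case w of (x, y, z) \<Rightarrow> s(e3 := z, e2 := y, e1 := x)) i) \<in> borel \<Otimes>\<^sub>M borel \<Otimes>\<^sub>M borel \<rightarrow>\<^sub>M ?M i"
          by (cases "i = e1"; cases "i = e2"; cases "i = e3")
            (simp_all add: split_def measurable_cong_sets[OF refl sets_expo])
      qed
      from measurable_compose[OF this f] show ?thesis by (simp add: split_def)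
    qed
    show "(\<integral>\<^sup>+z. \<integral>\<^sup>+y. \<integral>\<^sup>+x. f (corner_flip e1 e2 e3 (s(e3 := z, e2 := y, e1 := x))) \<partial>?M e1 \<partial>?M e2 \<partial>?M e3)
      = (\<integral>\<^sup>+z. \<integral>\<^sup>+y. \<integral>\<^sup>+x. f (s(e3 := z, e2 := y, e1 := x)) \<partial>?M e1 \<partial>?M e2 \<partial>?M e3)"
      using nn_integral_expo_flip[OF meas r] K
      by (simp add: corner_flip_def rate fun_upd_twist)
  qed
qed

section \<open>Exponential moments and changes of density on product spaces\<close>

lemma emeasure_expo_UNIV: "0 < r \<Longrightarrow> emeasure (expo r) UNIV = 1"
  using prob_space.emeasure_space_1[OF prob_space_expo] by simp

lemma nn_integral_expo_exp:
  assumes "0 < r" "t < r"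
  shows "(\<integral>\<^sup>+x. ennreal (exp (t * x)) \<partial>expo r) = ennreal (r / (r - t))"
proof -
  have eq: "exponential_density r x * exp (t * x) = r / (r - t) * exponential_density (r - t) x" for x
  proof -
    have "exp (- x * (r - t)) = exp (- x * r) * exp (t * x)"
      by (simp add: algebra_simps flip: exp_add)
    then show ?thesis
      using assms by (simp add: exponential_density_def)
  qed
  have "(\<integral>\<^sup>+x. ennreal (exp (t * x)) \<partial>expo r)
      = (\<integral>\<^sup>+x. ennreal (r / (r - t)) * ennreal (exponential_density (r - t) x) \<partial>lborel)"
    using assms by (simp add: nn_integral_expo eq exponential_density_nonneg flip: ennreal_mult)
  also have "\<dots> = ennreal (r / (r - t)) * (\<integral>\<^sup>+x. 1 \<partial>expo (r - t))"
    by (subst nn_integral_cmult) (auto simp: nn_integral_expo simp del: nn_integral_const)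
  finally show ?thesis
    using assms by (simp add: emeasure_expo_UNIV)
qed

lemma expo_eq_density:
  assumes "0 < r" "0 < r'"
  shows "expo r' = density (expo r) (\<lambda>x. ennreal (r' / r * exp ((r - r') * x)))"
proof -
  have "density (expo r) (\<lambda>x. ennreal (r' / r * exp ((r - r') * x))) =
      density lborel (\<lambda>x. ennreal (exponential_density r x) * ennreal (r' / r * exp ((r - r') * x)))"
    unfolding expo_def by (rule density_density_eq) auto
  also have "\<dots> = expo r'"
    unfolding expo_def
    using assms by (intro arg_cong[where f = "density lborel"] ext)
      (simp add: exponential_density_def algebra_simps flip: exp_add ennreal_mult)
  finally show ?thesis by simp
qed

text \<open>A product measure is determined by its values on boxes, where both sides factor into
  one-dimensional integrals.\<close>

lemma PiM_density:
  fixes M :: "'i \<Rightarrow> 'b measure" and w :: "'i \<Rightarrow> 'b \<Rightarrow> ennreal"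
  assumes fin: "finite I"
    and M: "\<And>i. sigma_finite_measure (M i)"
    and D: "\<And>i. sigma_finite_measure (density (M i) (w i))"
    and w [measurable]: "\<And>i. w i \<in> borel_measurable (M i)"
  shows "PiM I (\<lambda>i. density (M i) (w i)) = density (PiM I M) (\<lambda>x. \<Prod>i\<in>I. w i (x i))"
proof -
  interpret M: product_sigma_finite M
    using M by (simp add: product_sigma_finite_def)
  interpret D: product_sigma_finite "\<lambda>i. density (M i) (w i)"
    using D by (simp add: product_sigma_finite_def)
  have wm [measurable]: "(\<lambda>x. \<Prod>i\<in>I. w i (x i)) \<in> borel_measurable (PiM I M)"
    by (intro borel_measurable_prod_ennreal measurable_compose[OF measurable_component_singleton]) auto
  have "density (PiM I M) (\<lambda>x. \<Prod>i\<in>I. w i (x i)) = PiM I (\<lambda>i. density (M i) (w i))"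
  proof (rule D.PiM_eqI[OF fin])
    show "sets (density (PiM I M) (\<lambda>x. \<Prod>i\<in>I. w i (x i))) = sets (PiM I (\<lambda>i. density (M i) (w i)))"
      by (simp cong: sets_PiM_cong)
    fix A assume A: "\<And>i. i \<in> I \<Longrightarrow> A i \<in> sets (density (M i) (w i))"
    then have A' [measurable]: "\<And>i. i \<in> I \<Longrightarrow> A i \<in> sets (M i)" by simp
    have "Pi\<^sub>E I A \<in> sets (PiM I M)"
      using fin A' by (rule sets_PiM_I_finite)
    then have "emeasure (density (PiM I M) (\<lambda>x. \<Prod>i\<in>I. w i (x i))) (Pi\<^sub>E I A)
       = (\<integral>\<^sup>+x. (\<Prod>i\<in>I. w i (x i)) * indicator (Pi\<^sub>E I A) x \<partial>PiM I M)"
      by (simp add: emeasure_density)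
    also have "\<dots> = (\<integral>\<^sup>+x. (\<Prod>i\<in>I. w i (x i) * indicator (A i) (x i)) \<partial>PiM I M)"
    proof (rule nn_integral_cong)
      fix x assume "x \<in> space (PiM I M)"
      then have "x \<in> extensional I" by (auto simp: space_PiM PiE_def)
      then show "(\<Prod>i\<in>I. w i (x i)) * indicator (Pi\<^sub>E I A) x
          = (\<Prod>i\<in>I. w i (x i) * (indicator (A i) (x i) :: ennreal))"
        using fin by (auto simp: prod.distrib indicator_def PiE_def Pi_def)
    qed
    also have "\<dots> = (\<Prod>i\<in>I. \<integral>\<^sup>+x. w i x * indicator (A i) x \<partial>M i)"
      using fin A' by (intro M.product_nn_integral_prod) auto
    also have "\<dots> = (\<Prod>i\<in>I. emeasure (density (M i) (w i)) (A i))"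
      using A' by (intro prod.cong) (auto simp: emeasure_density)
    finally show "emeasure (density (PiM I M) (\<lambda>x. \<Prod>i\<in>I. w i (x i))) (Pi\<^sub>E I A)
      = (\<Prod>i\<in>I. emeasure (density (M i) (w i)) (A i))" .
  qed
  then show ?thesis by simp
qed

section \<open>The boundary value field and its moment generating function\<close>

type_synonym site = "(int \<times> int) + int + int"

abbreviation (input) bulk :: "int \<times> int \<Rightarrow> site" where "bulk z \<equiv> Inl z"
abbreviation (input) hor :: "int \<Rightarrow> site" where "hor i \<equiv> Inr (Inl i)"
abbreviation (input) ver :: "int \<Rightarrow> site" where "ver j \<equiv> Inr (Inr j)"

text \<open>Coordinates are relative to the corner \<open>(x0, y0)\<close> of a rectangle whose sides carry the boundary
  variables.  Below the line the predicate \<open>F\<close> holds and the increments are copied unchanged, so that the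
  increments along the line are the original boundary variables.\<close>

fun lpp_field :: "int \<Rightarrow> int \<Rightarrow> (nat \<Rightarrow> nat \<Rightarrow> bool) \<Rightarrow> (site \<Rightarrow> real) \<Rightarrow> nat \<Rightarrow> nat \<Rightarrow> real" where
  "lpp_field x0 y0 F f 0 0 = 0"
| "lpp_field x0 y0 F f (Suc i) 0 = lpp_field x0 y0 F f i 0 + f (hor (x0 + int (Suc i)))"
| "lpp_field x0 y0 F f 0 (Suc j) = lpp_field x0 y0 F f 0 j + f (ver (y0 + int (Suc j)))"
| "lpp_field x0 y0 F f (Suc i) (Suc j) =
    (if F (Suc i) (Suc j)
     then lpp_field x0 y0 F f (Suc i) j + lpp_field x0 y0 F f i (Suc j) - lpp_field x0 y0 F f i j
     else max (lpp_field x0 y0 F f i (Suc j)) (lpp_field x0 y0 F f (Suc i) j)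
       + f (bulk (x0 + int (Suc i), y0 + int (Suc j))))"

text \<open>Increments are updated in place: the \<open>hor\<close> slots hold the horizontal
  increments of the row reached so far, the \<open>ver\<close> slot of the current row holds the
  vertical increment at the current column, and used \<open>bulk\<close> slots hold the minima
  produced by the flips.\<close>

primrec sweep_row :: "int \<Rightarrow> int \<Rightarrow> (nat \<Rightarrow> nat \<Rightarrow> bool) \<Rightarrow> nat \<Rightarrow> nat \<Rightarrow> (site \<Rightarrow> real) \<Rightarrow> site \<Rightarrow> real" where
  "sweep_row x0 y0 F j 0 f = f"
| "sweep_row x0 y0 F j (Suc i) f =
    (let g = sweep_row x0 y0 F j i f
     in if F (Suc i) j then g
        else corner_flip (hor (x0 + int (Suc i))) (ver (y0 + int j)) (bulk (x0 + int (Suc i), y0 + int j)) g)"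

primrec sweep :: "int \<Rightarrow> int \<Rightarrow> (nat \<Rightarrow> nat \<Rightarrow> bool) \<Rightarrow> nat \<Rightarrow> nat \<Rightarrow> (site \<Rightarrow> real) \<Rightarrow> site \<Rightarrow> real" where
  "sweep x0 y0 F a 0 f = f"
| "sweep x0 y0 F a (Suc j) f = sweep_row x0 y0 F (Suc j) a (sweep x0 y0 F a j f)"

text \<open>Loop invariant of a row: columns before \<open>i\<close> already show the new row
  \<open>Suc j\<close>, later columns still show row \<open>j\<close>, and the vertical slot carries
  the difference between the two rows at column \<open>i\<close>. Slots not yet visited are intact,
  which the next row relies on.\<close>

lemma sweep_row_field:
  assumes A: "\<And>i. i < a \<Longrightarrow> g (hor (x0 + int (Suc i))) = lpp_field x0 y0 F f (Suc i) j - lpp_field x0 y0 F f i j"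
    and B: "\<And>j'. j < j' \<Longrightarrow> g (ver (y0 + int j')) = f (ver (y0 + int j'))"
    and C: "\<And>i' j'. j < j' \<Longrightarrow> g (bulk (x0 + int i', y0 + int j')) = f (bulk (x0 + int i', y0 + int j'))"
    and i: "i \<le> a"
  defines "H \<equiv> lpp_field x0 y0 F f"
  defines "g' \<equiv> sweep_row x0 y0 F (Suc j) i g"
  shows "(\<forall>i'<a. g' (hor (x0 + int (Suc i'))) =
            (if i' < i then H (Suc i') (Suc j) - H i' (Suc j) else H (Suc i') j - H i' j))
       \<and> g' (ver (y0 + int (Suc j))) = H i (Suc j) - H i j
       \<and> (\<forall>j'>Suc j. g' (ver (y0 + int j')) = f (ver (y0 + int j')))
       \<and> (\<forall>i' j'. Suc j < j' \<longrightarrow> g' (bulk (x0 + int i', y0 + int j')) = f (bulk (x0 + int i', y0 + int j')))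
       \<and> (\<forall>i'>i. g' (bulk (x0 + int i', y0 + int (Suc j))) = f (bulk (x0 + int i', y0 + int (Suc j))))"
  using i unfolding g'_def
proof (induction i)
  case 0
  then show ?case
    using A B[of "Suc j"] B C C[of "Suc j"] by (simp add: H_def)
next
  case (Suc i)
  define G where "G = sweep_row x0 y0 F (Suc j) i g"
  from Suc have IH1: "\<And>i'. i' < a \<Longrightarrow> G (hor (x0 + int (Suc i'))) =
            (if i' < i then H (Suc i') (Suc j) - H i' (Suc j) else H (Suc i') j - H i' j)"
     and IH2: "G (ver (y0 + int (Suc j))) = H i (Suc j) - H i j"
     and IH3: "\<And>j'. Suc j < j' \<Longrightarrow> G (ver (y0 + int j')) = f (ver (y0 + int j'))"
     and IH4: "\<And>i' j'. Suc j < j' \<Longrightarrow> G (bulk (x0 + int i', y0 + int j')) = f (bulk (x0 + int i', y0 + int j'))"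
     and IH5: "\<And>i'. i' > i \<Longrightarrow> G (bulk (x0 + int i', y0 + int (Suc j))) = f (bulk (x0 + int i', y0 + int (Suc j)))"
    unfolding G_def by auto
  have ia: "i < a" using Suc by simp
  show ?case
  proof (cases "F (Suc i) (Suc j)")
    case True
    then have "sweep_row x0 y0 F (Suc j) (Suc i) g = G" by (simp add: G_def)
    \<comment> \<open>Below the line opposite increments of a unit square are equal, so leaving the
      slots alone is correct.\<close>
    moreover have "H (Suc i) (Suc j) = H (Suc i) j + H i (Suc j) - H i j"
      using True by (simp add: H_def)
    ultimately show ?thesis
      using IH1 IH2 IH3 IH4 IH5 by (auto simp: less_Suc_eq)
  next
    case False
    let ?e1 = "hor (x0 + int (Suc i))" and ?e2 = "ver (y0 + int (Suc j))"
      and ?e3 = "bulk (x0 + int (Suc i), y0 + int (Suc j))"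
    have G': "sweep_row x0 y0 F (Suc j) (Suc i) g = corner_flip ?e1 ?e2 ?e3 G"
      using False by (simp add: G_def)
    have H': "H (Suc i) (Suc j) = max (H i (Suc j)) (H (Suc i) j) + f ?e3"
      using False by (simp add: H_def)
    have v: "G ?e1 = H (Suc i) j - H i j" "G ?e2 = H i (Suc j) - H i j" "G ?e3 = f ?e3"
      using IH1[OF ia] IH2 IH5[of "Suc i"] by simp_all
    \<comment> \<open>With I and J the stored increments, the maximum of \<open>H i (Suc j)\<close>
      and \<open>H (Suc i) j\<close> exceeds the former by max 0 (I - J), which is the update made
      by the flip.\<close>
    have n1: "corner_flip ?e1 ?e2 ?e3 G ?e1 = H (Suc i) (Suc j) - H i (Suc j)"
      unfolding corner_flip_def H' using v by (simp add: max_def)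
    have n2: "corner_flip ?e1 ?e2 ?e3 G ?e2 = H (Suc i) (Suc j) - H (Suc i) j"
      unfolding corner_flip_def H' using v by (simp add: max_def)
    have o: "corner_flip ?e1 ?e2 ?e3 G e = G e" if "e \<noteq> ?e1" "e \<noteq> ?e2" "e \<noteq> ?e3" for e
      using that by (simp add: corner_flip_def)
    show ?thesis
      unfolding G'
    proof (intro conjI allI impI)
      fix i' assume "i' < a"
      show "corner_flip ?e1 ?e2 ?e3 G (hor (x0 + int (Suc i'))) =
        (if i' < Suc i then H (Suc i') (Suc j) - H i' (Suc j) else H (Suc i') j - H i' j)"
        using n1 IH1[OF \<open>i' < a\<close>] by (cases "i' = i") (simp_all add: o less_Suc_eq del: of_nat_Suc)
    qed (use n2 IH3 IH4 IH5 in \<open>simp_all add: o del: of_nat_Suc\<close>)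
  qed
qed

lemma sweep_field:
  fixes x0 y0 :: int and F :: "nat \<Rightarrow> nat \<Rightarrow> bool" and f :: "site \<Rightarrow> real"
  defines "H \<equiv> lpp_field x0 y0 F f"
  shows "(\<forall>i<a. sweep x0 y0 F a j f (hor (x0 + int (Suc i))) = H (Suc i) j - H i j)
       \<and> (\<forall>j'>j. sweep x0 y0 F a j f (ver (y0 + int j')) = f (ver (y0 + int j')))
       \<and> (\<forall>i' j'. j < j' \<longrightarrow> sweep x0 y0 F a j f (bulk (x0 + int i', y0 + int j')) = f (bulk (x0 + int i', y0 + int j')))"
proof (induction j)
  case 0
  then show ?case by (simp add: H_def)
next
  case (Suc j)
  show ?case
    using sweep_row_field[of a "sweep x0 y0 F a j f" x0 y0 F f j a] Suc
    by (simp add: H_def)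
qed

section \<open>Row sums, the rectangle of sites and the invariance of its law\<close>

lemma sum_greaterThanAtMost_shift:
  "(\<Sum>i\<in>{x0<..x0 + int a}. g i) = (\<Sum>i<a. g (x0 + int (Suc i)))"
proof (induction a)
  case (Suc a)
  have "{x0<..x0 + int (Suc a)} = insert (x0 + int (Suc a)) {x0<..x0 + int a}" by auto
  then show ?case using Suc by (simp add: add.commute)
qed simp

lemma sum_sweep:
  "(\<Sum>i\<in>{x0<..x0 + int a}. sweep x0 y0 F a d f (hor i)) = lpp_field x0 y0 F f a d - lpp_field x0 y0 F f 0 d"
proof -
  have "(\<Sum>i\<in>{x0<..x0 + int a}. sweep x0 y0 F a d f (hor i))
     = (\<Sum>i<a. lpp_field x0 y0 F f (Suc i) d - lpp_field x0 y0 F f i d)"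
    unfolding sum_greaterThanAtMost_shift
    by (rule sum.cong) (use sweep_field[of a x0 y0 F d f] in simp_all)
  then show ?thesis
    using sum_lessThan_telescope[of "\<lambda>i. lpp_field x0 y0 F f i d" a] by simp
qed

lemma lpp_field_0_left: "lpp_field x0 y0 F f 0 d = (\<Sum>j\<in>{y0<..y0 + int d}. f (ver j))"
  unfolding sum_greaterThanAtMost_shift by (induction d) auto

text \<open>A boundary variable belongs to the unit step that ends at its index, so nothing sits on
  the left column \<open>x0\<close> or the bottom row \<open>y0\<close> and all ranges are half
  open.\<close>

definition sites :: "int \<Rightarrow> int \<Rightarrow> nat \<Rightarrow> nat \<Rightarrow> site set" where
  "sites x0 y0 a d = Inl ` ({x0<..x0 + int a} \<times> {y0<..y0 + int d})
     \<union> Inr ` Inl ` {x0<..x0 + int a} \<union> Inr ` Inr ` {y0<..y0 + int d}"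

lemma finite_sites [simp]: "finite (sites x0 y0 a d)"
  by (simp add: sites_def)

lemma sites_iff [simp]:
  "bulk (x, y) \<in> sites x0 y0 a d \<longleftrightarrow> x0 < x \<and> x \<le> x0 + int a \<and> y0 < y \<and> y \<le> y0 + int d"
  "hor x \<in> sites x0 y0 a d \<longleftrightarrow> x0 < x \<and> x \<le> x0 + int a"
  "ver y \<in> sites x0 y0 a d \<longleftrightarrow> y0 < y \<and> y \<le> y0 + int d"
  by (auto simp: sites_def)

lemma prod_sites:
  "(\<Prod>e\<in>sites x0 y0 a d. g e) = (\<Prod>z\<in>{x0<..x0 + int a} \<times> {y0<..y0 + int d}. g (bulk z))
     * (\<Prod>i\<in>{x0<..x0 + int a}. g (hor i)) * (\<Prod>j\<in>{y0<..y0 + int d}. g (ver j))"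
  for g :: "site \<Rightarrow> 'c::comm_monoid_mult"
proof -
  have "(\<Prod>e\<in>sites x0 y0 a d. g e) = prod g (Inl ` ({x0<..x0 + int a} \<times> {y0<..y0 + int d}))
     * prod g (Inr ` Inl ` {x0<..x0 + int a}) * prod g (Inr ` Inr ` {y0<..y0 + int d})"
    unfolding sites_def
    by (subst prod.union_disjoint, auto)+
  then show ?thesis
    by (simp add: prod.reindex inj_on_def image_image)
qed

text \<open>Boundary parameter \<open>r1\<close> north-west of the origin (horizontal index \<open>\<le> 0\<close>, vertical index \<open>> 0\<close>) and
  \<open>r2\<close> south-east of it.\<close>

definition two_rate :: "real \<Rightarrow> real \<Rightarrow> site \<Rightarrow> real" where
  "two_rate r1 r2 = case_sum (\<lambda>_. 1) (case_sum (\<lambda>i. if i \<le> 0 then 1 - r1 else 1 - r2)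
     (\<lambda>j. if j \<le> 0 then r2 else r1))"

lemma two_rate_pos: "0 < r1 \<Longrightarrow> r1 < 1 \<Longrightarrow> 0 < r2 \<Longrightarrow> r2 < 1 \<Longrightarrow> 0 < two_rate r1 r2 e"
  by (auto simp: two_rate_def split: sum.split)

abbreviation bdry_measure :: "int \<Rightarrow> int \<Rightarrow> nat \<Rightarrow> nat \<Rightarrow> real \<Rightarrow> real \<Rightarrow> (site \<Rightarrow> real) measure" where
  "bdry_measure x0 y0 a d r1 r2 \<equiv> PiM (sites x0 y0 a d) (\<lambda>e. expo (two_rate r1 r2 e))"

lemma measurable_PiM_expo_component:
  "e \<in> K \<Longrightarrow> (\<lambda>f. f e) \<in> borel_measurable (PiM K (\<lambda>e. expo (rate e)))"
  using measurable_component_singleton[of e K "\<lambda>e. expo (rate e)"]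
  by (simp add: measurable_cong_sets[OF refl sets_expo])

text \<open>With equal parameters on both sides of the origin every horizontal rate is 1 - r and
  every vertical rate is r, so each step is the identity or a measure-preserving flip. Measurability
  is carried through the same induction because composing the integral identities requires
  it.\<close>

lemma sweep_row_preserves:
  assumes r: "0 < r" "r < 1" and i: "i \<le> a" and j: "0 < j" "j \<le> d"
  shows "sweep_row x0 y0 F j i \<in> measurable (bdry_measure x0 y0 a d r r) (bdry_measure x0 y0 a d r r)
    \<and> (\<forall>\<phi>\<in>borel_measurable (bdry_measure x0 y0 a d r r).
      (\<integral>\<^sup>+f. \<phi> (sweep_row x0 y0 F j i f) \<partial>bdry_measure x0 y0 a d r r) = (\<integral>\<^sup>+f. \<phi> f \<partial>bdry_measure x0 y0 a d r r))"
  using i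
proof (induction i)
  case 0
  then show ?case by simp
next
  case (Suc i)
  let ?M = "bdry_measure x0 y0 a d r r"
  let ?T = "corner_flip (hor (x0 + int (Suc i))) (ver (y0 + int j)) (bulk (x0 + int (Suc i), y0 + int j))"
  note IH = Suc.IH[THEN conjunct1] Suc.IH[THEN conjunct2, rule_format]
  show ?case
  proof (cases "F (Suc i) j")
    case True
    then show ?thesis using Suc by simp
  next
    case False
    have T: "?T \<in> measurable ?M ?M"
      using Suc.prems j by (intro corner_flip_measurable) auto
    have eq: "sweep_row x0 y0 F j (Suc i) = (\<lambda>f. ?T (sweep_row x0 y0 F j i f))"
      using False by (simp add: fun_eq_iff)
    show ?thesis
    proof (intro conjI ballI)
      show "sweep_row x0 y0 F j (Suc i) \<in> measurable ?M ?M"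
        unfolding eq using Suc.prems by (intro measurable_compose[OF IH(1) T]) simp
      fix \<phi> :: "(site \<Rightarrow> real) \<Rightarrow> ennreal" assume \<phi>: "\<phi> \<in> borel_measurable ?M"
      have "(\<integral>\<^sup>+f. \<phi> (sweep_row x0 y0 F j (Suc i) f) \<partial>?M) = (\<integral>\<^sup>+f. \<phi> (?T f) \<partial>?M)"
        unfolding eq using Suc.prems by (intro IH(2) measurable_compose[OF T \<phi>]) auto
      also have "\<dots> = (\<integral>\<^sup>+f. \<phi> f \<partial>?M)"
        using Suc.prems j \<phi> r by (intro nn_integral_corner_flip[OF _ _ _ _ _ _ _ r])
          (auto simp: two_rate_pos, auto simp: two_rate_def)
      finally show "(\<integral>\<^sup>+f. \<phi> (sweep_row x0 y0 F j (Suc i) f) \<partial>?M) = (\<integral>\<^sup>+f. \<phi> f \<partial>?M)" .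
    qed
  qed
qed

lemma sweep_preserves:
  assumes r: "0 < r" "r < 1" and j: "j \<le> d"
  shows "sweep x0 y0 F a j \<in> measurable (bdry_measure x0 y0 a d r r) (bdry_measure x0 y0 a d r r)
    \<and> (\<forall>\<phi>\<in>borel_measurable (bdry_measure x0 y0 a d r r).
      (\<integral>\<^sup>+f. \<phi> (sweep x0 y0 F a j f) \<partial>bdry_measure x0 y0 a d r r) = (\<integral>\<^sup>+f. \<phi> f \<partial>bdry_measure x0 y0 a d r r))"
  using j
proof (induction j)
  case 0
  then show ?case by simp
next
  case (Suc j)
  note row = sweep_row_preserves[OF r le_refl, of "Suc j" d x0 y0 F a]
  let ?M = "bdry_measure x0 y0 a d r r"
  have IH: "sweep x0 y0 F a j \<in> measurable ?M ?M"
    "\<And>\<phi>. \<phi> \<in> borel_measurable ?M \<Longrightarrow> (\<integral>\<^sup>+f. \<phi> (sweep x0 y0 F a j f) \<partial>?M) = (\<integral>\<^sup>+f. \<phi> f \<partial>?M)"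
    using Suc by auto
  have row1: "sweep_row x0 y0 F (Suc j) a \<in> measurable ?M ?M"
    and row2: "\<And>\<phi>. \<phi> \<in> borel_measurable ?M \<Longrightarrow>
      (\<integral>\<^sup>+f. \<phi> (sweep_row x0 y0 F (Suc j) a f) \<partial>?M) = (\<integral>\<^sup>+f. \<phi> f \<partial>?M)"
    using row Suc.prems by auto
  show ?case
  proof (intro conjI ballI)
    show "sweep x0 y0 F a (Suc j) \<in> measurable ?M ?M"
      using measurable_compose[OF IH(1) row1] by (simp add: fun_eq_iff cong: measurable_cong)
    fix \<phi> :: "(site \<Rightarrow> real) \<Rightarrow> ennreal" assume \<phi>: "\<phi> \<in> borel_measurable ?M"
    show "(\<integral>\<^sup>+f. \<phi> (sweep x0 y0 F a (Suc j) f) \<partial>?M) = (\<integral>\<^sup>+f. \<phi> f \<partial>?M)"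
      using IH(2)[OF measurable_compose[OF row1 \<phi>]] row2[OF \<phi>] by simp
  qed
qed

text \<open>The field normalized to vanish at the origin, which lies on the line.\<close>

definition shifted_field :: "int \<Rightarrow> int \<Rightarrow> (nat \<Rightarrow> nat \<Rightarrow> bool) \<Rightarrow> nat \<Rightarrow> nat \<Rightarrow> (site \<Rightarrow> real) \<Rightarrow> real" where
  "shifted_field x0 y0 F a d f = lpp_field x0 y0 F f a d - (\<Sum>i\<in>{x0<..0}. f (hor i)) - (\<Sum>j\<in>{y0<..0}. f (ver j))"

lemma lpp_field_measurable:
  assumes "\<And>e. e \<in> sites x0 y0 i j \<Longrightarrow> (\<lambda>s. X s e) \<in> borel_measurable N"
  shows "(\<lambda>s. lpp_field x0 y0 F (X s) i j) \<in> borel_measurable N"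
proof -
  let ?P = "\<lambda>i' j'. (\<lambda>s. lpp_field x0 y0 F (X s) i' j') \<in> borel_measurable N"
  have "?P i' j'" if "i' \<le> i" "j' \<le> j" for i' j'
    using that
  proof (induction i' arbitrary: j')
    case 0
    then show ?case
    proof (induction j')
      case (Suc j')
      have "?P 0 j'" using Suc by simp
      moreover have "(\<lambda>s. X s (ver (y0 + int (Suc j')))) \<in> borel_measurable N"
        using Suc.prems by (intro assms) simp
      ultimately show ?case by simp
    qed simp
  next
    case (Suc i')
    from Suc.prems(2) show ?case
    proof (induction j')
      case 0
      then show ?case
      proof -
        have "?P i' 0" using Suc.prems(1) Suc.IH[of 0] by simp
        moreover have "(\<lambda>s. X s (hor (x0 + int (Suc i')))) \<in> borel_measurable N"
          using Suc.prems by (intro assms) simp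
        ultimately show ?thesis by simp
      qed
    next
      case (Suc j')
      note IH = \<open>\<And>j'. i' \<le> i \<Longrightarrow> j' \<le> j \<Longrightarrow> ?P i' j'\<close>
      have [measurable]: "?P (Suc i') j'"
        by (rule Suc.IH) (use Suc.prems in simp)
      have [measurable]: "?P i' (Suc j')" "?P i' j'"
        by (rule IH; use Suc.prems \<open>Suc i' \<le> i\<close> in simp)+
      have [measurable]: "(\<lambda>s. X s (bulk (x0 + int (Suc i'), y0 + int (Suc j')))) \<in> borel_measurable N"
        using Suc.prems \<open>Suc i' \<le> i\<close> by (intro assms) simp
      show ?case by simp
    qed
  qed
  then show ?thesis by simp
qed

text \<open>The weight \<open>exp ((r1 - r2) W)\<close>, with \<open>W\<close> the value at the north-west corner, is up to a constant the
  density of parameters \<open>(r2, r2)\<close> with respect to \<open>(r1, r2)\<close>; what remains of the field is the sum of the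
  increments along the top row, which are independent by Burke's theorem.\<close>

theorem mgf_shifted_field:
  assumes r: "0 < r1" "r1 < 1" "0 < r2" "r2 < 1"
    and xy: "x0 \<le> 0" "0 \<le> x0 + int a" "y0 \<le> 0" "0 \<le> y0 + int d"
  shows "(\<integral>\<^sup>+f. ennreal (exp ((r1 - r2) * shifted_field x0 y0 F a d f)) \<partial>bdry_measure x0 y0 a d r1 r2)
    = ennreal (((1 - r2) / (1 - r1)) ^ nat (x0 + int a) * (r1 / r2) ^ nat (y0 + int d))"
proof -
  let ?K = "sites x0 y0 a d" and ?t = "r1 - r2"
  let ?N = "bdry_measure x0 y0 a d r1 r2" and ?M = "bdry_measure x0 y0 a d r2 r2"
  define w where "w = (\<lambda>e x. two_rate r1 r2 e / two_rate r2 r2 e * exp ((two_rate r2 r2 e - two_rate r1 r2 e) * x))"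
  define C where "C = ((1 - r1) / (1 - r2)) ^ nat (- x0) * (r1 / r2) ^ nat (y0 + int d)"
  have pos1: "0 < two_rate r1 r2 e" and pos2: "0 < two_rate r2 r2 e" for e
    using r by (auto intro: two_rate_pos)
  have C: "0 < C" using r by (simp add: C_def)
  interpret M: product_sigma_finite "\<lambda>e. expo (two_rate r2 r2 e)"
    using pos2 by (simp add: product_sigma_finite_def prob_space_expo prob_space_imp_sigma_finite)
  have H: "(\<lambda>f. lpp_field x0 y0 F f a d) \<in> borel_measurable ?M"
    by (intro lpp_field_measurable measurable_PiM_expo_component)
  have G [measurable]: "shifted_field x0 y0 F a d \<in> borel_measurable ?M"
    using xy unfolding shifted_field_def
    by (intro borel_measurable_diff H borel_measurable_sum measurable_PiM_expo_component) auto
  have w1: "(\<lambda>x. ennreal (w e x)) \<in> borel_measurable borel" for e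
    unfolding w_def by measurable
  have w_meas: "(\<lambda>x. \<Prod>i\<in>?K. ennreal (w i (x i))) \<in> borel_measurable ?M"
    by (intro borel_measurable_prod_ennreal measurable_compose[OF measurable_PiM_expo_component w1])
  have N: "?N = density ?M (\<lambda>x. \<Prod>i\<in>?K. ennreal (w i (x i)))"
  proof -
    have e: "expo (two_rate r1 r2 e) = density (expo (two_rate r2 r2 e)) (\<lambda>x. ennreal (w e x))" for e
      unfolding w_def by (rule expo_eq_density[OF pos2 pos1])
    have "?N = PiM ?K (\<lambda>e. density (expo (two_rate r2 r2 e)) (\<lambda>x. ennreal (w e x)))"
      by (intro PiM_cong refl e)
    also have "\<dots> = density ?M (\<lambda>x. \<Prod>i\<in>?K. ennreal (w i (x i)))"
    proof (rule PiM_density)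
      show "sigma_finite_measure (expo (two_rate r2 r2 e))" for e
        by (intro prob_space_imp_sigma_finite prob_space_expo pos2)
      show "sigma_finite_measure (density (expo (two_rate r2 r2 e)) (\<lambda>x. ennreal (w e x)))" for e
        unfolding e[symmetric] by (intro prob_space_imp_sigma_finite prob_space_expo pos1)
      show "(\<lambda>x. ennreal (w e x)) \<in> borel_measurable (expo (two_rate r2 r2 e))" for e
        using w1 by (simp add: measurable_cong_sets[OF sets_expo refl])
    qed simp
    finally show ?thesis .
  qed
  have w_pos: "0 < w e x" for e x using pos1 pos2 by (simp add: w_def)
  \<comment> \<open>Only coordinates whose rate changes contribute: \<open>hor i\<close> with i
    \<le> 0 and \<open>ver j\<close> with j > 0. The exponent is minus r1 - r2 times the value at
    the north-west corner.\<close>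
  have prod_w: "(\<Prod>e\<in>?K. w e (f e)) = C * exp (?t * ((\<Sum>i\<in>{x0<..0}. f (hor i)) - (\<Sum>j\<in>{0<..y0 + int d}. f (ver j))))" for f
  proof -
    have 1: "w (bulk z) x = 1" for z x by (simp add: w_def two_rate_def)
    have "(\<Prod>i\<in>{x0<..x0 + int a}. w (hor i) (f (hor i)))
       = (\<Prod>i\<in>{x0<..0}. w (hor i) (f (hor i)))"
      using xy r by (intro prod.mono_neutral_right) (auto simp: w_def two_rate_def)
    also have "\<dots> = (\<Prod>i\<in>{x0<..0}. (1 - r1) / (1 - r2) * exp (?t * f (hor i)))"
      by (intro prod.cong) (auto simp: w_def two_rate_def)
    also have "\<dots> = ((1 - r1) / (1 - r2)) ^ nat (- x0) * exp (?t * (\<Sum>i\<in>{x0<..0}. f (hor i)))"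
      by (simp only: prod.distrib exp_sum sum_distrib_left finite_greaterThanAtMost_int prod_constant) simp
    finally have 2: "(\<Prod>i\<in>{x0<..x0 + int a}. w (hor i) (f (hor i))) = \<dots>" .
    have "(\<Prod>j\<in>{y0<..y0 + int d}. w (ver j) (f (ver j)))
       = (\<Prod>j\<in>{0<..y0 + int d}. w (ver j) (f (ver j)))"
      using xy r by (intro prod.mono_neutral_right) (auto simp: w_def two_rate_def)
    also have "\<dots> = (\<Prod>j\<in>{0<..y0 + int d}. r1 / r2 * exp (- ?t * f (ver j)))"
      by (intro prod.cong) (auto simp: w_def two_rate_def)
    also have "\<dots> = (r1 / r2) ^ nat (y0 + int d) * exp (- ?t * (\<Sum>j\<in>{0<..y0 + int d}. f (ver j)))"
      by (simp only: prod.distrib exp_sum sum_distrib_left finite_greaterThanAtMost_int prod_constant) simp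
    finally have 3: "(\<Prod>j\<in>{y0<..y0 + int d}. w (ver j) (f (ver j))) = \<dots>" .
    show ?thesis
      unfolding prod_sites 2 3
      by (simp add: 1 C_def algebra_simps flip: exp_add)
  qed
  \<comment> \<open>Value at the north-west corner plus increments along the top row; the density
    cancels the former.\<close>
  have G_top: "shifted_field x0 y0 F a d f = (\<Sum>j\<in>{0<..y0 + int d}. f (ver j)) - (\<Sum>i\<in>{x0<..0}. f (hor i))
      + (\<Sum>i\<in>{x0<..x0 + int a}. sweep x0 y0 F a d f (hor i))" for f
  proof -
    have "{y0<..y0 + int d} = {y0<..0} \<union> {0<..y0 + int d}" using xy by auto
    then have "(\<Sum>j\<in>{y0<..y0 + int d}. f (ver j)) = (\<Sum>j\<in>{y0<..0}. f (ver j)) + (\<Sum>j\<in>{0<..y0 + int d}. f (ver j))"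
      by (simp add: sum.union_disjoint)
    then show ?thesis
      by (simp add: shifted_field_def sum_sweep lpp_field_0_left)
  qed
  have [measurable]: "(\<lambda>f. f e) \<in> borel_measurable ?M" if "e \<in> ?K" for e
    using that by (rule measurable_PiM_expo_component)
  define k :: "site \<Rightarrow> real" where "k = case_sum (\<lambda>_. 0) (case_sum (\<lambda>_. ?t) (\<lambda>_. 0))"
  define \<phi> where "\<phi> = (\<lambda>f. \<Prod>i\<in>{x0<..x0 + int a}. ennreal (exp (?t * f (hor i))))"
  have \<phi> [measurable]: "\<phi> \<in> borel_measurable ?M"
    unfolding \<phi>_def by (intro borel_measurable_prod_ennreal) auto
  have "(\<integral>\<^sup>+f. ennreal (exp (?t * shifted_field x0 y0 F a d f)) \<partial>?N)
      = (\<integral>\<^sup>+f. (\<Prod>i\<in>?K. ennreal (w i (f i))) * ennreal (exp (?t * shifted_field x0 y0 F a d f)) \<partial>?M)"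
    unfolding N by (rule nn_integral_density[OF w_meas]) measurable
  also have "\<dots> = (\<integral>\<^sup>+f. ennreal C * \<phi> (sweep x0 y0 F a d f) \<partial>?M)"
  proof (rule nn_integral_cong)
    fix f
    have "(\<Prod>i\<in>?K. ennreal (w i (f i))) * ennreal (exp (?t * shifted_field x0 y0 F a d f))
      = ennreal ((\<Prod>i\<in>?K. w i (f i)) * exp (?t * shifted_field x0 y0 F a d f))"
      using w_pos by (simp add: prod_ennreal less_imp_le prod_nonneg ennreal_mult)
    also have "(\<Prod>i\<in>?K. w i (f i)) * exp (?t * shifted_field x0 y0 F a d f)
      = C * exp (?t * (\<Sum>i\<in>{x0<..x0 + int a}. sweep x0 y0 F a d f (hor i)))"
      unfolding prod_w G_top by (simp add: algebra_simps flip: exp_add)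
    also have "\<dots> = C * (\<Prod>i\<in>{x0<..x0 + int a}. exp (?t * sweep x0 y0 F a d f (hor i)))"
      by (simp add: sum_distrib_left exp_sum)
    finally show "(\<Prod>i\<in>?K. ennreal (w i (f i))) * ennreal (exp (?t * shifted_field x0 y0 F a d f))
      = ennreal C * \<phi> (sweep x0 y0 F a d f)"
      using C by (simp add: \<phi>_def prod_ennreal ennreal_mult less_imp_le prod_nonneg)
  qed
  also have "\<dots> = ennreal C * (\<integral>\<^sup>+f. \<phi> f \<partial>?M)"
    using sweep_preserves[OF r(3,4) le_refl, of x0 y0 F a d] \<phi>
    by (subst nn_integral_cmult) (simp_all add: measurable_compose[of "sweep x0 y0 F a d" ?M ?M \<phi>])
  also have "(\<integral>\<^sup>+f. \<phi> f \<partial>?M) = (\<integral>\<^sup>+f. (\<Prod>e\<in>?K. ennreal (exp (k e * f e))) \<partial>?M)"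
    by (intro nn_integral_cong) (simp add: prod_sites \<phi>_def k_def)
  also have "\<dots> = (\<Prod>e\<in>?K. \<integral>\<^sup>+x. ennreal (exp (k e * x)) \<partial>expo (two_rate r2 r2 e))"
    by (intro M.product_nn_integral_prod) (simp_all add: measurable_cong_sets[OF sets_expo refl])
  \<comment> \<open>The moments are finite since r1 - r2 < 1 - r2.\<close>
  also have "\<dots> = (\<Prod>e\<in>?K. ennreal (two_rate r2 r2 e / (two_rate r2 r2 e - k e)))"
    using r by (intro prod.cong refl nn_integral_expo_exp pos2) (auto simp: k_def two_rate_def split: sum.split)
  also have "\<dots> = ennreal (((1 - r2) / (1 - r1)) ^ a)"
    using r by (simp add: prod_sites ennreal_power k_def two_rate_def)
  finally have "(\<integral>\<^sup>+f. ennreal (exp (?t * shifted_field x0 y0 F a d f)) \<partial>?N) = ennreal (C * ((1 - r2) / (1 - r1)) ^ a)"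
    using C r by (simp add: ennreal_mult)
  \<comment> \<open>Columns left of the origin contribute inverse factors to \<open>C\<close> and to
    the top row, so only the columns between the origin and the end point survive.\<close>
  also have "C * ((1 - r2) / (1 - r1)) ^ a = ((1 - r2) / (1 - r1)) ^ nat (x0 + int a) * (r1 / r2) ^ nat (y0 + int d)"
  proof -
    have "a = nat (- x0) + nat (x0 + int a)" using xy by simp
    then have "((1 - r2) / (1 - r1)) ^ a = ((1 - r2) / (1 - r1)) ^ nat (- x0) * ((1 - r2) / (1 - r1)) ^ nat (x0 + int a)"
      by (metis power_add)
    moreover have "((1 - r1) / (1 - r2)) ^ nat (- x0) * ((1 - r2) / (1 - r1)) ^ nat (- x0) = 1"
      using r by (simp add: power_mult_distrib[symmetric])
    ultimately show ?thesis by (simp add: C_def)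
  qed
  finally show ?thesis .
qed

section \<open>Paths from the line and the field\<close>

definition path_weight :: "(int \<times> int \<Rightarrow> real) \<Rightarrow> (int \<times> int) list \<Rightarrow> real" where
  "path_weight w \<pi> = (\<Sum>z\<in>set \<pi> - {hd \<pi>}. w z)"

lemma up_right_path_snoc_iff:
  "\<pi> \<noteq> [] \<Longrightarrow> up_right_path a b (\<pi> @ [v]) \<longleftrightarrow>
     v = b \<and> up_right_path a (last \<pi>) \<pi> \<and> v - last \<pi> \<in> {(1, 0), (0, 1)}"
  by (auto simp: up_right_path_def successively_append_iff)

text \<open>Paths grow at their end because the field recursion looks back from the end
  point.\<close>

lemma up_right_path_induct [consumes 1, case_names base step]:
  assumes "up_right_path a b \<pi>"
    and base: "P a [a]"
    and step: "\<And>u v \<pi>. up_right_path a u \<pi> \<Longrightarrow> P u \<pi> \<Longrightarrow> v - u \<in> {(1, 0), (0, 1)} \<Longrightarrow> P v (\<pi> @ [v])"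
  shows "P b \<pi>"
  using assms(1)
proof (induction \<pi> arbitrary: b rule: rev_induct)
  case Nil
  then show ?case by (simp add: up_right_path_def)
next
  case (snoc v \<pi>)
  show ?case
  proof (cases "\<pi> = []")
    case True
    with snoc.prems show ?thesis
      using base by (auto simp: up_right_path_def)
  next
    case False
    with snoc.prems have "v = b" "up_right_path a (last \<pi>) \<pi>" "v - last \<pi> \<in> {(1, 0), (0, 1)}"
      by (auto simp: up_right_path_snoc_iff)
    then show ?thesis
      using step snoc.IH by blast
  qed
qed

lemma up_right_path_bounds:
  assumes "up_right_path a b \<pi>" "z \<in> set \<pi>"
  shows "fst a \<le> fst z" "snd a \<le> snd z" "fst z \<le> fst b" "snd z \<le> snd b"
proof -
  have "\<forall>z\<in>set \<pi>. fst a \<le> fst z \<and> snd a \<le> snd z \<and> fst z \<le> fst b \<and> snd z \<le> snd b"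
    using assms(1)
  proof (induction rule: up_right_path_induct)
    case (step u v \<pi>)
    have "u \<in> set \<pi>"
      using step.hyps(1) by (auto simp: up_right_path_def)
    with step.IH have a: "fst a \<le> fst u" "snd a \<le> snd u" by auto
    have v: "fst v = fst u + 1 \<and> snd v = snd u \<or> fst v = fst u \<and> snd v = snd u + 1"
      using step.hyps(2) by (cases u; cases v) auto
    show ?case
      using step.IH a v by fastforce
  qed simp
  with assms(2) show "fst a \<le> fst z" "snd a \<le> snd z" "fst z \<le> fst b" "snd z \<le> snd b" by auto
qed

lemma up_right_path_le:
  assumes "up_right_path a b \<pi>"
  shows "fst a \<le> fst b" "snd a \<le> snd b"
proof -
  have "a \<in> set \<pi>" using assms by (auto simp: up_right_path_def)
  from up_right_path_bounds(3,4)[OF assms this] show "fst a \<le> fst b" "snd a \<le> snd b" .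
qed

lemma up_right_path_singleton: "up_right_path a a [a]"
  by (simp add: up_right_path_def)

lemma path_weight_singleton [simp]: "path_weight w [a] = 0"
  by (simp add: path_weight_def)

lemma up_right_path_snoc:
  assumes \<pi>: "up_right_path a u \<pi>" and v: "v - u \<in> {(1, 0), (0, 1)}"
  shows "up_right_path a v (\<pi> @ [v])" "path_weight w (\<pi> @ [v]) = path_weight w \<pi> + w v"
proof -
  have ne: "\<pi> \<noteq> []" and hd: "hd \<pi> = a" and last: "last \<pi> = u"
    using \<pi> by (auto simp: up_right_path_def)
  show "up_right_path a v (\<pi> @ [v])"
    using ne \<pi> v last by (simp add: up_right_path_snoc_iff)
  have "v \<notin> set \<pi>"
    using up_right_path_bounds(3,4)[OF \<pi>, of v] v by (cases u; cases v) auto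
  moreover from this ne hd have "v \<noteq> a" by auto
  ultimately have "set (\<pi> @ [v]) - {a} = insert v (set \<pi> - {a})" "v \<notin> set \<pi> - {a}" by auto
  then show "path_weight w (\<pi> @ [v]) = path_weight w \<pi> + w v"
    using ne hd by (simp add: path_weight_def)
qed

lemma up_right_path_exists:
  assumes "x \<le> x'" "y \<le> y'"
  shows "\<exists>\<pi>. up_right_path (x, y) (x', y') \<pi>"
proof -
  have "\<exists>\<pi>. up_right_path (x, y) (x', y) \<pi>"
    using assms(1)
  proof (induction x' rule: int_ge_induct)
    case base
    then show ?case using up_right_path_singleton by blast
  next
    case (step i)
    then obtain \<pi> where "up_right_path (x, y) (i, y) \<pi>" by blast
    from up_right_path_snoc(1)[OF this, of "(i + 1, y)"] show ?case by auto
  qed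
  with assms(2) show ?thesis
  proof (induction y' rule: int_ge_induct)
    case (step i)
    then obtain \<pi> where "up_right_path (x, y) (x', i) \<pi>" by blast
    from up_right_path_snoc(1)[OF this, of "(x', i + 1)"] show ?case by auto
  qed
qed

lemma path_weight_nonneg: "(\<And>z. 0 \<le> w z) \<Longrightarrow> 0 \<le> path_weight w \<pi>"
  by (simp add: path_weight_def sum_nonneg)

lemma last_passage_time_eq:
  "last_passage_time w a b = (SUP \<pi>\<in>{\<pi>. up_right_path a b \<pi>}. ereal (path_weight w \<pi>))"
  unfolding last_passage_time_def by (intro SUP_cong) (auto simp: path_weight_def up_right_path_def)

section \<open>The field at lattice points and its comparison with paths\<close>

definition partial_sum :: "(int \<Rightarrow> real) \<Rightarrow> int \<Rightarrow> int \<Rightarrow> real" where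
  "partial_sum g x0 x = (\<Sum>i\<in>{x0<..x}. g i)"

lemma partial_sum_step: "x0 < x \<Longrightarrow> partial_sum g x0 x = partial_sum g x0 (x - 1) + g x"
proof -
  assume "x0 < x"
  then have "{x0<..x} = insert x {x0<..x - 1}" by auto
  then show ?thesis by (simp add: partial_sum_def add.commute)
qed

lemma partial_sum_diff:
  assumes "x0 \<le> x" "x \<le> y"
  shows "partial_sum g x0 y - partial_sum g x0 x = (\<Sum>i\<in>{x<..y}. g i)"
proof -
  have "{x0<..y} = {x0<..x} \<union> {x<..y}" using assms by auto
  then show ?thesis by (simp add: partial_sum_def sum.union_disjoint)
qed

lemma partial_sum_mono:
  assumes "\<And>i. 0 \<le> g i" "x \<le> y"
  shows "partial_sum g x0 x \<le> partial_sum g x0 y"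
  unfolding partial_sum_def using assms by (intro sum_mono2) auto

definition below :: "(int \<Rightarrow> int) \<Rightarrow> int \<Rightarrow> int \<Rightarrow> nat \<Rightarrow> nat \<Rightarrow> bool" where
  "below h x0 y0 i j \<longleftrightarrow> x0 + int i \<le> h (y0 + int j)"

definition site_field :: "(int \<Rightarrow> int) \<Rightarrow> int \<Rightarrow> int \<Rightarrow> (site \<Rightarrow> real) \<Rightarrow> int \<Rightarrow> int \<Rightarrow> real" where
  "site_field h x0 y0 f x y = lpp_field x0 y0 (below h x0 y0) f (nat (x - x0)) (nat (y - y0))"

text \<open>For a decreasing line the region \<open>below\<close> is closed under moving left or
  down, so the additive recursion never leaves it and the field splits into two boundary
  sums.\<close>

lemma lpp_field_below:
  assumes "antimono h" "i = 0 \<or> j = 0 \<or> below h x0 y0 i j"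
  shows "lpp_field x0 y0 (below h x0 y0) f i j
     = partial_sum (\<lambda>i. f (hor i)) x0 (x0 + int i) + partial_sum (\<lambda>j. f (ver j)) y0 (y0 + int j)"
  using assms(2)
proof (induction x0 y0 "below h x0 y0" f i j rule: lpp_field.induct)
  case (4 x0 y0 f i j)
  then have b: "below h x0 y0 (Suc i) (Suc j)" by simp
  have "below h x0 y0 (Suc i) j" "below h x0 y0 i (Suc j)" "below h x0 y0 i j"
    using b antimonoD[OF assms(1), of "y0 + int j" "y0 + int (Suc j)"] by (auto simp: below_def)
  then show ?case
    using 4 b partial_sum_step[of x0 "x0 + int (Suc i)" "\<lambda>i. f (hor i)"]
      partial_sum_step[of y0 "y0 + int (Suc j)" "\<lambda>i. f (ver i)"] by simp
next
  case (2 x0 y0 f i)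
  then show ?case
    using partial_sum_step[of x0 "x0 + int (Suc i)" "\<lambda>i. f (hor i)"] by simp
next
  case (3 x0 y0 f j)
  then show ?case
    using partial_sum_step[of y0 "y0 + int (Suc j)" "\<lambda>i. f (ver i)"] by simp
qed (simp add: partial_sum_def)

lemma site_field_below:
  assumes "antimono h" "x0 \<le> x" "y0 \<le> y" "x \<le> h y \<or> y = y0"
  shows "site_field h x0 y0 f x y = partial_sum (\<lambda>i. f (hor i)) x0 x + partial_sum (\<lambda>j. f (ver j)) y0 y"
  unfolding site_field_def using assms
  by (subst lpp_field_below) (auto simp: below_def)

lemma site_field_above:
  assumes "x0 < x" "y0 < y" "h y < x"
  shows "site_field h x0 y0 f x y
     = max (site_field h x0 y0 f (x - 1) y) (site_field h x0 y0 f x (y - 1)) + f (bulk (x, y))"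
proof -
  have "nat (x - x0) = Suc (nat (x - 1 - x0))" "nat (y - y0) = Suc (nat (y - 1 - y0))"
    using assms by auto
  then show ?thesis
    using assms by (simp add: site_field_def below_def)
qed

context
  fixes h :: "int \<Rightarrow> int" and x0 y0 n :: int and f :: "site \<Rightarrow> real"
  assumes h: "antimono h" and x0: "x0 \<le> h n" and nonneg: "\<And>e. 0 \<le> f e"
begin

abbreviation (input) "hsum \<equiv> partial_sum (\<lambda>i. f (hor i)) x0"
abbreviation (input) "vsum \<equiv> partial_sum (\<lambda>j. f (ver j)) y0"
abbreviation (input) "fld \<equiv> site_field h x0 y0 f"
abbreviation (input) "bulk_of \<equiv> \<lambda>z. f (bulk z)"

text \<open>The field also allows exits between two consecutive points of the line; \<open>E\<close> is the price for
  restricting to the points of the line.\<close>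

lemma site_field_le_path:
  assumes E: "\<And>y. y0 < y \<Longrightarrow> y \<le> n \<Longrightarrow> hsum (h (y - 1)) - hsum (h y) \<le> E" "0 \<le> E"
    and m: "m \<le> h y0"
    and xy: "y0 < y" "y \<le> n" "h y \<le> x" "x \<le> m"
  shows "\<exists>k \<pi>. y0 < k \<and> k \<le> y \<and> up_right_path (h k, k) (x, y) \<pi> \<and> fld x y \<le> hsum (h k) + vsum k + path_weight bulk_of \<pi> + E"
  using xy
proof (induction "nat (x - x0) + nat (y - y0)" arbitrary: x y rule: less_induct)
  case less
  have hy: "x0 \<le> h y" using antimonoD[OF h less.prems(2)] x0 by simp
  show ?case
  proof (cases "x = h y")
    case True
    have "fld x y = hsum (h y) + vsum y"
      using True less.prems hy by (subst site_field_below[OF h]) auto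
    then show ?thesis
      using True less.prems E(2) up_right_path_singleton[of "(h y, y)"]
      by (intro exI[of _ y] exI[of _ "[(h y, y)]"]) simp
  next
    case False
    then have gt: "h y < x" using less.prems by simp
    have rec: "fld x y = max (fld (x - 1) y) (fld x (y - 1)) + bulk_of (x, y)"
      using gt hy less.prems by (intro site_field_above) auto
    have extend: ?thesis
      if "up_right_path (h k, k) u \<pi>" "(x, y) - u \<in> {(1, 0), (0, 1)}" "y0 < k" "k \<le> y"
        "max (fld (x - 1) y) (fld x (y - 1)) \<le> hsum (h k) + vsum k + path_weight bulk_of \<pi> + E" for k u \<pi>
      using up_right_path_snoc(1)[OF that(1,2)] up_right_path_snoc(2)[OF that(1,2), of bulk_of] that(3-5) rec
      by (intro exI[of _ k] exI[of _ "\<pi> @ [(x, y)]"]) simp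
    \<comment> \<open>If \<open>y - 1 = y0\<close>, then \<open>m \<le> h y0\<close> rules out the
      second case, so the induction never descends to height \<open>y0\<close>.\<close>
    consider (left) "fld x (y - 1) \<le> fld (x - 1) y"
      | (down) "fld (x - 1) y \<le> fld x (y - 1)" "y0 < y - 1" "h (y - 1) \<le> x"
      | (new) "fld (x - 1) y \<le> fld x (y - 1)" "x \<le> h (y - 1)"
      using less.prems m by (cases "y - 1 = y0") force+
    then show ?thesis
    proof cases
      case left
      obtain k \<pi> where "y0 < k" "k \<le> y" "up_right_path (h k, k) (x - 1, y) \<pi>"
        "fld (x - 1) y \<le> hsum (h k) + vsum k + path_weight bulk_of \<pi> + E"
        using less.hyps[of "x - 1" y] gt hy less.prems by auto
      then show ?thesis using left by (intro extend[of k "(x - 1, y)" \<pi>]) auto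
    next
      case down
      obtain k \<pi> where "y0 < k" "k \<le> y - 1" "up_right_path (h k, k) (x, y - 1) \<pi>"
        "fld x (y - 1) \<le> hsum (h k) + vsum k + path_weight bulk_of \<pi> + E"
        using less.hyps[of x "y - 1"] down less.prems by auto
      then show ?thesis using down by (intro extend[of k "(x, y - 1)" \<pi>]) auto
    next
      \<comment> \<open>The site under (x, y) is on or below the line, so its value is a sum of
        boundary variables. The exit is moved to the line point of row \<open>y\<close>; this loses
        at most the horizontal sum between two consecutive line points, hence at most
        \<open>E\<close>.\<close>
      case new
      obtain \<pi> where \<pi>: "up_right_path (h y, y) (x - 1, y) \<pi>"
        using up_right_path_exists[of "h y" "x - 1" y y] gt by auto
      have "fld x (y - 1) = hsum x + vsum (y - 1)"
        using new gt hy less.prems by (subst site_field_below[OF h]) auto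
      also have "hsum x \<le> hsum (h (y - 1))"
        using new nonneg by (intro partial_sum_mono) auto
      also have "vsum (y - 1) \<le> vsum y"
        using nonneg by (intro partial_sum_mono) auto
      finally have "fld x (y - 1) \<le> hsum (h y) + vsum y + E"
        using E(1)[of y] less.prems by simp
      moreover have "0 \<le> path_weight bulk_of \<pi>"
        using nonneg by (intro path_weight_nonneg)
      ultimately show ?thesis
        using new \<pi> less.prems by (intro extend[of y "(x - 1, y)" \<pi>]) auto
    qed
  qed
qed

text \<open>The extra sum is needed because a path that runs up a vertical stretch of the line collects bulk
  weights there, while the field only knows the boundary variables.\<close>

lemma path_le_site_field:
  assumes "up_right_path (h k, k) b \<pi>" "y0 < k" "snd b \<le> n"
  shows "hsum (h k) + vsum k + path_weight bulk_of \<pi>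
     \<le> fld (fst b) (snd b) + (\<Sum>i\<in>{i\<in>{k<..snd b}. h i = h k}. bulk_of (h i, i))"
  using assms(1,3)
proof (induction rule: up_right_path_induct)
  case base
  have "x0 \<le> h k" using antimonoD[OF h, of k n] x0 base by simp
  then show ?case
    using assms(2) by (simp add: site_field_below[OF h])
next
  case (step u v \<pi>)
  obtain x y where v: "v = (x, y)" by (cases v)
  let ?T = "\<lambda>y. \<Sum>i\<in>{i\<in>{k<..y}. h i = h k}. bulk_of (h i, i)"
  have u: "u = (x - 1, y) \<or> u = (x, y - 1)"
    using step.hyps(2) v by (cases u) auto
  then have IH: "hsum (h k) + vsum k + path_weight bulk_of \<pi> \<le> fld (fst u) (snd u) + ?T (snd u)"
    using step.IH step.prems v by auto
  have ub: "h k \<le> fst u" "k \<le> snd u"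
    using up_right_path_le[OF step.hyps(1)] by auto
  have k: "h y \<le> h k" "x0 \<le> h y" "h k \<le> x" "k \<le> y"
    using u ub v step.prems x0 antimonoD[OF h, of k y] antimonoD[OF h, of y n] by auto
  have pw: "path_weight bulk_of (\<pi> @ [v]) = path_weight bulk_of \<pi> + bulk_of (x, y)"
    using up_right_path_snoc(2)[OF step.hyps] v by simp
  have T: "?T (snd u) \<le> ?T y"
    using u nonneg by (intro sum_mono2) (auto intro: finite_subset[of _ "{k<..y}"])
  show ?case
  proof (cases "h y < x")
    case True
    have "fld x y = max (fld (x - 1) y) (fld x (y - 1)) + bulk_of (x, y)"
      using True k assms(2) by (intro site_field_above) auto
    then show ?thesis
      using IH u T pw v by (auto simp: max_def)
  next
    \<comment> \<open>The step climbs along a vertical stretch of the line: the field adds no bulk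
      weight there, and the extra sum pays for the one that the path collects.\<close>
    case False
    then have x: "x = h y" "h y = h k" using k by auto
    then have u': "u = (x, y - 1)" "k < y" using u ub by auto
    then have hy1: "h (y - 1) = h k"
      using antimonoD[OF h, of "y - 1" y] antimonoD[OF h, of k "y - 1"] x ub by auto
    have ins: "{i\<in>{k<..y}. h i = h k} = insert y {i\<in>{k<..y - 1}. h i = h k}"
      using u' x by auto
    have fin: "finite {i\<in>{k<..y - 1}. h i = h k}"
      by (rule finite_subset[of _ "{k<..y}"]) auto
    then have Ty: "?T y = ?T (y - 1) + bulk_of (x, y)"
      unfolding ins by (subst sum.insert[OF fin]) (use x in auto)
    have "fld x y = hsum x + vsum y" "fld x (y - 1) = hsum x + vsum (y - 1)"
      using x k assms(2) u' hy1 by (auto intro!: site_field_below[OF h])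
    moreover have "vsum (y - 1) \<le> vsum y"
      using nonneg by (intro partial_sum_mono) auto
    ultimately show ?thesis
      using IH u' pw v Ty by simp
  qed
qed

end

text \<open>\<open>W\<close> has the maximizer \<open>z\<close>, the value \<open>G'\<close> is
  reached through \<open>j\<close> with weights \<open>W'\<close>, and \<open>G''\<close> bounds the
  paths from \<open>j\<close> and \<open>z\<close> with weights \<open>W''\<close>. If passing from
  \<open>W\<close> to \<open>W'\<close> favours \<open>z\<close> over \<open>j\<close>, the
  optimality of \<open>z\<close> carries over to \<open>W'\<close> and the gain \<open>D\<close> is
  collected at \<open>z\<close>; otherwise it is collected at \<open>j\<close> itself.
  \<open>E'\<close> and \<open>E''\<close> are the discretization errors.\<close>

lemma exit_compare:
  fixes L :: "int \<Rightarrow> ereal"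
  assumes max: "last_passage_time w (pt j) b + ereal (W j) \<le> last_passage_time w (pt z) b + ereal (W z)"
    and \<pi>: "up_right_path (pt j) b \<pi>" "G' \<le> W' j + path_weight w \<pi> + E'"
    and up: "\<And>k \<pi>. k \<in> {j, z} \<Longrightarrow> up_right_path (pt k) b \<pi> \<Longrightarrow> W'' k + path_weight w \<pi> \<le> G'' + E''"
    and D: "D \<le> W'' z - W' z"
    and mono: "W' j - W j \<le> W' z - W z \<or> D \<le> W'' j - W' j"
  shows "G' \<le> G'' + E' + E'' - D"
  using mono
proof
  assume m: "W' j - W j \<le> W' z - W z"
  have "ereal (path_weight w \<pi>) \<le> last_passage_time w (pt j) b"
    unfolding last_passage_time_eq using \<pi>(1) by (intro SUP_upper) simp
  then have "ereal (path_weight w \<pi> + W j) \<le> last_passage_time w (pt j) b + ereal (W j)"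
    unfolding plus_ereal.simps(1)[symmetric] by (rule add_right_mono)
  also note max
  also have "last_passage_time w (pt z) b \<le> ereal (G'' + E'' - W'' z)"
    unfolding last_passage_time_eq using up[of z] by (intro SUP_least) (simp add: algebra_simps)
  then have "last_passage_time w (pt z) b + ereal (W z) \<le> ereal (G'' + E'' - W'' z) + ereal (W z)"
    by (rule add_right_mono)
  finally have "path_weight w \<pi> + W j \<le> G'' + E'' - W'' z + W z" by simp
  then show ?thesis using \<pi>(2) m D by simp
next
  assume "D \<le> W'' j - W' j"
  then show ?thesis using \<pi>(2) up[of j, OF _ \<pi>(1)] by simp
qed

section \<open>Existence of the exit point, and boundary weights as partial sums\<close>

lemma last_passage_time_no_path:
  assumes "\<not> (fst a \<le> fst b \<and> snd a \<le> snd b)"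
  shows "last_passage_time w a b = -\<infinity>"
proof -
  have "{\<pi>. up_right_path a b \<pi>} = {}" using up_right_path_le[of a b] assms by auto
  then show ?thesis by (simp add: last_passage_time_def bot_ereal_def)
qed

lemma line_abscissa_antimono:
  assumes "0 < lam" "lam < 1" shows "antimono (line_abscissa lam)"
proof (rule antimonoI)
  fix k l :: int assume "k \<le> l"
  then have "(lam - 1) / lam * of_int l \<le> (lam - 1) / lam * of_int k"
    using assms by (intro mult_left_mono_neg) (auto simp: divide_le_0_iff)
  then show "line_abscissa lam l \<le> line_abscissa lam k"
    unfolding line_abscissa_def by (rule floor_mono)
qed

lemma line_abscissa_bounds:
  assumes "0 < lam" "lam < 1"
  shows "real_of_int (line_abscissa lam k) \<le> - ((1 - lam) / lam) * of_int k"
    "- ((1 - lam) / lam) * of_int k < real_of_int (line_abscissa lam k) + 1"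
proof -
  have "(lam - 1) / lam = - ((1 - lam) / lam)" by (simp add: divide_simps)
  then show "real_of_int (line_abscissa lam k) \<le> - ((1 - lam) / lam) * of_int k"
    "- ((1 - lam) / lam) * of_int k < real_of_int (line_abscissa lam k) + 1"
    unfolding line_abscissa_def by (auto simp: floor_correct)
qed

lemma line_abscissa_0 [simp]: "line_abscissa lam 0 = 0"
  by (simp add: line_abscissa_def)

text \<open>Only finitely many line points can reach the end point, all others have value
  -\<infinity>, and index 0 does better than that. The supremum is therefore attained and
  \<open>arg_max\<close> returns a true maximizer.\<close>

lemma exit_point_props:
  fixes w :: "int \<times> int \<Rightarrow> real" and p q :: "int \<Rightarrow> real"
  assumes lam: "0 < lam" "lam < 1" and b: "0 \<le> m" "0 \<le> n"
  defines "z \<equiv> exit_point lam w p q (m, n)"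
  shows "last_passage_time w (line_point lam j) (m, n) + ereal (boundary_weight lam p q j)
      \<le> last_passage_time w (line_point lam z) (m, n) + ereal (boundary_weight lam p q z)"
    and "line_abscissa lam z \<le> m" "z \<le> n"
proof -
  let ?v = "\<lambda>k. last_passage_time w (line_point lam k) (m, n) + ereal (boundary_weight lam p q k)"
  let ?A = "{k. line_abscissa lam k \<le> m \<and> k \<le> n}"
  have out: "?v k = -\<infinity>" if "k \<notin> ?A" for k
    using that by (subst last_passage_time_no_path) (auto simp: line_point_def)
  define t where "t = (1 - lam) / lam"
  have t: "0 < t" using lam by (simp add: t_def)
  have "?A \<subseteq> {\<lfloor>- (of_int m + 1) / t\<rfloor>..n}"
  proof
    fix k assume "k \<in> ?A"
    moreover have "- t * of_int k < real_of_int (line_abscissa lam k) + 1"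
      using line_abscissa_bounds(2)[OF lam, of k] by (simp add: t_def)
    ultimately have "- (of_int m + 1) < t * of_int k" by simp
    then have "- (of_int m + 1) / t < of_int k" using t by (simp add: field_simps)
    then have "\<lfloor>- (of_int m + 1) / t\<rfloor> \<le> k" by linarith
    then show "k \<in> {\<lfloor>- (of_int m + 1) / t\<rfloor>..n}" using \<open>k \<in> ?A\<close> by simp
  qed
  then have fin: "finite ?A" by (rule finite_subset) simp
  have A0: "0 \<in> ?A" using b by simp
  have gt0: "- \<infinity> < ?v 0"
  proof -
    obtain \<pi> where "up_right_path (0, 0) (m, n) \<pi>" using up_right_path_exists[of 0 m 0 n] b by auto
    then have "ereal (path_weight w \<pi>) \<le> last_passage_time w (line_point lam 0) (m, n)"
      unfolding last_passage_time_eq by (intro SUP_upper) (simp add: line_point_def)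
    then have "last_passage_time w (line_point lam 0) (m, n) \<noteq> -\<infinity>" by auto
    then show ?thesis by (cases "last_passage_time w (line_point lam 0) (m, n)") auto
  qed
  define M where "M = Max (?v ` ?A)"
  have "M \<in> ?v ` ?A" unfolding M_def using fin A0 by (intro Max_in) blast+
  then obtain k where k: "?v k = M" by auto
  have "?v j \<le> M" for j
    using out[of j] fin by (cases "j \<in> ?A") (auto simp: M_def intro!: Max_ge)
  then have "is_arg_max ?v (\<lambda>_. True) k" using k by (auto simp: is_arg_max_def not_less)
  then have z: "is_arg_max ?v (\<lambda>_. True) z"
    unfolding z_def exit_point_def arg_max_def by (rule someI)
  then show *: "?v j \<le> ?v z" for j by (auto simp: is_arg_max_def not_less)
  have "?v z \<noteq> -\<infinity>" using *[of 0] gt0 by auto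
  then have "z \<in> ?A" using out by blast
  then show "line_abscissa lam z \<le> m" "z \<le> n" by auto
qed

text \<open>One formula for all signs of \<open>k\<close>, based at the corner of the rectangle and
  normalised at the origin like \<open>shifted_field\<close>, so that boundary weights and field
  values can be compared directly.\<close>

lemma boundary_weight_eq:
  assumes lam: "0 < lam" "lam < 1" and "x0 \<le> 0" "y0 \<le> 0" "x0 \<le> line_abscissa lam k" "y0 \<le> k"
  shows "boundary_weight lam p q k = partial_sum p x0 (line_abscissa lam k) + partial_sum q y0 k
     - partial_sum p x0 0 - partial_sum q y0 0"
proof -
  have iv: "{i + 1..j} = {i<..j}" "{1..j} = {0<..j}" for i j :: int by auto
  note anti = antimonoD[OF line_abscissa_antimono[OF lam]]
  have d: "partial_sum g x y - partial_sum g x z = (\<Sum>i\<in>{z<..y}. g i)" if "x \<le> z" "z \<le> y"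
    for g :: "int \<Rightarrow> real" and x y z using that by (rule partial_sum_diff)
  consider "k < 0" | "k = 0" | "0 < k" by linarith
  then show ?thesis
  proof cases
    case 1
    then have "0 \<le> line_abscissa lam k" using anti[of k 0] by simp
    then show ?thesis
      using 1 assms d[of x0 0 "line_abscissa lam k" p] d[of y0 k 0 q]
      by (simp add: boundary_weight_def iv)
  next
    case 2
    then show ?thesis by (simp add: boundary_weight_def)
  next
    case 3
    then have "line_abscissa lam k \<le> 0" using anti[of 0 k] by simp
    then show ?thesis
      using 3 assms d[of x0 "line_abscissa lam k" 0 p] d[of y0 0 k q]
      by (simp add: boundary_weight_def iv)
  qed
qed

section \<open>Coupling of different boundary parameters\<close>

text \<open>Multiplying an exponential variable by the ratio of its rate to a new rate gives the new
  law. All parameters are thereby coupled on one environment, and the weights are monotone in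
  them.\<close>

definition rescale :: "real \<Rightarrow> real \<Rightarrow> real \<Rightarrow> (site \<Rightarrow> real) \<Rightarrow> site \<Rightarrow> real" where
  "rescale \<rho> r1 r2 f e = two_rate \<rho> \<rho> e / two_rate r1 r2 e * f e"

definition rescaled_boundary :: "real \<Rightarrow> real \<Rightarrow> real \<Rightarrow> real \<Rightarrow> (site \<Rightarrow> real) \<Rightarrow> int \<Rightarrow> real" where
  "rescaled_boundary lam \<rho> r1 r2 f =
     boundary_weight lam (\<lambda>i. rescale \<rho> r1 r2 f (hor i)) (\<lambda>j. rescale \<rho> r1 r2 f (ver j))"

text \<open>The left side is the abscissa of the line at height \<open>n\<close>: no line point that
  reaches (m, n) lies further left.\<close>

definition rescaled_field :: "real \<Rightarrow> int \<Rightarrow> int \<Rightarrow> int \<Rightarrow> real \<Rightarrow> real \<Rightarrow> real \<Rightarrow> (site \<Rightarrow> real) \<Rightarrow> real" where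
  "rescaled_field lam y0 m n \<rho> r1 r2 f =
     (let x0 = line_abscissa lam n
      in shifted_field x0 y0 (below (line_abscissa lam) x0 y0) (nat (m - x0)) (nat (n - y0)) (rescale \<rho> r1 r2 f))"

lemma rescale_bulk [simp]: "rescale \<rho> r1 r2 f (bulk z) = f (bulk z)"
  by (simp add: rescale_def two_rate_def)

lemma rescale_same [simp]: "0 < \<rho> \<Longrightarrow> \<rho> < 1 \<Longrightarrow> rescale \<rho> \<rho> \<rho> f = f"
  using two_rate_pos[of \<rho> \<rho>] by (auto simp: rescale_def fun_eq_iff less_le)

lemma rescale_nonneg:
  assumes "0 < \<rho>" "\<rho> < 1" "0 < r1" "r1 < 1" "0 < r2" "r2 < 1" "\<And>e. 0 \<le> f e"
  shows "0 \<le> rescale \<rho> r1 r2 f e"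
  using two_rate_pos[of \<rho> \<rho> e] two_rate_pos[of r1 r2 e] assms by (simp add: rescale_def)

lemma rescaled_boundary_diff:
  assumes lam: "0 < lam" "lam < 1" and jk: "j \<le> k"
  shows "rescaled_boundary lam \<rho> r1 r2 f k - rescaled_boundary lam \<rho> r1 r2 f j
    = (\<Sum>i\<in>{j<..k}. rescale \<rho> r1 r2 f (ver i))
      - (\<Sum>i\<in>{line_abscissa lam k<..line_abscissa lam j}. rescale \<rho> r1 r2 f (hor i))"
proof -
  let ?h = "line_abscissa lam"
  define x0 y0 where "x0 = min (?h k) 0" and "y0 = min j 0"
  have h: "?h k \<le> ?h j" using antimonoD[OF line_abscissa_antimono[OF lam] jk] .
  have "x0 \<le> 0" "y0 \<le> 0" "x0 \<le> ?h k" "x0 \<le> ?h j" "y0 \<le> k" "y0 \<le> j"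
    using h jk by (auto simp: x0_def y0_def)
  then show ?thesis
    using jk h partial_sum_diff[of x0 "?h k" "?h j" "\<lambda>i. rescale \<rho> r1 r2 f (hor i)"]
      partial_sum_diff[of y0 j k "\<lambda>i. rescale \<rho> r1 r2 f (ver i)"]
    by (simp add: rescaled_boundary_def boundary_weight_eq[OF lam, of x0 y0])
qed

text \<open>Smaller parameters enlarge the vertical weights and shrink the horizontal ones. Moving
  up the line adds the former and subtracts the latter, so both effects have the same sign; only the
  vertical one is kept in the bound.\<close>

lemma rescaled_boundary_mono:
  assumes lam: "0 < lam" "lam < 1" and jk: "j \<le> k"
    and \<rho>: "0 < \<rho>" "\<rho> < 1"
    and r: "0 < r1'" "r1' \<le> r1" "r1 < 1" "0 < r2'" "r2' \<le> r2" "r2 < 1"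
    and f: "\<And>e. 0 \<le> f e"
  shows "(\<Sum>i\<in>{j<..k}. rescale \<rho> r1' r2' f (ver i) - rescale \<rho> r1 r2 f (ver i))
     \<le> (rescaled_boundary lam \<rho> r1' r2' f k - rescaled_boundary lam \<rho> r1 r2 f k)
       - (rescaled_boundary lam \<rho> r1' r2' f j - rescaled_boundary lam \<rho> r1 r2 f j)"
proof -
  have "rescale \<rho> r1' r2' f (hor i) \<le> rescale \<rho> r1 r2 f (hor i)" for i
    using \<rho> r f by (auto simp: rescale_def two_rate_def intro!: mult_right_mono divide_left_mono)
  then have "(\<Sum>i\<in>{line_abscissa lam k<..line_abscissa lam j}. rescale \<rho> r1' r2' f (hor i))
    \<le> (\<Sum>i\<in>{line_abscissa lam k<..line_abscissa lam j}. rescale \<rho> r1 r2 f (hor i))"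
    by (intro sum_mono)
  then show ?thesis
    using rescaled_boundary_diff[OF lam jk, of \<rho> r1' r2' f] rescaled_boundary_diff[OF lam jk, of \<rho> r1 r2 f]
    by (simp add: sum_subtractf)
qed

lemma rescale_ver_mono:
  assumes \<rho>: "0 < \<rho>" and r: "0 < r1'" "r1' \<le> r1" "0 < r2'" "r2' \<le> r2" and f: "\<And>e. 0 \<le> f e"
  shows "rescale \<rho> r1 r2 f (ver i) \<le> rescale \<rho> r1' r2' f (ver i)"
  using assms by (auto simp: rescale_def two_rate_def intro!: mult_right_mono divide_left_mono)

lemma rescaled_boundary_0 [simp]: "rescaled_boundary lam \<rho> r1 r2 f 0 = 0"
  by (simp add: rescaled_boundary_def boundary_weight_def)

section \<open>From a far exit point to a gap between two fields, in a fixed environment\<close>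

context
  fixes lam :: real and m n y0 :: int and \<theta> :: real
  assumes lam: "0 < lam" "lam < 1" and mn: "0 \<le> m" "0 \<le> n"
    and y0: "y0 \<le> 0" "m < line_abscissa lam y0"
  defines "\<theta> \<equiv> (1 - lam) / lam"
begin

lemma \<theta>_pos: "0 < \<theta>"
  using lam by (simp add: \<theta>_def)

lemma abscissa_n_nonpos: "line_abscissa lam n \<le> 0"
  using antimonoD[OF line_abscissa_antimono[OF lam] mn(2)] by simp

lemma y0_neg: "y0 < 0"
  using y0 mn by (cases "y0 = 0") auto

lemma abscissa_bounds:
  "real_of_int (line_abscissa lam k) \<le> - \<theta> * of_int k" "- \<theta> * of_int k < real_of_int (line_abscissa lam k) + 1"
  unfolding \<theta>_def by (rule line_abscissa_bounds[OF lam])+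

lemma abscissa_step: "real_of_int (line_abscissa lam (y - 1) - line_abscissa lam y) \<le> \<theta> + 1"
  using abscissa_bounds(1)[of "y - 1"] abscissa_bounds(2)[of y]
  by (simp add: algebra_simps)

lemma shifted_eq_site_field:
  fixes f :: "site \<Rightarrow> real"
  defines "x0 \<equiv> line_abscissa lam n"
  shows "shifted_field x0 y0 (below (line_abscissa lam) x0 y0) (nat (m - x0)) (nat (n - y0)) f
    = site_field (line_abscissa lam) x0 y0 f m n - partial_sum (\<lambda>i. f (hor i)) x0 0 - partial_sum (\<lambda>j. f (ver j)) y0 0"
  by (simp add: shifted_field_def site_field_def partial_sum_def)

text \<open>The line moves by at most \<theta> + 1 columns per row, so an exit between two line
  points costs at most (\<theta> + 1) B.\<close>

lemma shifted_field_le_path: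
  fixes f :: "site \<Rightarrow> real"
  assumes f: "\<And>e. 0 \<le> f e" and B: "\<And>i. line_abscissa lam n < i \<Longrightarrow> i \<le> line_abscissa lam y0 \<Longrightarrow> f (hor i) \<le> B"
    and B0: "0 \<le> B"
  defines "x0 \<equiv> line_abscissa lam n"
  shows "\<exists>k \<pi>. y0 < k \<and> k \<le> n \<and> up_right_path (line_point lam k) (m, n) \<pi> \<and>
     shifted_field x0 y0 (below (line_abscissa lam) x0 y0) (nat (m - x0)) (nat (n - y0)) f
       \<le> boundary_weight lam (\<lambda>i. f (hor i)) (\<lambda>j. f (ver j)) k + path_weight (\<lambda>z. f (bulk z)) \<pi> + (\<theta> + 1) * B"
proof -
  let ?h = "line_abscissa lam"
  note anti = line_abscissa_antimono[OF lam]
  have E: "partial_sum (\<lambda>i. f (hor i)) x0 (?h (y - 1)) - partial_sum (\<lambda>i. f (hor i)) x0 (?h y) \<le> (\<theta> + 1) * B"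
    if "y0 < y" "y \<le> n" for y
  proof -
    have h: "x0 \<le> ?h y" "?h y \<le> ?h (y - 1)" "?h (y - 1) \<le> ?h y0"
      using that antimonoD[OF anti, of y n] antimonoD[OF anti, of "y - 1" y] antimonoD[OF anti, of y0 "y - 1"]
      by (auto simp: x0_def)
    have "partial_sum (\<lambda>i. f (hor i)) x0 (?h (y - 1)) - partial_sum (\<lambda>i. f (hor i)) x0 (?h y)
       = (\<Sum>i\<in>{?h y<..?h (y - 1)}. f (hor i))"
      using h by (intro partial_sum_diff)
    also have "\<dots> \<le> of_nat (card {?h y<..?h (y - 1)}) * B"
      using h by (intro sum_bounded_above B) (auto simp: x0_def)
    also have "\<dots> \<le> (\<theta> + 1) * B"
      using h abscissa_step[of y] B0 by (intro mult_right_mono) auto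
    finally show ?thesis .
  qed
  have B': "0 \<le> (\<theta> + 1) * B" using \<theta>_pos B0 by simp
  have "\<exists>k \<pi>. y0 < k \<and> k \<le> n \<and> up_right_path (?h k, k) (m, n) \<pi> \<and>
    site_field ?h x0 y0 f m n \<le> partial_sum (\<lambda>i. f (hor i)) x0 (?h k) + partial_sum (\<lambda>j. f (ver j)) y0 k
       + path_weight (\<lambda>z. f (bulk z)) \<pi> + (\<theta> + 1) * B"
    by (rule site_field_le_path[OF anti _ f E B', where m = m])
      (use y0 y0_neg mn abscissa_n_nonpos in \<open>auto simp: x0_def\<close>)
  then obtain k \<pi> where *: "y0 < k" "k \<le> n" "up_right_path (?h k, k) (m, n) \<pi>"
    "site_field ?h x0 y0 f m n \<le> partial_sum (\<lambda>i. f (hor i)) x0 (?h k) + partial_sum (\<lambda>j. f (ver j)) y0 k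
       + path_weight (\<lambda>z. f (bulk z)) \<pi> + (\<theta> + 1) * B"
    by blast
  have "x0 \<le> ?h k" using antimonoD[OF anti *(2)] by (simp add: x0_def)
  then show ?thesis
    using * abscissa_n_nonpos y0 unfolding x0_def shifted_eq_site_field
    by (intro exI[of _ k] exI[of _ \<pi>]) (simp add: boundary_weight_eq[OF lam, of "?h n" y0] line_point_def)
qed

text \<open>At most 1 / \<theta> further rows share the abscissa of a line point, so the bulk
  weights on a vertical stretch add up to at most B / \<theta>.\<close>

lemma path_le_shifted_field:
  fixes f :: "site \<Rightarrow> real"
  assumes f: "\<And>e. 0 \<le> f e" and B: "\<And>i. y0 < i \<Longrightarrow> i \<le> n \<Longrightarrow> f (bulk (line_abscissa lam i, i)) \<le> B"
    and B0: "0 \<le> B" and k: "y0 < k" and \<pi>: "up_right_path (line_point lam k) (m, n) \<pi>"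
  defines "x0 \<equiv> line_abscissa lam n"
  shows "boundary_weight lam (\<lambda>i. f (hor i)) (\<lambda>j. f (ver j)) k + path_weight (\<lambda>z. f (bulk z)) \<pi>
     \<le> shifted_field x0 y0 (below (line_abscissa lam) x0 y0) (nat (m - x0)) (nat (n - y0)) f + B / \<theta>"
proof -
  let ?h = "line_abscissa lam"
  let ?S = "{i\<in>{k<..n}. ?h i = ?h k}"
  note anti = line_abscissa_antimono[OF lam]
  have kn: "k \<le> n" using up_right_path_le(2)[OF \<pi>] by (simp add: line_point_def)
  have x0: "x0 \<le> ?h k" using antimonoD[OF anti kn] by (simp add: x0_def)
  have "?S \<subseteq> {k<..k + \<lfloor>1 / \<theta>\<rfloor>}"
  proof
    fix i assume "i \<in> ?S"
    then have i: "k < i" "?h i = ?h k" by auto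
    have "\<theta> * of_int (i - k) < 1"
      using abscissa_bounds(1)[of i] abscissa_bounds(2)[of k] i(2)
      by (simp add: algebra_simps)
    then have "of_int (i - k) \<le> 1 / \<theta>" using \<theta>_pos by (simp add: field_simps)
    then have "i - k \<le> \<lfloor>1 / \<theta>\<rfloor>" by (simp add: le_floor_iff)
    then show "i \<in> {k<..k + \<lfloor>1 / \<theta>\<rfloor>}" using i by simp
  qed
  then have "card ?S \<le> card {k<..k + \<lfloor>1 / \<theta>\<rfloor>}" by (intro card_mono) auto
  also have "\<dots> = nat \<lfloor>1 / \<theta>\<rfloor>" by simp
  finally have "real (card ?S) \<le> real (nat \<lfloor>1 / \<theta>\<rfloor>)" by simp
  also have "\<dots> = of_int \<lfloor>1 / \<theta>\<rfloor>" using \<theta>_pos by simp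
  also have "\<dots> \<le> 1 / \<theta>" by simp
  finally have "real (card ?S) \<le> 1 / \<theta>" .
  moreover have "(\<Sum>i\<in>?S. f (bulk (?h i, i))) \<le> of_nat (card ?S) * B"
    using k by (intro sum_bounded_above B) auto
  ultimately have T: "(\<Sum>i\<in>?S. f (bulk (?h i, i))) \<le> B / \<theta>"
    using mult_right_mono[of "real (card ?S)" "1 / \<theta>" B] B0 by simp
  have "partial_sum (\<lambda>i. f (hor i)) x0 (?h k) + partial_sum (\<lambda>j. f (ver j)) y0 k + path_weight (\<lambda>z. f (bulk z)) \<pi>
     \<le> site_field ?h x0 y0 f m n + (\<Sum>i\<in>?S. f (bulk (?h i, i)))"
    using path_le_site_field[OF anti _ f \<pi>[unfolded line_point_def] k, of x0 n] by (simp add: x0_def)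
  then show ?thesis
    using T x0 k y0 abscissa_n_nonpos unfolding x0_def shifted_eq_site_field
    by (simp add: boundary_weight_eq[OF lam, of "?h n" y0])
qed

text \<open>The start of a path that nearly realises the first field plays the role of
  \<open>j\<close> in \<open>exit_compare\<close>. Its horizontal weights are bounded by 2 B after
  rescaling, while bulk weights are not rescaled; this gives the two summands in front of
  \<open>B\<close>.\<close>

lemma exit_point_field_gap:
  fixes f :: "site \<Rightarrow> real" and \<rho> :: real
  defines "z \<equiv> exit_point lam (\<lambda>z. f (bulk z)) (\<lambda>i. f (hor i)) (\<lambda>j. f (ver j)) (m, n)"
  defines "W \<equiv> \<lambda>r1 r2. rescaled_boundary lam \<rho> r1 r2 f"
  assumes f: "\<And>e. 0 \<le> f e" and B0: "0 \<le> B"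
    and B: "\<And>i. line_abscissa lam n < i \<Longrightarrow> i \<le> line_abscissa lam y0 \<Longrightarrow> f (hor i) \<le> B"
      "\<And>i. y0 < i \<Longrightarrow> i \<le> n \<Longrightarrow> f (bulk (line_abscissa lam i, i)) \<le> B"
    and \<rho>: "0 < \<rho>" "\<rho> < 1"
    and a: "0 < a1" "a1 \<le> (1 + \<rho>) / 2" "0 < a2" "a2 \<le> (1 + \<rho>) / 2"
    and b: "0 < b1" "b1 < 1" "0 < b2" "b2 < 1"
    and D: "D \<le> W b1 b2 z - W a1 a2 z"
    and mono: "\<And>j. y0 < j \<Longrightarrow> W a1 a2 j - W \<rho> \<rho> j \<le> W a1 a2 z - W \<rho> \<rho> z \<or> D \<le> W b1 b2 j - W a1 a2 j"
  shows "rescaled_field lam y0 m n \<rho> a1 a2 f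
     \<le> rescaled_field lam y0 m n \<rho> b1 b2 f + (2 * (\<theta> + 1) + 1 / \<theta>) * B - D"
proof -
  have a': "a1 < 1" "a2 < 1" using a \<rho> by auto
  have fa: "0 \<le> rescale \<rho> a1 a2 f e" and fb: "0 \<le> rescale \<rho> b1 b2 f e" for e
    using \<rho> a a' b f by (auto intro!: rescale_nonneg)
  have Ba: "rescale \<rho> a1 a2 f (hor i) \<le> 2 * B" if "line_abscissa lam n < i" "i \<le> line_abscissa lam y0" for i
  proof -
    \<comment> \<open>The upper bound (1 + \<rho>) / 2 on the parameters says 1 - a \<ge> (1 -
      \<rho>) / 2.\<close>
    have "(1 - \<rho>) / (1 - a1) \<le> 2" "(1 - \<rho>) / (1 - a2) \<le> 2" using a a' by (simp_all add: field_simps)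
    then have "two_rate \<rho> \<rho> (hor i) / two_rate a1 a2 (hor i) \<le> 2" by (simp add: two_rate_def)
    then show ?thesis
      unfolding rescale_def using B(1)[OF that] f[of "hor i"] by (intro mult_mono) auto
  qed
  note props = exit_point_props[OF lam mn, where w = "\<lambda>z. f (bulk z)" and p = "\<lambda>i. f (hor i)" and q = "\<lambda>j. f (ver j)",
    folded z_def]
  have zy: "y0 < z"
    using props(2) y0(2) antimonoD[OF line_abscissa_antimono[OF lam], of z y0] by (cases "z \<le> y0") auto
  obtain j \<pi> where j: "y0 < j" "up_right_path (line_point lam j) (m, n) \<pi>"
    "rescaled_field lam y0 m n \<rho> a1 a2 f \<le> W a1 a2 j + path_weight (\<lambda>z. f (bulk z)) \<pi> + (\<theta> + 1) * (2 * B)"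
    using shifted_field_le_path[of "rescale \<rho> a1 a2 f" "2 * B", OF fa Ba] B0
    by (auto simp: rescaled_field_def Let_def W_def rescaled_boundary_def)
  have up: "W b1 b2 k + path_weight (\<lambda>z. f (bulk z)) \<pi> \<le> rescaled_field lam y0 m n \<rho> b1 b2 f + B / \<theta>"
    if "k \<in> {j, z}" "up_right_path (line_point lam k) (m, n) \<pi>" for k \<pi>
    using path_le_shifted_field[of "rescale \<rho> b1 b2 f" B k \<pi>, OF fb] B(2) B0 that zy j(1)
    by (auto simp: rescaled_field_def Let_def W_def rescaled_boundary_def)
  have max: "last_passage_time (\<lambda>z. f (bulk z)) (line_point lam j) (m, n) + ereal (W \<rho> \<rho> j)
     \<le> last_passage_time (\<lambda>z. f (bulk z)) (line_point lam z) (m, n) + ereal (W \<rho> \<rho> z)"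
    using props(1)[of j] \<rho> by (simp add: W_def rescaled_boundary_def)
  have "rescaled_field lam y0 m n \<rho> a1 a2 f \<le> rescaled_field lam y0 m n \<rho> b1 b2 f + (\<theta> + 1) * (2 * B) + B / \<theta> - D"
    by (rule exit_compare[where W = "W \<rho> \<rho>" and W' = "W a1 a2" and W'' = "W b1 b2" and pt = "line_point lam"
          and j = j and z = z and \<pi> = \<pi>, OF max j(2,3) up D mono[OF j(1)]])
  then show ?thesis by (simp add: algebra_simps)
qed

text \<open>Lowering \<open>r1\<close> to \<rho> - \<delta> favours larger indices, so an exit
  \<open>j\<close> before \<open>z\<close> meets the first alternative of
  \<open>exit_compare\<close>; an exit beyond \<open>z\<close> is also at least \<open>K\<close> and
  collects the gain itself. The gain comes from the vertical weights of index 1 to \<open>K\<close>,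
  whose parameter drops from \<rho> - \<delta> to \<rho> - 2 \<delta>.\<close>

lemma exit_point_right_gap:
  fixes f :: "site \<Rightarrow> real"
  defines "z \<equiv> exit_point lam (\<lambda>z. f (bulk z)) (\<lambda>i. f (hor i)) (\<lambda>j. f (ver j)) (m, n)"
  assumes f: "\<And>e. 0 \<le> f e" and B0: "0 \<le> B"
    and B: "\<And>i. line_abscissa lam n < i \<Longrightarrow> i \<le> line_abscissa lam y0 \<Longrightarrow> f (hor i) \<le> B"
      "\<And>i. y0 < i \<Longrightarrow> i \<le> n \<Longrightarrow> f (bulk (line_abscissa lam i, i)) \<le> B"
    and \<rho>: "0 < \<rho>" "\<rho> < 1" and \<delta>: "0 < \<delta>" "6 * \<delta> \<le> \<rho>" "6 * \<delta> \<le> 1 - \<rho>"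
    and K: "0 \<le> K" "K \<le> z"
  shows "rescaled_field lam y0 m n \<rho> (\<rho> - \<delta>) \<rho> f
     \<le> rescaled_field lam y0 m n \<rho> (\<rho> - 2 * \<delta>) (\<rho> - 3 * \<delta>) f + (2 * (\<theta> + 1) + 1 / \<theta>) * B
       - \<rho> * \<delta> * (\<Sum>i\<in>{0<..K}. f (ver i))"
  unfolding z_def
proof (rule exit_point_field_gap[OF f B0 B \<rho>])
  let ?W = "\<lambda>r1 r2. rescaled_boundary lam \<rho> r1 r2 f"
  have m1: "?W (\<rho> - \<delta>) \<rho> j - ?W \<rho> \<rho> j \<le> ?W (\<rho> - \<delta>) \<rho> k - ?W \<rho> \<rho> k" if "j \<le> k" for j k
  proof -
    have "0 \<le> (\<Sum>i\<in>{j<..k}. rescale \<rho> (\<rho> - \<delta>) \<rho> f (ver i) - rescale \<rho> \<rho> \<rho> f (ver i))"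
      using \<rho> \<delta> f rescale_ver_mono[of \<rho> "\<rho> - \<delta>" \<rho> \<rho> \<rho> f] by (intro sum_nonneg) auto
    also have "\<dots> \<le> ?W (\<rho> - \<delta>) \<rho> k - ?W \<rho> \<rho> k - (?W (\<rho> - \<delta>) \<rho> j - ?W \<rho> \<rho> j)"
      using \<rho> \<delta> f that by (intro rescaled_boundary_mono lam) auto
    finally show ?thesis by simp
  qed
  have D: "\<rho> * \<delta> * (\<Sum>i\<in>{0<..K}. f (ver i)) \<le> ?W (\<rho> - 2 * \<delta>) (\<rho> - 3 * \<delta>) k - ?W (\<rho> - \<delta>) \<rho> k"
    if "K \<le> k" for k
  proof -
    let ?d = "\<lambda>i. rescale \<rho> (\<rho> - 2 * \<delta>) (\<rho> - 3 * \<delta>) f (ver i) - rescale \<rho> (\<rho> - \<delta>) \<rho> f (ver i)"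
    \<comment> \<open>The product of the two parameters is at most 1, which bounds the difference of
      the scale factors from below by \<rho> \<delta>.\<close>
    have c: "\<rho> * \<delta> \<le> \<rho> / (\<rho> - 2 * \<delta>) - \<rho> / (\<rho> - \<delta>)"
    proof -
      have "(\<rho> - 2 * \<delta>) * (\<rho> - \<delta>) \<le> 1 * 1" using \<rho> \<delta> by (intro mult_mono) auto
      then have "\<rho> * \<delta> * ((\<rho> - 2 * \<delta>) * (\<rho> - \<delta>)) \<le> \<rho> * \<delta> * 1" using \<rho> \<delta> by (intro mult_left_mono) auto
      moreover have "\<rho> / (\<rho> - 2 * \<delta>) - \<rho> / (\<rho> - \<delta>) = \<rho> * \<delta> / ((\<rho> - 2 * \<delta>) * (\<rho> - \<delta>))"
        using \<rho> \<delta> by (simp add: diff_frac_eq algebra_simps)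
      ultimately show ?thesis using \<rho> \<delta> by (simp add: pos_le_divide_eq)
    qed
    have "\<rho> * \<delta> * (\<Sum>i\<in>{0<..K}. f (ver i)) \<le> (\<Sum>i\<in>{0<..K}. ?d i)"
      unfolding sum_distrib_left
    proof (rule sum_mono)
      fix i assume "i \<in> {0<..K}"
      then have "?d i = (\<rho> / (\<rho> - 2 * \<delta>) - \<rho> / (\<rho> - \<delta>)) * f (ver i)"
        by (simp add: rescale_def two_rate_def left_diff_distrib)
      then show "\<rho> * \<delta> * f (ver i) \<le> ?d i" using mult_right_mono[OF c f] by simp
    qed
    also have "\<dots> \<le> (\<Sum>i\<in>{0<..k}. ?d i)"
      using \<rho> \<delta> f that rescale_ver_mono[of \<rho> "\<rho> - 2 * \<delta>" "\<rho> - \<delta>" "\<rho> - 3 * \<delta>" \<rho> f]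
      by (intro sum_mono2) auto
    also have "\<dots> \<le> ?W (\<rho> - 2 * \<delta>) (\<rho> - 3 * \<delta>) k - ?W (\<rho> - \<delta>) \<rho> k
        - (?W (\<rho> - 2 * \<delta>) (\<rho> - 3 * \<delta>) 0 - ?W (\<rho> - \<delta>) \<rho> 0)"
      using \<rho> \<delta> f that K by (intro rescaled_boundary_mono lam) auto
    finally show ?thesis by simp
  qed
  let ?z = "exit_point lam (\<lambda>z. f (bulk z)) (\<lambda>i. f (hor i)) (\<lambda>j. f (ver j)) (m, n)"
  have Kz: "K \<le> ?z" using K by (simp add: z_def)
  show "\<rho> * \<delta> * (\<Sum>i\<in>{0<..K}. f (ver i)) \<le> ?W (\<rho> - 2 * \<delta>) (\<rho> - 3 * \<delta>) ?z - ?W (\<rho> - \<delta>) \<rho> ?z"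
    using D[OF Kz] .
  show "?W (\<rho> - \<delta>) \<rho> j - ?W \<rho> \<rho> j \<le> ?W (\<rho> - \<delta>) \<rho> ?z - ?W \<rho> \<rho> ?z \<or>
     \<rho> * \<delta> * (\<Sum>i\<in>{0<..K}. f (ver i)) \<le> ?W (\<rho> - 2 * \<delta>) (\<rho> - 3 * \<delta>) j - ?W (\<rho> - \<delta>) \<rho> j" for j
    using m1[of j ?z] D[of j] Kz by (cases "j \<le> ?z") auto
qed (use \<rho> \<delta> in \<open>auto simp: field_simps\<close>)

text \<open>South-east of the origin \<open>r2\<close> acts, and raising it favours smaller indices.
  Boundary weights of negative index subtract vertical variables, so shrinking these by moving their
  parameter from \<rho> + \<delta> to \<rho> + 2 \<delta> is a gain.\<close>

lemma exit_point_left_gap: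
  fixes f :: "site \<Rightarrow> real"
  defines "z \<equiv> exit_point lam (\<lambda>z. f (bulk z)) (\<lambda>i. f (hor i)) (\<lambda>j. f (ver j)) (m, n)"
  assumes f: "\<And>e. 0 \<le> f e" and B0: "0 \<le> B"
    and B: "\<And>i. line_abscissa lam n < i \<Longrightarrow> i \<le> line_abscissa lam y0 \<Longrightarrow> f (hor i) \<le> B"
      "\<And>i. y0 < i \<Longrightarrow> i \<le> n \<Longrightarrow> f (bulk (line_abscissa lam i, i)) \<le> B"
    and \<rho>: "0 < \<rho>" "\<rho> < 1" and \<delta>: "0 < \<delta>" "6 * \<delta> \<le> \<rho>" "6 * \<delta> \<le> 1 - \<rho>"
    and K: "0 \<le> K" "z \<le> - K"
  shows "rescaled_field lam y0 m n \<rho> \<rho> (\<rho> + \<delta>) f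
     \<le> rescaled_field lam y0 m n \<rho> (\<rho> + 3 * \<delta>) (\<rho> + 2 * \<delta>) f + (2 * (\<theta> + 1) + 1 / \<theta>) * B
       - \<rho> * \<delta> * (\<Sum>i\<in>{-K<..0}. f (ver i))"
  unfolding z_def
proof (rule exit_point_field_gap[OF f B0 B \<rho>])
  let ?W = "\<lambda>r1 r2. rescaled_boundary lam \<rho> r1 r2 f"
  have m1: "?W \<rho> (\<rho> + \<delta>) k - ?W \<rho> \<rho> k \<le> ?W \<rho> (\<rho> + \<delta>) j - ?W \<rho> \<rho> j" if "j \<le> k" for j k
  proof -
    have "0 \<le> (\<Sum>i\<in>{j<..k}. rescale \<rho> \<rho> \<rho> f (ver i) - rescale \<rho> \<rho> (\<rho> + \<delta>) f (ver i))"
      using \<rho> \<delta> f rescale_ver_mono[of \<rho> \<rho> \<rho> \<rho> "\<rho> + \<delta>" f] by (intro sum_nonneg) auto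
    also have "\<dots> \<le> ?W \<rho> \<rho> k - ?W \<rho> (\<rho> + \<delta>) k - (?W \<rho> \<rho> j - ?W \<rho> (\<rho> + \<delta>) j)"
      using \<rho> \<delta> f that by (intro rescaled_boundary_mono lam) auto
    finally show ?thesis by simp
  qed
  have D: "\<rho> * \<delta> * (\<Sum>i\<in>{-K<..0}. f (ver i)) \<le> ?W (\<rho> + 3 * \<delta>) (\<rho> + 2 * \<delta>) k - ?W \<rho> (\<rho> + \<delta>) k"
    if "k \<le> - K" for k
  proof -
    let ?d = "\<lambda>i. rescale \<rho> \<rho> (\<rho> + \<delta>) f (ver i) - rescale \<rho> (\<rho> + 3 * \<delta>) (\<rho> + 2 * \<delta>) f (ver i)"
    have c: "\<rho> * \<delta> \<le> \<rho> / (\<rho> + \<delta>) - \<rho> / (\<rho> + 2 * \<delta>)"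
    proof -
      have "(\<rho> + \<delta>) * (\<rho> + 2 * \<delta>) \<le> 1 * 1" using \<rho> \<delta> by (intro mult_mono) auto
      then have "\<rho> * \<delta> * ((\<rho> + \<delta>) * (\<rho> + 2 * \<delta>)) \<le> \<rho> * \<delta> * 1" using \<rho> \<delta> by (intro mult_left_mono) auto
      moreover have "\<rho> / (\<rho> + \<delta>) - \<rho> / (\<rho> + 2 * \<delta>) = \<rho> * \<delta> / ((\<rho> + \<delta>) * (\<rho> + 2 * \<delta>))"
        using \<rho> \<delta> by (simp add: diff_frac_eq algebra_simps)
      ultimately show ?thesis using \<rho> \<delta> by (simp add: pos_le_divide_eq)
    qed
    have "\<rho> * \<delta> * (\<Sum>i\<in>{-K<..0}. f (ver i)) \<le> (\<Sum>i\<in>{-K<..0}. ?d i)"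
      unfolding sum_distrib_left
    proof (rule sum_mono)
      fix i assume "i \<in> {-K<..0}"
      then have "?d i = (\<rho> / (\<rho> + \<delta>) - \<rho> / (\<rho> + 2 * \<delta>)) * f (ver i)"
        by (simp add: rescale_def two_rate_def left_diff_distrib)
      then show "\<rho> * \<delta> * f (ver i) \<le> ?d i" using mult_right_mono[OF c f] by simp
    qed
    also have "\<dots> \<le> (\<Sum>i\<in>{k<..0}. ?d i)"
      using \<rho> \<delta> f that rescale_ver_mono[of \<rho> \<rho> "\<rho> + 3 * \<delta>" "\<rho> + \<delta>" "\<rho> + 2 * \<delta>" f]
      by (intro sum_mono2) auto
    also have "\<dots> \<le> ?W \<rho> (\<rho> + \<delta>) 0 - ?W (\<rho> + 3 * \<delta>) (\<rho> + 2 * \<delta>) 0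
        - (?W \<rho> (\<rho> + \<delta>) k - ?W (\<rho> + 3 * \<delta>) (\<rho> + 2 * \<delta>) k)"
      using \<rho> \<delta> f that K by (intro rescaled_boundary_mono lam) auto
    finally show ?thesis by simp
  qed
  let ?z = "exit_point lam (\<lambda>z. f (bulk z)) (\<lambda>i. f (hor i)) (\<lambda>j. f (ver j)) (m, n)"
  have Kz: "?z \<le> - K" using K by (simp add: z_def)
  show "\<rho> * \<delta> * (\<Sum>i\<in>{-K<..0}. f (ver i)) \<le> ?W (\<rho> + 3 * \<delta>) (\<rho> + 2 * \<delta>) ?z - ?W \<rho> (\<rho> + \<delta>) ?z"
    using D[OF Kz] .
  show "?W \<rho> (\<rho> + \<delta>) j - ?W \<rho> \<rho> j \<le> ?W \<rho> (\<rho> + \<delta>) ?z - ?W \<rho> \<rho> ?z \<or>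
     \<rho> * \<delta> * (\<Sum>i\<in>{-K<..0}. f (ver i)) \<le> ?W (\<rho> + 3 * \<delta>) (\<rho> + 2 * \<delta>) j - ?W \<rho> (\<rho> + \<delta>) j" for j
    using m1[of ?z j] D[of j] Kz by (cases "?z \<le> j") auto
qed (use \<rho> \<delta> in \<open>auto simp: field_simps\<close>)

end

section \<open>Tail bounds\<close>

lemma lpp_field_cong:
  assumes "\<And>e. e \<in> sites x0 y0 a d \<Longrightarrow> f e = g e" "i \<le> a" "j \<le> d"
  shows "lpp_field x0 y0 F f i j = lpp_field x0 y0 F g i j"
  using assms
proof (induction x0 y0 F f i j rule: lpp_field.induct)
  case (4 x0 y0 F f i j)
  have "f (bulk (x0 + int (Suc i), y0 + int (Suc j))) = g (bulk (x0 + int (Suc i), y0 + int (Suc j)))"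
    using "4.prems" by (intro "4.prems"(1)) auto
  then show ?case using 4 by simp
qed auto

lemma shifted_field_cong:
  assumes "\<And>e. e \<in> sites x0 y0 a d \<Longrightarrow> f e = g e" "0 \<le> x0 + int a" "0 \<le> y0 + int d"
  shows "shifted_field x0 y0 F a d f = shifted_field x0 y0 F a d g"
proof -
  have "(\<Sum>i\<in>{x0<..0}. f (hor i)) = (\<Sum>i\<in>{x0<..0}. g (hor i))"
    "(\<Sum>i\<in>{y0<..0}. f (ver i)) = (\<Sum>i\<in>{y0<..0}. g (ver i))"
    using assms by (auto intro!: sum.cong)
  then show ?thesis
    using lpp_field_cong[of x0 y0 a d f g a d F, OF assms(1)] by (simp add: shifted_field_def)
qed

lemma shifted_field_measurable:
  assumes X: "\<And>e. (\<lambda>s. X s e) \<in> borel_measurable N"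
  shows "(\<lambda>s. shifted_field x0 y0 F a d (X s)) \<in> borel_measurable N"
  unfolding shifted_field_def
  by (intro borel_measurable_diff lpp_field_measurable borel_measurable_sum X)

lemma (in prob_space) exponential_markov:
  assumes T: "T \<in> borel_measurable M" and A: "0 \<le> A"
    and mgf: "(\<integral>\<^sup>+s. ennreal (exp (T s)) \<partial>M) = ennreal A"
  shows "prob {s\<in>space M. c \<le> T s} \<le> exp (- c) * A"
proof -
  have "emeasure M {s\<in>space M. 1 \<le> ennreal (exp (- c)) * ennreal (exp (T s))}
     \<le> ennreal (exp (- c)) * (\<integral>\<^sup>+s. ennreal (exp (T s)) * indicator (space M) s \<partial>M)"
    using T by (intro nn_integral_Markov_inequality) auto
  also have "(\<integral>\<^sup>+s. ennreal (exp (T s)) * indicator (space M) s \<partial>M) = ennreal A"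
    unfolding mgf[symmetric] by (intro nn_integral_cong) simp
  also have "{s\<in>space M. 1 \<le> ennreal (exp (- c)) * ennreal (exp (T s))} = {s\<in>space M. c \<le> T s}"
    by (simp flip: ennreal_mult exp_add)
  finally show ?thesis
    using A by (simp add: emeasure_eq_measure flip: ennreal_mult)
qed

lemma (in prob_space) distributed_exponential_scale:
  assumes X: "distributed M lborel X (exponential_density r)" and r: "0 < r" "0 < r'"
  shows "distributed M lborel (\<lambda>s. r / r' * X s) (exponential_density r')"
proof -
  have [measurable]: "X \<in> borel_measurable M"
    using X r by (simp add: exponential_distributed_iff)
  show ?thesis
  proof (subst exponential_distributed_iff[OF r(2)], intro conjI allI impI)
    fix a :: real assume a: "0 \<le> a"
    have "\<P>(s in M. r / r' * X s \<le> a) = \<P>(s in M. X s \<le> a * r' / r)"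
      using r by (intro arg_cong[where f = prob]) (auto simp: field_simps)
    also have "\<dots> = 1 - exp (- (a * r' / r) * r)"
      using a r by (intro exponential_distributedD_le[OF X]) auto
    finally show "\<P>(s in M. r / r' * X s \<le> a) = 1 - exp (- a * r')"
      using r by simp
  qed measurable
qed

text \<open>Mean value theorem for b ln u - a ln (1 - u), whose derivative a / (1 - u) + b / u is
  the mean passage time of the stationary model with parameter u.\<close>

lemma mgf_exponent:
  fixes a b :: nat
  assumes r: "0 < r1" "r1 < 1" "0 < r2" "r2 < 1"
  shows "\<exists>\<xi>. min r1 r2 \<le> \<xi> \<and> \<xi> \<le> max r1 r2 \<and>
     ((1 - r2) / (1 - r1)) ^ a * (r1 / r2) ^ b = exp ((r1 - r2) * (a / (1 - \<xi>) + b / \<xi>))"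
proof -
  define F where "F = (\<lambda>u::real. b * ln u - a * ln (1 - u))"
  have der: "(F has_real_derivative (a / (1 - u) + b / u)) (at u)" if "0 < u" "u < 1" for u
    unfolding F_def using that by (auto intro!: derivative_eq_intros)
  have F: "((1 - r2) / (1 - r1)) ^ a * (r1 / r2) ^ b = exp (F r1 - F r2)"
  proof -
    have "F r1 - F r2 = a * ln ((1 - r2) / (1 - r1)) + b * ln (r1 / r2)"
      using r by (simp add: F_def ln_div algebra_simps)
    then have "exp (F r1 - F r2) = exp (ln ((1 - r2) / (1 - r1))) ^ a * exp (ln (r1 / r2)) ^ b"
      by (simp add: exp_add exp_of_nat_mult)
    moreover have "0 < (1 - r2) / (1 - r1)" "0 < r1 / r2" using r by auto
    ultimately show ?thesis by (simp only: exp_ln)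
  qed
  consider "r1 < r2" | "r1 = r2" | "r2 < r1" by linarith
  then show ?thesis
  proof cases
    case 1
    have "\<And>u. r1 \<le> u \<Longrightarrow> u \<le> r2 \<Longrightarrow> (F has_real_derivative (a / (1 - u) + b / u)) (at u)"
      using der r by simp
    from MVT2[OF 1 this] obtain \<xi> where "r1 < \<xi>" "\<xi> < r2"
      "F r2 - F r1 = (r2 - r1) * (a / (1 - \<xi>) + b / \<xi>)"
      by blast
    moreover from this have "F r1 - F r2 = (r1 - r2) * (a / (1 - \<xi>) + b / \<xi>)"
      by (metis minus_diff_eq mult_minus_left)
    ultimately show ?thesis unfolding F by (intro exI[of _ \<xi>]) auto
  next
    case 2
    then show ?thesis using r by (intro exI[of _ r1]) simp
  next
    case 3
    have "\<And>u. r2 \<le> u \<Longrightarrow> u \<le> r1 \<Longrightarrow> (F has_real_derivative (a / (1 - u) + b / u)) (at u)"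
      using der r by simp
    from MVT2[OF 3 this] obtain \<xi> where "r2 < \<xi>" "\<xi> < r1"
      "F r1 - F r2 = (r1 - r2) * (a / (1 - \<xi>) + b / \<xi>)"
      by blast
    then show ?thesis unfolding F by (intro exI[of _ \<xi>]) simp
  qed
qed

text \<open>This is where the direction of the end point enters: the mean is minimal at \<xi> =
  \<rho>, so a change of parameter costs only to second order.\<close>

lemma characteristic_direction:
  fixes \<rho> \<xi> :: real
  assumes "0 < \<xi>" "\<xi> < 1"
  shows "(1 - \<rho>)\<^sup>2 / (1 - \<xi>) + \<rho>\<^sup>2 / \<xi> = 1 + (\<xi> - \<rho>)\<^sup>2 / (\<xi> * (1 - \<xi>))"
  using assms by (simp add: divide_simps) (simp add: power2_eq_square algebra_simps)

text \<open>\<open>C\<close> absorbs the integer parts and the shift of the end point. Since 3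
  \<delta> is at most half of \<rho> and of 1 - \<rho>, the inverses at most double, and 36 is 9
  times 4. The quadratic term is nonnegative and so disappears from the lower bound.\<close>

lemma mean_bounds:
  fixes \<rho> \<xi> \<delta> m n N C :: real
  assumes \<rho>: "0 < \<rho>" "\<rho> < 1" and \<delta>: "0 < \<delta>" "6 * \<delta> \<le> \<rho>" "6 * \<delta> \<le> 1 - \<rho>"
    and \<xi>: "\<bar>\<xi> - \<rho>\<bar> \<le> 3 * \<delta>" and N: "0 \<le> N"
    and C: "\<bar>m - (1 - \<rho>)\<^sup>2 * N\<bar> \<le> C" "\<bar>n - \<rho>\<^sup>2 * N\<bar> \<le> C"
  shows "N - C * (2 / \<rho> + 2 / (1 - \<rho>)) \<le> m / (1 - \<xi>) + n / \<xi>"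
    and "m / (1 - \<xi>) + n / \<xi> \<le> N + 36 * \<delta>\<^sup>2 * N / (\<rho> * (1 - \<rho>)) + C * (2 / \<rho> + 2 / (1 - \<rho>))"
proof -
  have x: "\<rho> / 2 \<le> \<xi>" "(1 - \<rho>) / 2 \<le> 1 - \<xi>" using \<xi> \<delta> by (simp_all add: abs_le_iff)
  then have x0: "0 < \<xi>" "\<xi> < 1" using \<rho> by auto
  have C0: "0 \<le> C" using C(1) by linarith
  let ?R = "(m - (1 - \<rho>)\<^sup>2 * N) / (1 - \<xi>) + (n - \<rho>\<^sup>2 * N) / \<xi>"
  have inv: "1 / \<xi> \<le> 2 / \<rho>" "1 / (1 - \<xi>) \<le> 2 / (1 - \<rho>)"
    using x x0 \<rho> by (simp_all add: field_simps)
  have eq: "m / (1 - \<xi>) + n / \<xi> = N * ((1 - \<rho>)\<^sup>2 / (1 - \<xi>) + \<rho>\<^sup>2 / \<xi>) + ?R"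
    using x0 by (simp add: diff_divide_distrib algebra_simps)
  have eq': "m / (1 - \<xi>) + n / \<xi> = N + N * ((\<xi> - \<rho>)\<^sup>2 / (\<xi> * (1 - \<xi>))) + ?R"
    unfolding eq characteristic_direction[OF x0] by (simp add: algebra_simps)
  have "\<bar>?R\<bar> \<le> \<bar>(m - (1 - \<rho>)\<^sup>2 * N) / (1 - \<xi>)\<bar> + \<bar>(n - \<rho>\<^sup>2 * N) / \<xi>\<bar>"
    by (rule abs_triangle_ineq)
  also have "\<dots> = \<bar>m - (1 - \<rho>)\<^sup>2 * N\<bar> * (1 / (1 - \<xi>)) + \<bar>n - \<rho>\<^sup>2 * N\<bar> * (1 / \<xi>)"
    using x0 by (simp add: abs_divide)
  also have "\<dots> \<le> C * (2 / (1 - \<rho>)) + C * (2 / \<rho>)"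
    using C C0 inv x0 by (intro add_mono mult_mono) auto
  finally have R: "\<bar>?R\<bar> \<le> C * (2 / \<rho> + 2 / (1 - \<rho>))" by (simp add: algebra_simps)
  have q0: "0 \<le> (\<xi> - \<rho>)\<^sup>2 / (\<xi> * (1 - \<xi>))" using x0 by simp
  have "(\<xi> - \<rho>)\<^sup>2 \<le> (3 * \<delta>)\<^sup>2"
    using \<xi> \<delta> by (metis abs_ge_zero power2_abs power_mono)
  then have s: "(\<xi> - \<rho>)\<^sup>2 \<le> 9 * \<delta>\<^sup>2" by (simp add: power_mult_distrib)
  have "(\<xi> - \<rho>)\<^sup>2 / (\<xi> * (1 - \<xi>)) = (\<xi> - \<rho>)\<^sup>2 * ((1 / \<xi>) * (1 / (1 - \<xi>)))" by simp
  also have "\<dots> \<le> 9 * \<delta>\<^sup>2 * ((2 / \<rho>) * (2 / (1 - \<rho>)))"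
    using s inv x0 \<rho> by (intro mult_mono) auto
  also have "\<dots> = 36 * \<delta>\<^sup>2 / (\<rho> * (1 - \<rho>))" by simp
  finally have "N * ((\<xi> - \<rho>)\<^sup>2 / (\<xi> * (1 - \<xi>))) \<le> N * (36 * \<delta>\<^sup>2 / (\<rho> * (1 - \<rho>)))"
    using N by (rule mult_left_mono)
  also have "\<dots> = 36 * \<delta>\<^sup>2 * N / (\<rho> * (1 - \<rho>))" by simp
  finally show "m / (1 - \<xi>) + n / \<xi> \<le> N + 36 * \<delta>\<^sup>2 * N / (\<rho> * (1 - \<rho>)) + C * (2 / \<rho> + 2 / (1 - \<rho>))"
    using R unfolding eq' by linarith
  show "N - C * (2 / \<rho> + 2 / (1 - \<rho>)) \<le> m / (1 - \<xi>) + n / \<xi>"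
    using R mult_nonneg_nonneg[OF N q0] unfolding eq' abs_le_iff by linarith
qed

section \<open>The random environment: laws and tails\<close>

context stationary_lpp
begin

abbreviation env :: "'a \<Rightarrow> site \<Rightarrow> real" where
  "env s \<equiv> (\<lambda>e. case_sum \<omega> (case_sum p q) e s)"

lemma env_distributed:
  "distributed \<Omega> lborel (\<lambda>s. env s e) (exponential_density (two_rate \<rho> \<rho> e))"
  using bulk horizontal vertical by (cases e rule: sum.exhaust[case_product sum.exhaust]) 
    (auto simp: two_rate_def split: sum.split)

context
  assumes \<rho>: "0 < \<rho>" "\<rho> < 1"
begin

lemma env_rate_pos: "0 < two_rate \<rho> \<rho> e"
  using \<rho> by (intro two_rate_pos)

lemma env_measurable: "(\<lambda>s. env s e) \<in> borel_measurable \<Omega>"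
  using env_distributed[of e] exponential_distributed_iff[OF env_rate_pos[of e]] by blast

lemma rescale_measurable: "(\<lambda>s. rescale \<rho> r1 r2 (env s) e) \<in> borel_measurable \<Omega>"
  unfolding rescale_def by (intro borel_measurable_times env_measurable) auto

lemma rescaled_field_measurable: "(\<lambda>s. rescaled_field lam y0 m n \<rho> r1 r2 (env s)) \<in> borel_measurable \<Omega>"
  unfolding rescaled_field_def Let_def
  by (intro shifted_field_measurable rescale_measurable)

lemma env_nonneg: "AE s in \<Omega>. \<forall>e. 0 \<le> env s e"
proof (subst AE_all_countable, rule allI)
  fix e
  have [measurable]: "(\<lambda>s. env s e) \<in> borel_measurable \<Omega>" by (rule env_measurable)
  have "prob {s\<in>space \<Omega>. env s e \<le> 0} = 1 - exp (- 0 * two_rate \<rho> \<rho> e)"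
    by (rule exponential_distributedD_le[OF env_distributed order_refl env_rate_pos])
  then have "AE s in \<Omega>. s \<notin> {s\<in>space \<Omega>. env s e \<le> 0}"
    by (intro AE_not_in) (auto simp: null_sets_def emeasure_eq_measure)
  then show "AE s in \<Omega>. 0 \<le> env s e"
    by (rule AE_mp) (rule AE_I2, auto)
qed

lemma distr_rescale:
  assumes r: "0 < r1" "r1 < 1" "0 < r2" "r2 < 1"
  shows "distr \<Omega> borel (\<lambda>s. rescale \<rho> r1 r2 (env s) e) = expo (two_rate r1 r2 e)"
proof -
  have "distributed \<Omega> lborel (\<lambda>s. rescale \<rho> r1 r2 (env s) e) (exponential_density (two_rate r1 r2 e))"
    unfolding rescale_def
    using r by (intro distributed_exponential_scale[OF env_distributed] env_rate_pos two_rate_pos)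
  then have "distr \<Omega> lborel (\<lambda>s. rescale \<rho> r1 r2 (env s) e) = expo (two_rate r1 r2 e)"
    by (simp add: distributed_def expo_def)
  moreover have "distr \<Omega> borel (\<lambda>s. rescale \<rho> r1 r2 (env s) e) = distr \<Omega> lborel (\<lambda>s. rescale \<rho> r1 r2 (env s) e)"
    by (rule distr_cong) auto
  ultimately show ?thesis by simp
qed

lemma mgf_rescaled_field:
  assumes r: "0 < r1" "r1 < 1" "0 < r2" "r2 < 1" and mn: "0 \<le> m" "0 \<le> n" and y0: "y0 < 0"
    and lam: "0 < lam" "lam < 1"
  shows "(\<integral>\<^sup>+s. ennreal (exp ((r1 - r2) * rescaled_field lam y0 m n \<rho> r1 r2 (env s))) \<partial>\<Omega>)
    = ennreal (((1 - r2) / (1 - r1)) ^ nat m * (r1 / r2) ^ nat n)"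
proof -
  define x0 where "x0 = line_abscissa lam n"
  define a d where "a = nat (m - x0)" and "d = nat (n - y0)"
  define F where "F = below (line_abscissa lam) x0 y0"
  let ?K = "sites x0 y0 a d"
  let ?X = "\<lambda>s. \<lambda>e\<in>?K. rescale \<rho> r1 r2 (env s) e"
  let ?\<phi> = "\<lambda>f. ennreal (exp ((r1 - r2) * shifted_field x0 y0 F a d f))"
  have x0: "x0 \<le> 0"
    using antimonoD[OF line_abscissa_antimono[OF lam] mn(2)] by (simp add: x0_def)
  have ad: "x0 + int a = m" "y0 + int d = n" using x0 mn y0 by (auto simp: a_def d_def)
  have ne: "?K \<noteq> {}"
  proof -
    have "ver n \<in> ?K" using ad y0 mn by simp
    then show ?thesis by blast
  qed
  have "indep_vars (\<lambda>_. borel) (\<lambda>e s. rescale \<rho> r1 r2 (env s) e) ?K"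
  proof -
    have "indep_vars (\<lambda>_. borel) (\<lambda>e s. two_rate \<rho> \<rho> e / two_rate r1 r2 e * case_sum \<omega> (case_sum p q) e s) UNIV"
      by (rule indep_vars_compose2[OF indep]) auto
    then show ?thesis
      unfolding rescale_def by (rule indep_vars_subset) simp
  qed
  then have law: "distr \<Omega> (PiM ?K (\<lambda>_. borel)) ?X = PiM ?K (\<lambda>e. expo (two_rate r1 r2 e))"
    by (subst (asm) indep_vars_iff_distr_eq_PiM'[OF ne rescale_measurable]) (simp add: distr_rescale[OF r])
  have X: "?X \<in> measurable \<Omega> (PiM ?K (\<lambda>_. borel))"
    by (intro measurable_restrict rescale_measurable)
  have "?\<phi> \<in> borel_measurable (PiM ?K (\<lambda>_. borel))"
  proof -
    have "(\<lambda>f. shifted_field x0 y0 F a d f) \<in> borel_measurable (PiM ?K (\<lambda>_. borel :: real measure))"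
    proof -
      \<comment> \<open>Only the coordinates in \<open>?K\<close> are measurable on the product
        space; the others are set to 0, which leaves the field unchanged.\<close>
      have "(\<lambda>f. shifted_field x0 y0 F a d (\<lambda>e. if e \<in> ?K then f e else 0)) \<in> borel_measurable (PiM ?K (\<lambda>_. borel :: real measure))"
      proof (rule shifted_field_measurable)
        fix e show "(\<lambda>f. if e \<in> ?K then f e else 0) \<in> borel_measurable (PiM ?K (\<lambda>_. borel :: real measure))"
          by (cases "e \<in> ?K") auto
      qed
      moreover have "shifted_field x0 y0 F a d (\<lambda>e. if e \<in> ?K then f e else 0) = shifted_field x0 y0 F a d f" for f
        using ad mn by (intro shifted_field_cong) auto
      ultimately show ?thesis by simp
    qed
    then show ?thesis by measurable
  qed
  then have "(\<integral>\<^sup>+f. ?\<phi> f \<partial>distr \<Omega> (PiM ?K (\<lambda>_. borel)) ?X) = (\<integral>\<^sup>+s. ?\<phi> (?X s) \<partial>\<Omega>)"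
    using X by (intro nn_integral_distr) auto
  moreover have "shifted_field x0 y0 F a d (?X s) = rescaled_field lam y0 m n \<rho> r1 r2 (env s)" for s
  proof -
    have "shifted_field x0 y0 F a d (?X s) = shifted_field x0 y0 F a d (rescale \<rho> r1 r2 (env s))"
      using ad mn by (intro shifted_field_cong) auto
    then show ?thesis
      by (simp add: rescaled_field_def Let_def x0_def a_def d_def F_def)
  qed
  ultimately have "(\<integral>\<^sup>+s. ennreal (exp ((r1 - r2) * rescaled_field lam y0 m n \<rho> r1 r2 (env s))) \<partial>\<Omega>)
     = (\<integral>\<^sup>+f. ?\<phi> f \<partial>PiM ?K (\<lambda>e. expo (two_rate r1 r2 e)))"
    by (simp add: law)
  also have "\<dots> = ennreal (((1 - r2) / (1 - r1)) ^ nat m * (r1 / r2) ^ nat n)"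
    using mgf_shifted_field[OF r x0, of a y0 d F] ad mn y0 by simp
  finally show ?thesis .
qed

text \<open>Markov's inequality for the exact moment. Keeping the factor r1 - r2 inside the event
  covers the lower tail for r1 < r2 and the upper tail for r1 > r2 at once.\<close>

lemma prob_rescaled_field_tail:
  assumes r: "0 < r1" "r1 < 1" "0 < r2" "r2 < 1" and mn: "0 \<le> m" "0 \<le> n" and y0: "y0 < 0"
    and lam: "0 < lam" "lam < 1"
  shows "\<exists>\<xi>. min r1 r2 \<le> \<xi> \<and> \<xi> \<le> max r1 r2 \<and>
    prob {s\<in>space \<Omega>. (r1 - r2) * v \<le> (r1 - r2) * rescaled_field lam y0 m n \<rho> r1 r2 (env s)}
      \<le> exp ((r1 - r2) * (of_int m / (1 - \<xi>) + of_int n / \<xi> - v))"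
proof -
  obtain \<xi> where \<xi>: "min r1 r2 \<le> \<xi>" "\<xi> \<le> max r1 r2"
    "((1 - r2) / (1 - r1)) ^ nat m * (r1 / r2) ^ nat n = exp ((r1 - r2) * (nat m / (1 - \<xi>) + nat n / \<xi>))"
    using mgf_exponent[OF r, of "nat m" "nat n"] by auto
  have "prob {s\<in>space \<Omega>. (r1 - r2) * v \<le> (r1 - r2) * rescaled_field lam y0 m n \<rho> r1 r2 (env s)}
     \<le> exp (- ((r1 - r2) * v)) * exp ((r1 - r2) * (nat m / (1 - \<xi>) + nat n / \<xi>))"
    using mgf_rescaled_field[OF assms] rescaled_field_measurable unfolding \<xi>(3)
    by (intro exponential_markov) auto
  also have "\<dots> = exp ((r1 - r2) * (of_int m / (1 - \<xi>) + of_int n / \<xi> - v))"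
    using mn by (simp add: algebra_simps flip: exp_add)
  finally show ?thesis using \<xi> by blast
qed

text \<open>Chernoff's bound at exponent -\<rho>, where each variable has exponential moment 1 / 2;
  the rate is 1 / 2 - ln 2 \<le> -1 / 8.\<close>

lemma prob_sum_vertical:
  assumes I: "finite I"
  shows "prob {s\<in>space \<Omega>. (\<Sum>i\<in>I. q i s) \<le> card I / (2 * \<rho>)} \<le> exp (- real (card I) / 8)"
proof -
  have q: "(\<lambda>s. q i s) \<in> borel_measurable \<Omega>" for i
    using env_measurable[of "ver i"] by simp
  have "indep_vars (\<lambda>_. borel) (\<lambda>e s. ennreal (exp (- \<rho> * case_sum \<omega> (case_sum p q) e s))) (ver ` I)"
    by (rule indep_vars_subset[OF indep_vars_compose2[OF indep]]) auto
  then have "(\<integral>\<^sup>+s. (\<Prod>e\<in>ver ` I. ennreal (exp (- \<rho> * env s e))) \<partial>\<Omega>)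
     = (\<Prod>e\<in>ver ` I. \<integral>\<^sup>+s. ennreal (exp (- \<rho> * env s e)) \<partial>\<Omega>)"
    using I by (intro indep_vars_nn_integral) auto
  also have "\<dots> = (\<Prod>e\<in>ver ` I. ennreal (1 / 2))"
  proof (intro prod.cong refl)
    fix e assume "e \<in> ver ` I"
    then have rate: "two_rate \<rho> \<rho> e = \<rho>" by (auto simp: two_rate_def)
    have "(\<integral>\<^sup>+s. ennreal (exp (- \<rho> * env s e)) \<partial>\<Omega>)
       = (\<integral>\<^sup>+x. ennreal (exp (- \<rho> * x)) \<partial>distr \<Omega> borel (\<lambda>s. rescale \<rho> \<rho> \<rho> (env s) e))"
      using \<rho> env_measurable by (subst nn_integral_distr) auto
    also have "\<dots> = ennreal (1 / 2)"
      unfolding distr_rescale[OF \<rho> \<rho>] rate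
      using \<rho> nn_integral_expo_exp[of \<rho> "- \<rho>"] by simp
    finally show "(\<integral>\<^sup>+s. ennreal (exp (- \<rho> * env s e)) \<partial>\<Omega>) = ennreal (1 / 2)" .
  qed
  also have "\<dots> = ennreal ((1 / 2) ^ card I)"
    by (subst ennreal_power[symmetric]) (simp_all add: card_image inj_on_def)
  also have "(\<integral>\<^sup>+s. (\<Prod>e\<in>ver ` I. ennreal (exp (- \<rho> * env s e))) \<partial>\<Omega>)
      = (\<integral>\<^sup>+s. ennreal (exp (- \<rho> * (\<Sum>i\<in>I. q i s))) \<partial>\<Omega>)"
    using I by (intro nn_integral_cong)
      (simp add: prod.reindex inj_on_def prod_ennreal sum_distrib_left exp_sum flip: sum_negf)
  finally have "(\<integral>\<^sup>+s. ennreal (exp (- \<rho> * (\<Sum>i\<in>I. q i s))) \<partial>\<Omega>) = ennreal ((1 / 2) ^ card I)" .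
  then have "prob {s\<in>space \<Omega>. - (real (card I) / 2) \<le> - \<rho> * (\<Sum>i\<in>I. q i s)}
     \<le> exp (- (- (real (card I) / 2))) * (1 / 2) ^ card I"
    using q by (intro exponential_markov) auto
  also have "\<dots> = exp (real (card I) * (1 / 2 - ln 2))"
  proof -
    have "exp (real (card I) * - ln 2) = (1 / 2) ^ card I"
      unfolding exp_of_nat_mult by (simp add: exp_minus inverse_eq_divide)
    moreover have "exp (- (- (real (card I) / 2))) * exp (real (card I) * - ln 2)
      = exp (real (card I) * (1 / 2 - ln 2))"
      unfolding exp_add[symmetric] by (rule arg_cong[where f = exp]) (simp add: algebra_simps)
    ultimately show ?thesis by (simp only:)
  qed
  also have "\<dots> \<le> exp (- real (card I) / 8)"
    using ln2_ge_two_thirds mult_left_mono[of "1 / 2 - ln 2" "- (1 / 8)" "real (card I)"] by simp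
  also have "{s\<in>space \<Omega>. - (real (card I) / 2) \<le> - \<rho> * (\<Sum>i\<in>I. q i s)}
     = {s\<in>space \<Omega>. (\<Sum>i\<in>I. q i s) \<le> card I / (2 * \<rho>)}"
    using \<rho> by (auto simp: field_simps)
  finally show ?thesis .
qed

lemma prob_env_large:
  assumes J: "finite J" "\<And>e. e \<in> J \<Longrightarrow> 1 - \<rho> \<le> two_rate \<rho> \<rho> e" and B: "0 \<le> B"
  shows "(\<Union>e\<in>J. {s\<in>space \<Omega>. B < env s e}) \<in> events"
    and "prob (\<Union>e\<in>J. {s\<in>space \<Omega>. B < env s e}) \<le> card J * exp (- (1 - \<rho>) * B)"
proof -
  have m: "{s\<in>space \<Omega>. B < env s e} \<in> events" for e
    using env_measurable[of e] by measurable
  show "(\<Union>e\<in>J. {s\<in>space \<Omega>. B < env s e}) \<in> events"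
    using J(1) m by (intro sets.finite_UN) auto
  have "prob (\<Union>e\<in>J. {s\<in>space \<Omega>. B < env s e}) \<le> (\<Sum>e\<in>J. prob {s\<in>space \<Omega>. B < env s e})"
    using J m by (intro finite_measure_subadditive_finite) auto
  also have "\<dots> \<le> (\<Sum>e\<in>J. exp (- (1 - \<rho>) * B))"
  proof (rule sum_mono)
    fix e assume e: "e \<in> J"
    have "prob {s\<in>space \<Omega>. B < env s e} = exp (- B * two_rate \<rho> \<rho> e)"
      by (rule exponential_distributedD_gt[OF env_distributed B env_rate_pos])
    also have "\<dots> \<le> exp (- (1 - \<rho>) * B)"
      using mult_left_mono[OF J(2)[OF e] B] by (simp add: algebra_simps)
    finally show "prob {s\<in>space \<Omega>. B < env s e} \<le> exp (- (1 - \<rho>) * B)" .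
  qed
  finally show "prob (\<Union>e\<in>J. {s\<in>space \<Omega>. B < env s e}) \<le> card J * exp (- (1 - \<rho>) * B)" by simp
qed

end

end

section \<open>The tail of the exit point at fixed scales\<close>

context stationary_lpp
begin

text \<open>One term per bad event: a weight next to the line above \<open>B\<close>, a small
  vertical sum, a low value of the first field, a high value of the second.\<close>

definition exit_tail_bound :: "real \<Rightarrow> int \<Rightarrow> int \<Rightarrow> int \<Rightarrow> real \<Rightarrow> real \<Rightarrow> real \<Rightarrow> real \<Rightarrow> real \<Rightarrow> real \<Rightarrow> real" where
  "exit_tail_bound lam y0 n K \<delta> N C B v1 v2 =
     of_int (line_abscissa lam y0 - line_abscissa lam n + (n - y0)) * exp (- (1 - \<rho>) * B)
     + exp (- of_int K / 8)
     + exp (- \<delta> * (v1 - C * (2 / \<rho> + 2 / (1 - \<rho>))))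
     + exp (- \<delta> * (v2 - 36 * \<delta>\<^sup>2 * N / (\<rho> * (1 - \<rho>)) - C * (2 / \<rho> + 2 / (1 - \<rho>))))"

context
  fixes lam \<delta> N C B v1 v2 :: real and m n y0 K :: int
  assumes \<rho>: "0 < \<rho>" "\<rho> < 1" and lam: "0 < lam" "lam < 1" and mn: "0 \<le> m" "0 \<le> n"
    and y0: "y0 \<le> 0" "m < line_abscissa lam y0"
    and \<delta>: "0 < \<delta>" "6 * \<delta> \<le> \<rho>" "6 * \<delta> \<le> 1 - \<rho>" and N: "0 \<le> N"
    and C: "\<bar>of_int m - (1 - \<rho>)\<^sup>2 * N\<bar> \<le> C" "\<bar>of_int n - \<rho>\<^sup>2 * N\<bar> \<le> C"
    and B: "0 \<le> B" and K: "0 \<le> K"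
    and budget: "v1 + v2 + (2 * ((1 - lam) / lam + 1) + 1 / ((1 - lam) / lam)) * B \<le> \<delta> * of_int K / 2"
begin

text \<open>Both directions have the shape (a, a + \<delta>) against (b + \<delta>, b). Off the bad
  events the gap is at least \<delta> K / 2 minus the discretization error, and by
  \<open>budget\<close> the deviations \<open>v1\<close> and \<open>v2\<close> from \<open>N\<close>
  cannot make up for it. The conclusion provides a measurable set that covers \<open>P\<close>
  almost surely, so \<open>P\<close> may be any predicate.\<close>

lemma exit_side_event:
  assumes a: "\<bar>a - \<rho>\<bar> \<le> 3 * \<delta>" "\<bar>a + \<delta> - \<rho>\<bar> \<le> 3 * \<delta>"
    and b: "\<bar>b + \<delta> - \<rho>\<bar> \<le> 3 * \<delta>" "\<bar>b - \<rho>\<bar> \<le> 3 * \<delta>"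
    and I: "finite I" "card I = nat K"
    and gap: "\<And>s. (\<And>e. 0 \<le> env s e) \<Longrightarrow>
      (\<And>i. line_abscissa lam n < i \<Longrightarrow> i \<le> line_abscissa lam y0 \<Longrightarrow> env s (hor i) \<le> B) \<Longrightarrow>
      (\<And>i. y0 < i \<Longrightarrow> i \<le> n \<Longrightarrow> env s (bulk (line_abscissa lam i, i)) \<le> B) \<Longrightarrow> P s \<Longrightarrow>
      rescaled_field lam y0 m n \<rho> a (a + \<delta>) (env s)
       \<le> rescaled_field lam y0 m n \<rho> (b + \<delta>) b (env s)
         + (2 * ((1 - lam) / lam + 1) + 1 / ((1 - lam) / lam)) * B - \<rho> * \<delta> * (\<Sum>i\<in>I. env s (ver i))"
  shows "\<exists>S\<in>events. (AE s in \<Omega>. P s \<longrightarrow> s \<in> S) \<and> prob S \<le> exit_tail_bound lam y0 n K \<delta> N C B v1 v2"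
proof -
  let ?h = "line_abscissa lam"
  let ?G = "\<lambda>r1 r2 s. rescaled_field lam y0 m n \<rho> r1 r2 (env s)"
  let ?E = "2 * ((1 - lam) / lam + 1) + 1 / ((1 - lam) / lam)"
  let ?c = "C * (2 / \<rho> + 2 / (1 - \<rho>))"
  note anti = line_abscissa_antimono[OF lam]
  have y0': "y0 < 0" using y0 mn by (cases "y0 = 0") auto
  define J where "J = hor ` {?h n<..?h y0} \<union> (\<lambda>i. bulk (?h i, i)) ` {y0<..n}"
  define S1 where "S1 = (\<Union>e\<in>J. {s\<in>space \<Omega>. B < env s e})"
  define S2 where "S2 = {s\<in>space \<Omega>. (\<Sum>i\<in>I. q i s) \<le> card I / (2 * \<rho>)}"
  \<comment> \<open>The factor a - (a + \<delta>) is negative, so this says that the first field is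
    at most N - v1; the next event says that the second field is at least N + v2.\<close>
  define S3 where "S3 = {s\<in>space \<Omega>. (a - (a + \<delta>)) * (N - v1) \<le> (a - (a + \<delta>)) * ?G a (a + \<delta>) s}"
  define S4 where "S4 = {s\<in>space \<Omega>. (b + \<delta> - b) * (N + v2) \<le> (b + \<delta> - b) * ?G (b + \<delta>) b s}"
  have range: "0 < a" "a < 1" "0 < a + \<delta>" "a + \<delta> < 1" "0 < b + \<delta>" "b + \<delta> < 1" "0 < b" "b < 1"
    using a b \<delta> \<rho> by (auto simp: abs_le_iff)
  have J: "finite J" "\<And>e. e \<in> J \<Longrightarrow> 1 - \<rho> \<le> two_rate \<rho> \<rho> e"
    using \<rho> by (auto simp: J_def two_rate_def)
  have "card J \<le> card {?h n<..?h y0} + card {y0<..n}"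
    unfolding J_def by (rule order_trans[OF card_Un_le]) (intro add_mono card_image_le, auto)
  moreover have "?h n \<le> ?h y0" using antimonoD[OF anti, of y0 n] y0 mn by simp
  ultimately have cardJ: "real (card J) \<le> of_int (?h y0 - ?h n + (n - y0))"
    using y0' mn by simp
  have q: "(\<lambda>s. q i s) \<in> borel_measurable \<Omega>" for i
    using env_measurable[OF \<rho>, of "ver i"] by simp
  note G [measurable] = rescaled_field_measurable[OF \<rho>]
  have S1: "S1 \<in> events" and "prob S1 \<le> card J * exp (- (1 - \<rho>) * B)"
    unfolding S1_def using prob_env_large[OF \<rho> J B] by auto
  note this(2)
  also have "\<dots> \<le> of_int (?h y0 - ?h n + (n - y0)) * exp (- (1 - \<rho>) * B)"
    using cardJ by (intro mult_right_mono) auto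
  finally have P1: "prob S1 \<le> of_int (?h y0 - ?h n + (n - y0)) * exp (- (1 - \<rho>) * B)" .
  have S2: "S2 \<in> events" unfolding S2_def using q by measurable
  have P2: "prob S2 \<le> exp (- of_int K / 8)"
    using prob_sum_vertical[OF \<rho> I(1)] K unfolding S2_def I(2) by simp
  have S3: "S3 \<in> events" and S4: "S4 \<in> events" unfolding S3_def S4_def by measurable
  have P3: "prob S3 \<le> exp (- \<delta> * (v1 - ?c))"
  proof -
    obtain \<xi> where \<xi>: "a \<le> \<xi>" "\<xi> \<le> a + \<delta>"
      "prob S3 \<le> exp ((a - (a + \<delta>)) * (of_int m / (1 - \<xi>) + of_int n / \<xi> - (N - v1)))"
      using prob_rescaled_field_tail[OF \<rho> range(1-4) mn y0' lam, of "N - v1"] \<delta>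
      unfolding S3_def by auto
    have "\<bar>\<xi> - \<rho>\<bar> \<le> 3 * \<delta>" using \<xi> a by (auto simp: abs_le_iff)
    from mean_bounds(1)[OF \<rho> \<delta> this N C]
    have "\<delta> * (v1 - ?c) \<le> \<delta> * (of_int m / (1 - \<xi>) + of_int n / \<xi> - (N - v1))"
      using \<delta> by (intro mult_left_mono) auto
    then have "(a - (a + \<delta>)) * (of_int m / (1 - \<xi>) + of_int n / \<xi> - (N - v1)) \<le> - \<delta> * (v1 - ?c)"
      by simp
    with \<xi>(3) show ?thesis by (meson exp_le_cancel_iff order_trans)
  qed
  have P4: "prob S4 \<le> exp (- \<delta> * (v2 - 36 * \<delta>\<^sup>2 * N / (\<rho> * (1 - \<rho>)) - ?c))"
  proof -
    obtain \<xi> where \<xi>: "b \<le> \<xi>" "\<xi> \<le> b + \<delta>"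
      "prob S4 \<le> exp ((b + \<delta> - b) * (of_int m / (1 - \<xi>) + of_int n / \<xi> - (N + v2)))"
      using prob_rescaled_field_tail[OF \<rho> range(5-8) mn y0' lam, of "N + v2"] \<delta>
      unfolding S4_def by auto
    have "\<bar>\<xi> - \<rho>\<bar> \<le> 3 * \<delta>" using \<xi> b by (auto simp: abs_le_iff)
    from mean_bounds(2)[OF \<rho> \<delta> this N C]
    have "\<delta> * (of_int m / (1 - \<xi>) + of_int n / \<xi> - (N + v2))
        \<le> \<delta> * (- (v2 - 36 * \<delta>\<^sup>2 * N / (\<rho> * (1 - \<rho>)) - ?c))"
      using \<delta> by (intro mult_left_mono) auto
    then have "(b + \<delta> - b) * (of_int m / (1 - \<xi>) + of_int n / \<xi> - (N + v2))
        \<le> - \<delta> * (v2 - 36 * \<delta>\<^sup>2 * N / (\<rho> * (1 - \<rho>)) - ?c)"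
      by (simp only: add_diff_cancel_left' mult_minus_left mult_minus_right)
    with \<xi>(3) show ?thesis by (meson exp_le_cancel_iff order_trans)
  qed
  have "AE s in \<Omega>. P s \<longrightarrow> s \<in> S1 \<union> S2 \<union> S3 \<union> S4"
    using env_nonneg[OF \<rho>] AE_space
  proof eventually_elim
    case (elim s)
    show ?case
    proof (intro impI, rule ccontr)
      assume P: "P s" and "s \<notin> S1 \<union> S2 \<union> S3 \<union> S4"
      then have n1: "s \<notin> S1" and n2: "s \<notin> S2" and n3: "s \<notin> S3" and n4: "s \<notin> S4" by auto
      have le: "env s e \<le> B" if "e \<in> J" for e
        using n1 elim that by (force simp: S1_def not_less)
      have bd: "env s (hor i) \<le> B" if "?h n < i" "i \<le> ?h y0" for i
        by (rule le) (use that in \<open>auto simp: J_def\<close>)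
      have bd': "env s (bulk (?h i, i)) \<le> B" if "y0 < i" "i \<le> n" for i
        by (rule le) (use that in \<open>auto simp: J_def\<close>)
      have g: "?G a (a + \<delta>) s \<le> ?G (b + \<delta>) b s + ?E * B - \<rho> * \<delta> * (\<Sum>i\<in>I. env s (ver i))"
        using elim by (intro gap bd bd' P) auto
      have "of_int K / (2 * \<rho>) < (\<Sum>i\<in>I. env s (ver i))"
        using n2 elim I K by (simp add: S2_def not_le)
      then have "\<rho> * \<delta> * (of_int K / (2 * \<rho>)) \<le> \<rho> * \<delta> * (\<Sum>i\<in>I. env s (ver i))"
        using \<rho> \<delta> by (intro mult_left_mono) auto
      moreover have "\<rho> * \<delta> * (of_int K / (2 * \<rho>)) = \<delta> * of_int K / 2" using \<rho> by simp
      moreover have "N - v1 < ?G a (a + \<delta>) s"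
        using n3 elim \<delta> by (simp add: S3_def not_le)
      moreover have "?G (b + \<delta>) b s < N + v2"
        using n4 elim \<delta> by (simp add: S4_def not_le)
      ultimately show False using g budget by linarith
    qed
  qed
  moreover have "prob (S1 \<union> S2 \<union> S3 \<union> S4) \<le> prob S1 + prob S2 + prob S3 + prob S4"
    using measure_Un_le[OF sets.Un[OF sets.Un[OF S1 S2] S3] S4] measure_Un_le[OF sets.Un[OF S1 S2] S3]
      measure_Un_le[OF S1 S2] by simp
  ultimately show ?thesis
    using S1 S2 S3 S4 P1 P2 P3 P4
    by (intro bexI[of _ "S1 \<union> S2 \<union> S3 \<union> S4"]) (auto simp: exit_tail_bound_def)
qed

lemma exit_right_event:
  "\<exists>S\<in>events. (AE s in \<Omega>. K \<le> exit_point lam (\<lambda>z. \<omega> z s) (\<lambda>i. p i s) (\<lambda>i. q i s) (m, n) \<longrightarrow> s \<in> S)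
     \<and> prob S \<le> exit_tail_bound lam y0 n K \<delta> N C B v1 v2"
proof (rule exit_side_event[where a = "\<rho> - \<delta>" and b = "\<rho> - 3 * \<delta>" and I = "{0<..K}"])
  fix s
  assume *: "\<And>e. 0 \<le> env s e"
    "\<And>i. line_abscissa lam n < i \<Longrightarrow> i \<le> line_abscissa lam y0 \<Longrightarrow> env s (hor i) \<le> B"
    "\<And>i. y0 < i \<Longrightarrow> i \<le> n \<Longrightarrow> env s (bulk (line_abscissa lam i, i)) \<le> B"
    and P: "K \<le> exit_point lam (\<lambda>z. \<omega> z s) (\<lambda>i. p i s) (\<lambda>i. q i s) (m, n)"
  show "rescaled_field lam y0 m n \<rho> (\<rho> - \<delta>) (\<rho> - \<delta> + \<delta>) (env s)
       \<le> rescaled_field lam y0 m n \<rho> (\<rho> - 3 * \<delta> + \<delta>) (\<rho> - 3 * \<delta>) (env s)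
         + (2 * ((1 - lam) / lam + 1) + 1 / ((1 - lam) / lam)) * B - \<rho> * \<delta> * (\<Sum>i\<in>{0<..K}. env s (ver i))"
    using exit_point_right_gap[OF lam mn y0, where f = "env s", OF *(1) B *(2,3) \<rho> \<delta> K] P by simp
qed (use \<delta> in auto)

lemma exit_left_event:
  "\<exists>S\<in>events. (AE s in \<Omega>. exit_point lam (\<lambda>z. \<omega> z s) (\<lambda>i. p i s) (\<lambda>i. q i s) (m, n) \<le> - K \<longrightarrow> s \<in> S)
     \<and> prob S \<le> exit_tail_bound lam y0 n K \<delta> N C B v1 v2"
proof (rule exit_side_event[where a = "\<rho>" and b = "\<rho> + 2 * \<delta>" and I = "{-K<..0}"])
  fix s
  assume *: "\<And>e. 0 \<le> env s e"
    "\<And>i. line_abscissa lam n < i \<Longrightarrow> i \<le> line_abscissa lam y0 \<Longrightarrow> env s (hor i) \<le> B"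
    "\<And>i. y0 < i \<Longrightarrow> i \<le> n \<Longrightarrow> env s (bulk (line_abscissa lam i, i)) \<le> B"
    and P: "exit_point lam (\<lambda>z. \<omega> z s) (\<lambda>i. p i s) (\<lambda>i. q i s) (m, n) \<le> - K"
  have eq: "\<rho> + 2 * \<delta> + \<delta> = \<rho> + 3 * \<delta>" by simp
  show "rescaled_field lam y0 m n \<rho> \<rho> (\<rho> + \<delta>) (env s)
       \<le> rescaled_field lam y0 m n \<rho> (\<rho> + 2 * \<delta> + \<delta>) (\<rho> + 2 * \<delta>) (env s)
         + (2 * ((1 - lam) / lam + 1) + 1 / ((1 - lam) / lam)) * B - \<rho> * \<delta> * (\<Sum>i\<in>{-K<..0}. env s (ver i))"
    unfolding eq using exit_point_left_gap[OF lam mn y0, where f = "env s", OF *(1) B *(2,3) \<rho> \<delta> K] P by simp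
qed (use \<delta> in auto)

end

end

text \<open>Half of the exponent absorbs x^3, which will be N: the inequality M^2 + x \<le> 2 M^2 x
  splits the exponent, and e^u \<ge> u at u = c x / 6 gives 216 = 6^3.\<close>

lemma cube_exp_bound:
  fixes x M c :: real
  assumes "1 \<le> x" "1 \<le> M" "0 < c"
  shows "x ^ 3 * exp (- (c * (M\<^sup>2 * x))) \<le> 216 / c ^ 3 * exp (- (c / 2 * M\<^sup>2))"
proof -
  have "c * x / 6 \<le> exp (c * x / 6)" using exp_ge_add_one_self[of "c * x / 6"] by linarith
  then have "(c * x / 6) ^ 3 \<le> exp (c * x / 6) ^ 3" using assms by (intro power_mono) auto
  also have "\<dots> = exp (c * x / 2)" by (simp flip: exp_of_nat_mult)
  finally have x3: "x ^ 3 \<le> 216 / c ^ 3 * exp (c * x / 2)"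
    using assms by (simp add: power_mult_distrib power_divide field_simps)
  have M2: "1 \<le> M\<^sup>2" using assms by simp
  have "M\<^sup>2 + x \<le> 2 * (M\<^sup>2 * x)"
  proof -
    have "M\<^sup>2 * 1 \<le> M\<^sup>2 * x" using assms by (intro mult_left_mono) auto
    moreover have "1 * x \<le> M\<^sup>2 * x" using assms M2 by (intro mult_right_mono) auto
    ultimately show ?thesis by simp
  qed
  then have "c * (M\<^sup>2 + x) \<le> c * (2 * (M\<^sup>2 * x))" using assms by (intro mult_left_mono) auto
  then have "- (c * (M\<^sup>2 * x)) \<le> - (c * x / 2) - c / 2 * M\<^sup>2" by (simp add: algebra_simps)
  then have "exp (- (c * (M\<^sup>2 * x))) \<le> exp (- (c * x / 2) - c / 2 * M\<^sup>2)" by simp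
  also have "\<dots> = exp (- (c * x / 2)) * exp (- (c / 2 * M\<^sup>2))"
    by (simp flip: exp_add)
  finally have "x ^ 3 * exp (- (c * (M\<^sup>2 * x)))
     \<le> (216 / c ^ 3 * exp (c * x / 2)) * (exp (- (c * x / 2)) * exp (- (c / 2 * M\<^sup>2)))"
    using x3 assms by (intro mult_mono) auto
  also have "\<dots> = 216 / c ^ 3 * exp (- (c / 2 * M\<^sup>2)) * (exp (c * x / 2) * exp (- (c * x / 2)))"
    by (simp only: mult_ac)
  also have "exp (c * x / 2) * exp (- (c * x / 2)) = 1" by (simp flip: exp_add)
  finally show ?thesis by simp
qed

theorem lemma3p6:
  fixes lam \<rho> :: real
  assumes "0 < lam" and "lam < 1" and "0 < \<rho>" and "\<rho> < 1"
  shows "\<exists>C1>0. \<exists>C2>0. \<forall>c>0. \<exists>(M0::real) (N0::nat).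
    \<forall>(\<Omega>::'a measure) \<omega> p q. stationary_lpp \<Omega> \<rho> \<omega> p q \<longrightarrow>
      (\<forall>M\<ge>M0. \<forall>N\<ge>N0.
        \<P>(s in \<Omega>. real_of_int \<bar>exit_point lam (\<lambda>z. \<omega> z s) (\<lambda>i. p i s) (\<lambda>i. q i s)
                       (end_point \<rho> N (c * real N powr (1/3)))\<bar>
                     \<ge> M * real N powr (2/3))
        \<le> C1 * exp (- C2 * M\<^sup>2))"
proof -
  note lam = assms(1,2) and \<rho> = assms(3,4)
  define \<theta> where "\<theta> = (1 - lam) / lam"
  define E where "E = 2 * (\<theta> + 1) + 1 / \<theta>"
  \<comment> \<open>\<open>C0\<close> times N will bound the exit point in modulus, and
    \<open>C3\<close> times N the number of weights truncated at \<open>B\<close>.\<close>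
  define C0 where "C0 = 1 + 2 / \<theta>"
  define C3 where "C3 = 6 + 2 * \<theta> + 3 / \<theta>"
  define Bc where "Bc = 2 / \<rho> + 2 / (1 - \<rho>)"
  \<comment> \<open>For \<delta> = \<epsilon> M / x the first bound keeps 6 \<delta> at most \<rho>
    and 1 - \<rho> as long as M \<le> C0 x; the second keeps the quadratic term at most \<epsilon> U
    / 4, where U = M^2 x. Then \<eta> is chosen to make E B equal to \<epsilon> U / 16.\<close>
  define \<epsilon> where "\<epsilon> = min (min \<rho> (1 - \<rho>) / (6 * C0)) (\<rho> * (1 - \<rho>) / 144)"
  define \<eta> where "\<eta> = \<epsilon> / (16 * E)"
  define c0 where "c0 = (1 - \<rho>) * \<eta>"
  \<comment> \<open>Rates of the union bound, the vertical sum and the two field deviations.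
    \<open>C1\<close> collects these four terms for both signs of the exit point.\<close>
  define C2 where "C2 = min (c0 / 2) (min (1 / (8 * C0)) (\<epsilon>\<^sup>2 / 32))"
  define C1 where "C1 = 2 * (C3 * (216 / c0 ^ 3) + 3)"
  have \<theta>: "0 < \<theta>" using lam by (simp add: \<theta>_def)
  have pos: "0 < E" "1 \<le> C0" "0 < C3" "0 < Bc"
    using \<theta> \<rho> by (auto simp: E_def C0_def C3_def Bc_def intro!: add_pos_pos)
  have \<epsilon>: "0 < \<epsilon>" using \<rho> pos by (auto simp: \<epsilon>_def)
  have \<epsilon>1: "6 * (\<epsilon> * C0) \<le> \<rho>" "6 * (\<epsilon> * C0) \<le> 1 - \<rho>"
  proof -
    have "\<epsilon> \<le> min \<rho> (1 - \<rho>) / (6 * C0)" by (simp add: \<epsilon>_def)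
    then have "6 * (\<epsilon> * C0) \<le> min \<rho> (1 - \<rho>)" using pos by (simp add: pos_le_divide_eq mult_ac)
    then show "6 * (\<epsilon> * C0) \<le> \<rho>" "6 * (\<epsilon> * C0) \<le> 1 - \<rho>" by auto
  qed
  have \<epsilon>2: "144 * \<epsilon> \<le> \<rho> * (1 - \<rho>)" by (simp add: \<epsilon>_def)
  have \<eta>: "0 < \<eta>" and E\<eta>: "E * \<eta> = \<epsilon> / 16" using \<epsilon> pos by (auto simp: \<eta>_def)
  have c0: "0 < c0" using \<eta> \<rho> by (simp add: c0_def)
  have C2: "0 < C2" using c0 pos \<epsilon> by (simp add: C2_def)
  have C1: "0 < C1" using c0 pos by (simp add: C1_def add_nonneg_pos)
  \<comment> \<open>The bound on \<open>M\<close> makes the effect of the shift and of the integer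
    parts a small part of \<epsilon> U. The bound on \<open>N\<close> gives c x \<le> \<rho>^2 N, so
    that the end point has nonnegative coordinates, and it does not involve
    \<open>M\<close>.\<close>
  have main: "\<P>(s in \<Omega>. real_of_int \<bar>exit_point lam (\<lambda>z. \<omega> z s) (\<lambda>i. p i s) (\<lambda>i. q i s)
                       (end_point \<rho> N (c * real N powr (1/3)))\<bar>
                     \<ge> M * real N powr (2/3)) \<le> C1 * exp (- C2 * M\<^sup>2)"
    if c: "0 < c" and slpp: "stationary_lpp \<Omega> \<rho> \<omega> p q" and M: "1 + 32 * ((c + 1) * Bc) / \<epsilon> \<le> M"
      and N: "nat \<lceil>(1 + c / \<rho>\<^sup>2) ^ 3\<rceil> \<le> N"
    for c M N and \<Omega> :: "'a measure" and \<omega> p q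
  proof -
    interpret stationary_lpp \<Omega> \<rho> \<omega> p q by (rule slpp)
    define x where "x = real N powr (1/3)"
    have Nx: "real N = x ^ 3"
      unfolding x_def by (cases "N = 0") (simp_all add: powr_powr flip: powr_realpow)
    have x2: "real N powr (2/3) = x\<^sup>2"
      unfolding x_def by (cases "N = 0") (simp_all add: powr_powr flip: powr_realpow)
    have x0: "0 \<le> x" by (simp add: x_def)
    have "(1 + c / \<rho>\<^sup>2) ^ 3 \<le> x ^ 3" using N unfolding Nx[symmetric] by linarith
    then have "(1 + c / \<rho>\<^sup>2) ^ Suc 2 \<le> x ^ Suc 2" by simp
    then have xc: "1 + c / \<rho>\<^sup>2 \<le> x" using x0 by (rule power_le_imp_le_base)
    then have x1: "1 \<le> x" and cx: "c \<le> \<rho>\<^sup>2 * x"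
    proof -
      have "0 \<le> c / \<rho>\<^sup>2" using c by simp
      with xc show "1 \<le> x" by linarith
      from xc have "c / \<rho>\<^sup>2 \<le> x" by linarith
      then show "c \<le> \<rho>\<^sup>2 * x" using \<rho> by (simp add: field_simps)
    qed
    have M1: "1 \<le> M" and M2: "32 * ((c + 1) * Bc) / \<epsilon> \<le> M\<^sup>2"
    proof -
      have "0 \<le> 32 * ((c + 1) * Bc) / \<epsilon>" using c pos \<epsilon> by simp
      with M show "1 \<le> M" by linarith
      then have "M \<le> M\<^sup>2" by (simp add: power2_eq_square)
      with M show "32 * ((c + 1) * Bc) / \<epsilon> \<le> M\<^sup>2" by linarith
    qed
    have N1: "1 \<le> real N" unfolding Nx using x1 by simp
    define m n where "m = \<lfloor>(1 - \<rho>)\<^sup>2 * real N + c * x\<rfloor>" and "n = \<lfloor>\<rho>\<^sup>2 * real N - c * x\<rfloor>"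
    have cxN: "c * x \<le> \<rho>\<^sup>2 * real N"
    proof -
      have "c * x \<le> \<rho>\<^sup>2 * x * x" using cx x0 by (intro mult_right_mono)
      also have "\<dots> \<le> \<rho>\<^sup>2 * x * x * x"
        using mult_left_mono[OF x1, of "\<rho>\<^sup>2 * x * x"] x0 by simp
      finally show ?thesis by (simp add: Nx power3_eq_cube mult_ac)
    qed
    have cx0: "0 \<le> c * x" using c x0 by simp
    have mn: "0 \<le> m" "0 \<le> n" using cxN cx0 by (auto simp: m_def n_def)
    have sq: "\<rho>\<^sup>2 \<le> 1" "(1 - \<rho>)\<^sup>2 + \<rho>\<^sup>2 \<le> 1"
    proof -
      show "\<rho>\<^sup>2 \<le> 1" using \<rho> by (simp add: power_le_one)
      have "0 \<le> \<rho> * (1 - \<rho>)" using \<rho> by simp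
      then show "(1 - \<rho>)\<^sup>2 + \<rho>\<^sup>2 \<le> 1" by (simp add: power2_eq_square algebra_simps)
    qed
    have nN: "of_int n \<le> real N"
    proof -
      have "of_int n \<le> \<rho>\<^sup>2 * real N - c * x" by (simp add: n_def)
      also have "\<dots> \<le> 1 * real N" using cx0 mult_right_mono[OF sq(1), of "real N"] by simp
      finally show ?thesis by simp
    qed
    have mN: "of_int m \<le> real N"
    proof -
      have "of_int m \<le> (1 - \<rho>)\<^sup>2 * real N + c * x" by (simp add: m_def)
      also have "\<dots> \<le> ((1 - \<rho>)\<^sup>2 + \<rho>\<^sup>2) * real N" using cxN by (simp add: algebra_simps)
      also have "\<dots> \<le> 1 * real N" using sq by (intro mult_right_mono) auto
      finally show ?thesis by simp
    qed
    let ?Z = "\<lambda>s. exit_point lam (\<lambda>z. \<omega> z s) (\<lambda>i. p i s) (\<lambda>i. q i s) (m, n)"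
    let ?A = "{s\<in>space \<Omega>. M * x\<^sup>2 \<le> real_of_int \<bar>?Z s\<bar>}"
    \<comment> \<open>Upwards the exit index is limited by \<open>n\<close>; far enough downwards
      the line is to the right of \<open>m\<close>.\<close>
    have Z: "real_of_int \<bar>?Z s\<bar> \<le> C0 * real N" for s
    proof -
      note pr = exit_point_props(2,3)[OF lam mn, of "\<lambda>z. \<omega> z s" "\<lambda>i. p i s" "\<lambda>i. q i s"]
      have "- \<theta> * of_int (?Z s) < of_int m + 1"
        using line_abscissa_bounds(2)[OF lam, of "?Z s"] pr(1) by (simp add: \<theta>_def)
      then have "\<theta> * - of_int (?Z s) \<le> 2 * real N" using mN N1 by simp
      then have "- of_int (?Z s) \<le> 2 * real N / \<theta>" using \<theta> by (simp add: field_simps)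
      moreover have "of_int (?Z s) \<le> real N" using pr(2) nN by simp
      moreover have "0 \<le> 2 * real N / \<theta>" using \<theta> by simp
      ultimately show ?thesis using N1 by (simp add: C0_def algebra_simps abs_le_iff)
    qed
    have A: "prob ?A \<le> C1 * exp (- C2 * M\<^sup>2)"
    proof (cases "M \<le> C0 * x")
      \<comment> \<open>For M > C0 x the threshold M x^2 exceeds the a priori bound C0 x^3, so the
        event is empty.\<close>
      case False
      have "s \<notin> ?A" for s
      proof
        assume "s \<in> ?A"
        then have "M * x\<^sup>2 \<le> C0 * x * x\<^sup>2" using Z[of s] by (simp add: Nx power3_eq_cube power2_eq_square mult_ac)
        moreover have "C0 * x * x\<^sup>2 < M * x\<^sup>2" using False x1 by (intro mult_strict_right_mono) auto
        ultimately show False by simp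
      qed
      then have "?A = {}" by blast
      then show ?thesis using C1 by (simp only: measure_empty) simp
    next
      case MC: True
      \<comment> \<open>With K of size M x^2 and \<delta> of size K / N, the terms \<delta> K and N
        \<delta>^2 are both of order U = M^2 x.\<close>
      define U where "U = M\<^sup>2 * x"
      define \<delta> where "\<delta> = \<epsilon> * M / x"
      define K where "K = \<lceil>M * x\<^sup>2\<rceil>"
      define B where "B = \<eta> * U"
      \<comment> \<open>The budget \<epsilon> U / 2 is split into 1/16 for the first field, 3/8 for
        the second and 1/16 for discretization, in units of \<epsilon> U. After deducting 1/32 for
        the position of the end point, and 1/4 for the quadratic term of the second field, each
        field retains at least 1/32.\<close>
      define v1 where "v1 = \<epsilon> / 16 * U"
      define v2 where "v2 = 3 / 8 * \<epsilon> * U"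
      define C where "C = (c + 1) * x"
      \<comment> \<open>Low enough for the line to be strictly to the right of \<open>m\<close>
        there; the summand 2 absorbs the floor in the abscissa.\<close>
      define y0 where "y0 = - \<lceil>(of_int m + 2) / \<theta>\<rceil>"
      have U: "0 < U" using M1 x1 by (simp add: U_def)
      have \<delta>0: "0 < \<delta>" using \<epsilon> M1 x1 by (simp add: \<delta>_def)
      have \<delta>C: "\<delta> \<le> \<epsilon> * C0"
      proof -
        have "M / x \<le> C0" using MC x1 by (simp add: field_simps)
        then have "\<epsilon> * (M / x) \<le> \<epsilon> * C0" using \<epsilon> by (intro mult_left_mono) auto
        then show ?thesis by (simp add: \<delta>_def)
      qed
      then have \<delta>: "6 * \<delta> \<le> \<rho>" "6 * \<delta> \<le> 1 - \<rho>" using \<epsilon>1 by auto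
      have Kx: "M * x\<^sup>2 \<le> of_int K" by (simp add: K_def)
      have Mx2: "0 \<le> M * x\<^sup>2" using M1 by simp
      have K0: "0 \<le> K" using Kx Mx2 by linarith
      have y0: "y0 \<le> 0"
      proof -
        have "0 \<le> (of_int m + 2) / \<theta>" using mn \<theta> by simp
        then show ?thesis unfolding y0_def by linarith
      qed
      have y0l: "(of_int m + 2) / \<theta> \<le> - of_int y0" "- of_int y0 \<le> (of_int m + 2) / \<theta> + 1"
        unfolding y0_def by linarith+
      then have y0t: "of_int m + 2 \<le> \<theta> * - of_int y0" "\<theta> * - of_int y0 \<le> of_int m + 2 + \<theta>"
        using \<theta> by (simp_all add: field_simps)
      have hb: "real_of_int (line_abscissa lam k) \<le> - \<theta> * of_int k"
        "- \<theta> * of_int k < real_of_int (line_abscissa lam k) + 1" for k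
        unfolding \<theta>_def by (rule line_abscissa_bounds[OF lam])+
      have my0: "m < line_abscissa lam y0" using hb(2)[of y0] y0t(1) by simp
      have Cm: "\<bar>of_int m - (1 - \<rho>)\<^sup>2 * real N\<bar> \<le> C"
        using cx0 x1 unfolding m_def C_def by (simp add: algebra_simps abs_le_iff) linarith
      have Cn: "\<bar>of_int n - \<rho>\<^sup>2 * real N\<bar> \<le> C"
        using cx0 x1 unfolding n_def C_def by (simp add: algebra_simps abs_le_iff) linarith
      have B0: "0 \<le> B" using \<eta> U by (simp add: B_def)
      have \<delta>K: "\<epsilon> * U \<le> \<delta> * of_int K"
      proof -
        have "\<epsilon> * U = \<delta> * (M * x\<^sup>2)" using x1 by (simp add: U_def \<delta>_def power2_eq_square)
        also have "\<dots> \<le> \<delta> * of_int K" using Kx \<delta>0 by (intro mult_left_mono) auto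
        finally show ?thesis .
      qed
      have budget: "v1 + v2 + E * B \<le> \<delta> * of_int K / 2"
      proof -
        have "E * B = \<epsilon> / 16 * U" unfolding B_def using E\<eta> by (simp add: mult.assoc[symmetric])
        then have "v1 + v2 + E * B = \<epsilon> * U / 2" by (simp add: v1_def v2_def mult.commute)
        then show ?thesis using \<delta>K by linarith
      qed
      have N0: "0 \<le> real N" by simp
      let ?T = "exit_tail_bound lam y0 n K \<delta> (real N) C B v1 v2"
      have right: "\<exists>S\<in>events. (AE s in \<Omega>. K \<le> ?Z s \<longrightarrow> s \<in> S) \<and> prob S \<le> ?T"
        by (rule exit_right_event[OF \<rho> lam mn y0 my0 \<delta>0 \<delta> N0 Cm Cn B0 K0 budget[unfolded E_def \<theta>_def]])
      have left: "\<exists>S\<in>events. (AE s in \<Omega>. ?Z s \<le> - K \<longrightarrow> s \<in> S) \<and> prob S \<le> ?T"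
        by (rule exit_left_event[OF \<rho> lam mn y0 my0 \<delta>0 \<delta> N0 Cm Cn B0 K0 budget[unfolded E_def \<theta>_def]])
      have expC2: "exp (- z) \<le> exp (- C2 * M\<^sup>2)" if "C2 * M\<^sup>2 \<le> z" for z using that by simp
      have MM: "M\<^sup>2 \<le> M ^ 3" using M1 by (simp add: power_increasing)
      have C2le: "C2 * M\<^sup>2 \<le> c0 / 2 * M\<^sup>2" "C2 * M\<^sup>2 \<le> 1 / (8 * C0) * M\<^sup>2" "C2 * M\<^sup>2 \<le> \<epsilon>\<^sup>2 / 32 * M\<^sup>2"
        by (rule mult_right_mono; simp add: C2_def)+
      have t1: "of_int (line_abscissa lam y0 - line_abscissa lam n + (n - y0)) * exp (- (1 - \<rho>) * B)
          \<le> C3 * (216 / c0 ^ 3) * exp (- C2 * M\<^sup>2)"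
      proof -
        have t: "\<theta> * of_int n \<le> \<theta> * real N" using \<theta> nN by (intro mult_left_mono) auto
        have t': "(of_int m + 2) / \<theta> \<le> 3 * real N / \<theta>" using \<theta> mN N1 by (intro divide_right_mono) auto
        have t'': "\<theta> \<le> \<theta> * real N" using \<theta> N1 by simp
        have "real_of_int (line_abscissa lam y0 - line_abscissa lam n + (n - y0))
          \<le> (of_int m + 2 + \<theta>) + (\<theta> * of_int n + 1) + (of_int n + ((of_int m + 2) / \<theta> + 1))"
          using hb(1)[of y0] hb(2)[of n] y0t y0l by simp
        also have "\<dots> \<le> C3 * real N"
          using t t' t'' mN nN N1 by (simp add: C3_def algebra_simps)
        finally have "of_int (line_abscissa lam y0 - line_abscissa lam n + (n - y0)) * exp (- (1 - \<rho>) * B)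
            \<le> C3 * real N * exp (- (1 - \<rho>) * B)" by (intro mult_right_mono) auto
        also have "\<dots> = C3 * (x ^ 3 * exp (- (c0 * (M\<^sup>2 * x))))"
          unfolding Nx c0_def B_def U_def by (simp only: mult_minus_left mult.assoc)
        also have "\<dots> \<le> C3 * (216 / c0 ^ 3 * exp (- (c0 / 2 * M\<^sup>2)))"
          using cube_exp_bound[OF x1 M1 c0] pos by (intro mult_left_mono) auto
        also have "\<dots> \<le> C3 * (216 / c0 ^ 3 * exp (- C2 * M\<^sup>2))"
          using expC2[OF C2le(1)] pos c0 by (intro mult_left_mono) auto
        finally show ?thesis by (simp add: mult.assoc)
      qed
      \<comment> \<open>The condition M \<le> C0 x turns an exponent linear in \<open>K\<close> into
        one quadratic in \<open>M\<close>.\<close>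
      have t2: "exp (- of_int K / 8) \<le> exp (- C2 * M\<^sup>2)"
      proof -
        have "M\<^sup>2 \<le> C0 * (M * x)" using mult_left_mono[OF MC, of M] M1 by (simp add: power2_eq_square mult_ac)
        also have "\<dots> \<le> C0 * (M * x\<^sup>2)" using pos M1 x1 by (intro mult_left_mono) (auto simp: power2_eq_square)
        also have "\<dots> \<le> C0 * of_int K" using Kx pos by (intro mult_left_mono) auto
        finally have "1 / (8 * C0) * M\<^sup>2 \<le> of_int K / 8" using pos by (simp add: field_simps)
        then show ?thesis using expC2[of "of_int K / 8"] C2le(2) by simp
      qed
      have CU: "C * Bc \<le> \<epsilon> * U / 32"
      proof -
        have "32 * ((c + 1) * Bc) \<le> \<epsilon> * M\<^sup>2" using M2 \<epsilon> by (simp add: pos_divide_le_eq mult.commute)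
        then have "32 * ((c + 1) * Bc) * x \<le> \<epsilon> * M\<^sup>2 * x" using x0 by (intro mult_right_mono)
        then show ?thesis by (simp add: C_def U_def mult_ac)
      qed
      \<comment> \<open>The exponent of the field deviations is cubic in \<open>M\<close>; since M
        \<ge> 1 it dominates the quadratic rate.\<close>
      have \<delta>U: "C2 * M\<^sup>2 \<le> \<delta> * (\<epsilon> * U / 32)"
      proof -
        have "\<delta> * (\<epsilon> * U / 32) = \<epsilon>\<^sup>2 / 32 * M ^ 3"
          using x1 by (simp add: \<delta>_def U_def power2_eq_square power3_eq_cube)
        moreover have "\<epsilon>\<^sup>2 / 32 * M\<^sup>2 \<le> \<epsilon>\<^sup>2 / 32 * M ^ 3" using MM by (intro mult_left_mono) auto
        ultimately show ?thesis using C2le(3) by linarith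
      qed
      have t3: "exp (- \<delta> * (v1 - C * (2 / \<rho> + 2 / (1 - \<rho>)))) \<le> exp (- C2 * M\<^sup>2)"
      proof -
        have "\<delta> * (\<epsilon> * U / 32) \<le> \<delta> * (v1 - C * Bc)"
          using CU \<delta>0 by (intro mult_left_mono) (auto simp: v1_def mult.commute)
        from expC2[OF order_trans[OF \<delta>U this]] show ?thesis by (simp only: Bc_def mult_minus_left)
      qed
      have \<delta>N: "36 * \<delta>\<^sup>2 * real N / (\<rho> * (1 - \<rho>)) \<le> \<epsilon> * U / 4"
      proof -
        have "36 * \<delta>\<^sup>2 * real N = 36 * \<epsilon> * (\<epsilon> * U)"
          using x1 by (simp add: \<delta>_def U_def Nx power2_eq_square power3_eq_cube)
        also have "\<dots> \<le> \<rho> * (1 - \<rho>) / 4 * (\<epsilon> * U)" using \<epsilon>2 \<epsilon> U by (intro mult_right_mono) auto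
        finally have "36 * \<delta>\<^sup>2 * real N \<le> \<epsilon> * U / 4 * (\<rho> * (1 - \<rho>))" by (simp add: mult_ac)
        then show ?thesis using \<rho> by (simp add: pos_divide_le_eq)
      qed
      have t4: "exp (- \<delta> * (v2 - 36 * \<delta>\<^sup>2 * real N / (\<rho> * (1 - \<rho>)) - C * (2 / \<rho> + 2 / (1 - \<rho>)))) \<le> exp (- C2 * M\<^sup>2)"
      proof -
        let ?v = "v2 - 36 * \<delta>\<^sup>2 * real N / (\<rho> * (1 - \<rho>)) - C * Bc"
        have "0 \<le> \<epsilon> * U" using \<epsilon> U by simp
        then have "\<epsilon> * U / 32 \<le> ?v" using CU \<delta>N unfolding v2_def by linarith
        then have "\<delta> * (\<epsilon> * U / 32) \<le> \<delta> * ?v" using \<delta>0 by (intro mult_left_mono) auto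
        from expC2[OF order_trans[OF \<delta>U this]] show ?thesis by (simp only: Bc_def mult_minus_left)
      qed
      have T: "?T \<le> C1 / 2 * exp (- C2 * M\<^sup>2)"
      proof -
        have "C1 / 2 * u = C3 * (216 / c0 ^ 3) * u + u + u + u" for u
          by (simp add: C1_def algebra_simps)
        then show ?thesis
          unfolding exit_tail_bound_def by (simp only:) (intro add_mono t1 t2 t3 t4)
      qed
      obtain S1 S2 where S: "S1 \<in> events" "S2 \<in> events" "prob S1 \<le> ?T" "prob S2 \<le> ?T"
        and ae: "AE s in \<Omega>. K \<le> ?Z s \<longrightarrow> s \<in> S1" "AE s in \<Omega>. ?Z s \<le> - K \<longrightarrow> s \<in> S2"
        using right left by blast
      have "AE s in \<Omega>. s \<in> ?A \<longrightarrow> s \<in> S1 \<union> S2"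
        using ae
      proof eventually_elim
        case (elim s)
        show ?case
        proof
          assume "s \<in> ?A"
          then have "K \<le> \<bar>?Z s\<bar>" by (simp add: K_def ceiling_le_iff)
          then show "s \<in> S1 \<union> S2" using elim by (auto simp: abs_if split: if_splits)
        qed
      qed
      then have "prob ?A \<le> prob (S1 \<union> S2)" using S by (intro finite_measure_mono_AE) auto
      also have "\<dots> \<le> prob S1 + prob S2" using S by (intro measure_Un_le)
      also have "\<dots> \<le> C1 * exp (- C2 * M\<^sup>2)" using S T by simp
      finally show ?thesis .
    qed
    have "end_point \<rho> N (c * real N powr (1/3)) = (m, n)"
      by (simp add: end_point_def m_def n_def x_def)
    then show ?thesis using A unfolding x2 by simp
  qed
  show ?thesis
    using C1 C2 main by blast
qed

end
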